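(* Let $u$ be a limit, along a subsequence $h\to0$, of the family $(u_h)_h$ of discrete minimizing evolutions built from the initial function $u_0$ and the obstacle $u^+$. Then $u$ is the viscosity solution of $$u_t=|Du|\operatorname{div}\left(\frac{Du}{|Du|}\right)$$ with obstacles $u^-\equiv-1$ and $u^+$ and initial condition $u_0$.
   Context: Standing assumptions. $\operatorname{Per}$ is the perimeter of a set of finite perimeter in $\mathbb R^n$; $d_E$ is the signed distance function to $E$ (positive outside $E$, negative inside). A set $E\subset\mathbb R^n$ is a minimizing hull if $|\partial E|=0$ and $\operatorname{Per}(E)\le\operatorname{Per}(F)$ for all $F\supset E$ with $F\setminus E$ compact. $u_0:\mathbb R^n\to[-1,1]$ is uniformly continuous and each sublevel set $E_s:=\{u_0\le s\}$, $s\in[-1,1]$, is a minimizing hull. $u^+:\mathbb R^n\to[-1,1]$ is uniformly continuous (and independent of time) with $u^+\ge u_0$; $u^-\equiv-1$. Discrete flow. For an obstacle $\Omega$, a minimizing hull $E\supset\Omega$ and $h>0$, $T_h(E)$ denotes the maximal (for inclusion) minimizer of $F\mapsto\operatorname{Per}(F)+\frac1h\int_F d_E$ among sets $F\supset\Omega$ (it is known that it exists, is unique, is contained in $E$ and is again a minimizing hull). For $s\in[-1,1]$ put $\Omega_s:=\{u^+\le s\}\subset E_s$ and $(E_s)_h(t):=T_h^{\lfloor t/h\rfloor}(E_s)$, with $T_h$ computed with obstacle $\Omega_s$. The function $u_h:\mathbb R^n\times[0,T)\to[-1,1]$ is defined by $\{u_h(\cdot,t)\le s\}=(E_s)_h(t)$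 for all $s\in[-1,1]$. Up to a subsequence, $(u_h)_h$ has a limit as $h\to0$ which is uniformly continuous in space and time. Viscosity solution. Let $F(p,X)=-\operatorname{Tr}\left(\left(I-\frac{p\otimes p}{|p|^2}\right)X\right)$ for $p\ne0$, with upper and lower semicontinuous envelopes $F^\ast$, $F_\ast$ on $\mathbb R^n\times\mathcal S_n$ ($\mathcal S_n$ the symmetric $n\times n$ matrices). A subsolution is an upper semicontinuous $u$ on $\mathbb R^n\times[0,T)$ with $u^-\le u\le u^+$, $u(\cdot,0)\le u_0$, and such that whenever $\varphi$ is a $C^2$ function of $(x,t)$, $(\hat x,\hat t)\in\mathbb R^n\times(0,T)$ is a maximizer of $u-\varphi$ and $u(\hat x,\hat t)>u^-(\hat x,\hat t)$, one has $\varphi_t+F_\ast(D\varphi,D^2\varphi)\le0$ at $(\hat x,\hat t)$. A supersolution is a lower semicontinuous $u$ with $u^-\le u\le u^+$, $u(\cdot,0)\ge u_0$, and such that whenever $\varphi$ is $C^2$, $(\hat x,\hat t)\in\mathbb R^n\times(0,T)$ is a minimizer of $u-\varphi$ and $u(\hat x,\hat t)<u^+(\hat x,\hat t)$, one has $\varphi_t+F^\ast(D\varphi,D^2\varphi)\ge0$ at $(\hat x,\hat t)$. A solution is both. *)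

theory Defs
  imports "HOL-Analysis.Analysis"
begin

section \<open>Differentiability classes\<close>

definition partial_deriv ::
    "'a::real_normed_vector \<Rightarrow> ('a \<Rightarrow> 'b::real_normed_vector) \<Rightarrow> 'a \<Rightarrow> 'b" where
  "partial_deriv v f z = frechet_derivative f (at z) v"

definition C1 :: "('a::euclidean_space \<Rightarrow> 'b::real_normed_vector) \<Rightarrow> bool" where
  "C1 f \<longleftrightarrow> (\<forall>z. f differentiable (at z)) \<and> (\<forall>b\<in>Basis. continuous_on UNIV (partial_deriv b f))"

definition C2 :: "('a::euclidean_space \<Rightarrow> 'b::real_normed_vector) \<Rightarrow> bool" where
  "C2 f \<longleftrightarrow> C1 f \<and> (\<forall>b\<in>Basis. C1 (partial_deriv b f))"

section \<open>Perimeter and minimizing hulls\<close>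

definition divergence :: "(real^'n \<Rightarrow> real^'n) \<Rightarrow> real^'n \<Rightarrow> real" where
  "divergence X x = (\<Sum>i\<in>UNIV. partial_deriv (axis i 1) X x $ i)"

text \<open>De Giorgi's perimeter, with value \<open>\<infinity>\<close> when the set does not have finite perimeter;
  it is meant for Lebesgue measurable sets. Truncating at 0 by \<open>ennreal\<close> is harmless
  because the zero field is admissible.\<close>

definition perimeter :: "(real^'n) set \<Rightarrow> ennreal" where
  "perimeter E =
    (SUP X\<in>{X. C1 X \<and> compact (closure {x. X x \<noteq> 0}) \<and> (\<forall>x. norm (X x) \<le> 1)}.
       ennreal (LINT x:E|lebesgue. divergence X x))"

text \<open>Competitors are relatively compact perturbations: perimeters do not see null sets, whereas
  for a closed \<open>E\<close> literal compactness of \<open>F - E\<close> would force it to lie at positive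
  distance from \<open>E\<close>.\<close>

definition minimizing_hull :: "(real^'n) set \<Rightarrow> bool" where
  "minimizing_hull E \<longleftrightarrow>
    negligible (frontier E) \<and>
    (\<forall>F. F \<in> sets lebesgue \<and> E \<subseteq> F \<and> compact (closure (F - E)) \<longrightarrow> perimeter E \<le> perimeter F)"

section \<open>The discrete flow\<close>

text \<open>The extended-real infima give distance \<open>\<infinity>\<close> to the empty set, so that
  the signed distance is \<open>\<infinity>\<close> for \<open>E = {}\<close> and \<open>-\<infinity>\<close> for \<open>E = UNIV\<close>.\<close>

definition signed_dist :: "(real^'n) set \<Rightarrow> real^'n \<Rightarrow> ereal" where
  "signed_dist E x = (INF y\<in>E. ereal (dist x y)) - (INF y\<in>-E. ereal (dist x y))"

definition signed_dist_pos :: "(real^'n) set \<Rightarrow> (real^'n) set \<Rightarrow> ennreal" where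
  "signed_dist_pos E F = (\<integral>\<^sup>+ x\<in>F. e2ennreal (signed_dist E x) \<partial>lebesgue)"

definition signed_dist_neg :: "(real^'n) set \<Rightarrow> (real^'n) set \<Rightarrow> ennreal" where
  "signed_dist_neg E F = (\<integral>\<^sup>+ x\<in>F. e2ennreal (- signed_dist E x) \<partial>lebesgue)"

text \<open>\<open>e2ennreal\<close> truncates at 0, so the two integrals above are those of the positive and
  negative parts of the signed distance.\<close>

definition flow_energy :: "real \<Rightarrow> (real^'n) set \<Rightarrow> (real^'n) set \<Rightarrow> ereal" where
  "flow_energy h E F =
    enn2ereal (perimeter F)
    + ereal (1 / h) * (enn2ereal (signed_dist_pos E F) - enn2ereal (signed_dist_neg E F))"

text \<open>Sets of finite perimeter above the obstacle for which the integral of the signed distance is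
  defined in the extended reals.\<close>

definition flow_competitor :: "(real^'n) set \<Rightarrow> (real^'n) set \<Rightarrow> (real^'n) set \<Rightarrow> bool" where
  "flow_competitor \<Omega> E F \<longleftrightarrow>
    F \<in> sets lebesgue \<and> \<Omega> \<subseteq> F \<and> perimeter F < \<infinity> \<and>
    (signed_dist_pos E F < \<infinity> \<or> signed_dist_neg E F < \<infinity>)"

definition flow_minimizer :: "(real^'n) set \<Rightarrow> real \<Rightarrow> (real^'n) set \<Rightarrow> (real^'n) set \<Rightarrow> bool" where
  "flow_minimizer \<Omega> h E F \<longleftrightarrow>
    flow_competitor \<Omega> E F \<and>
    (\<forall>G. flow_competitor \<Omega> E G \<longrightarrow> flow_energy h E F \<le> flow_energy h E G)"

text \<open>\<open>flow_step \<Omega> h E F\<close> expresses \<open>F = T\<^sub>h(E)\<close>. The energy is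
  invariant under null modifications, so the maximal minimizer is only determined up to null sets.
  The last two conjuncts select the closed representative without spurious null parts outside
  \<open>\<Omega>\<close>; this makes \<open>F\<close> unique as a point set.\<close>

definition flow_step :: "(real^'n) set \<Rightarrow> real \<Rightarrow> (real^'n) set \<Rightarrow> (real^'n) set \<Rightarrow> bool" where
  "flow_step \<Omega> h E F \<longleftrightarrow>
    flow_minimizer \<Omega> h E F \<and>
    (\<forall>G. flow_minimizer \<Omega> h E G \<longrightarrow> negligible (G - F)) \<and>
    closed F \<and>
    (\<forall>x\<in>F - \<Omega>. \<forall>r>0. \<not> negligible (F \<inter> ball x r))"

lemma flow_step_unique:
  assumes "flow_step \<Omega> h E F" and "flow_step \<Omega> h E G"
  shows "F = G"
proof -
  have sub: "F \<subseteq> G" if F: "flow_step \<Omega> h E F" and G: "flow_step \<Omega> h E G" for F G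
  proof
    fix x assume x: "x \<in> F"
    show "x \<in> G"
    proof (rule ccontr)
      assume nx: "x \<notin> G"
      have "\<Omega> \<subseteq> G" and cl: "closed G" and neg: "negligible (F - G)"
        using F G by (auto simp: flow_step_def flow_minimizer_def flow_competitor_def)
      from cl nx obtain r where r: "r > 0" "ball x r \<subseteq> - G"
        by (metis ComplI open_Compl open_contains_ball)
      have "negligible (F \<inter> ball x r)"
        using neg by (rule negligible_subset) (use r in auto)
      moreover have "x \<in> F - \<Omega>"
        using x nx \<open>\<Omega> \<subseteq> G\<close> by auto
      ultimately show False
        using F r(1) unfolding flow_step_def by blast
    qed
  qed
  show ?thesis using sub assms by blast
qed

text \<open>\<open>v\<close> is the function \<open>u\<^sub>h\<close> on \<open>UNIV \<times> {0..<T}\<close> built from the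
  initial function \<open>u0\<close> and the obstacle \<open>up\<close>; \<open>G k\<close> is the \<open>k\<close>-th
  iterate of \<open>T\<^sub>h\<close> starting from the sublevel set of \<open>u0\<close>.\<close>

definition discrete_evolution ::
    "real \<Rightarrow> (real^'n \<Rightarrow> real) \<Rightarrow> (real^'n \<Rightarrow> real) \<Rightarrow> real \<Rightarrow> ((real^'n) \<times> real \<Rightarrow> real) \<Rightarrow> bool" where
  "discrete_evolution T u0 up h v \<longleftrightarrow>
    (\<forall>x. \<forall>t\<in>{0..<T}. v (x, t) \<in> {-1..1}) \<and>
    (\<forall>s\<in>{-1..1}. \<exists>G.
       G 0 = {x. u0 x \<le> s} \<and>
       (\<forall>k. flow_step {x. up x \<le> s} h (G k) (G (Suc k))) \<and>
       (\<forall>t\<in>{0..<T}. {x. v (x, t) \<le> s} = G (nat \<lfloor>t / h\<rfloor>)))"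

section \<open>Viscosity solutions with obstacles\<close>

definition mcf_F :: "real^'n \<Rightarrow> real^'n^'n \<Rightarrow> real" where
  "mcf_F p X = - trace ((mat 1 - (\<chi> i j. p $ i * p $ j / (norm p)\<^sup>2)) ** X)"

text \<open>The semicontinuous envelopes of \<open>mcf_F\<close>, as a function on the pairs \<open>(q, Y)\<close> with
  \<open>q \<noteq> 0\<close> and \<open>Y\<close> symmetric. The filter does not exclude the point \<open>(p, X)\<close> itself.\<close>

definition mcf_filter :: "real^'n \<Rightarrow> real^'n^'n \<Rightarrow> ((real^'n) \<times> (real^'n^'n)) filter" where
  "mcf_filter p X = inf (nhds (p, X)) (principal {(q, Y). q \<noteq> 0 \<and> transpose Y = Y})"

definition mcf_F_upper :: "real^'n \<Rightarrow> real^'n^'n \<Rightarrow> ereal" where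
  "mcf_F_upper p X = Limsup (mcf_filter p X) (\<lambda>(q, Y). ereal (mcf_F q Y))"

definition mcf_F_lower :: "real^'n \<Rightarrow> real^'n^'n \<Rightarrow> ereal" where
  "mcf_F_lower p X = Liminf (mcf_filter p X) (\<lambda>(q, Y). ereal (mcf_F q Y))"

definition time_deriv :: "((real^'n) \<times> real \<Rightarrow> real) \<Rightarrow> (real^'n) \<times> real \<Rightarrow> real" where
  "time_deriv \<phi> z = partial_deriv (0, 1) \<phi> z"

definition space_grad :: "((real^'n) \<times> real \<Rightarrow> real) \<Rightarrow> (real^'n) \<times> real \<Rightarrow> real^'n" where
  "space_grad \<phi> z = (\<chi> i. partial_deriv (axis i 1, 0) \<phi> z)"

definition space_hess :: "((real^'n) \<times> real \<Rightarrow> real) \<Rightarrow> (real^'n) \<times> real \<Rightarrow> real^'n^'n" where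
  "space_hess \<phi> z =
    (\<chi> i j. partial_deriv (axis i 1, 0) (partial_deriv (axis j 1, 0) \<phi>) z)"

definition upper_semicont_on :: "'a::topological_space set \<Rightarrow> ('a \<Rightarrow> real) \<Rightarrow> bool" where
  "upper_semicont_on S f \<longleftrightarrow>
    (\<forall>z\<in>S. \<forall>a. f z < a \<longrightarrow> (\<forall>\<^sub>F y in at z within S. f y < a))"

definition lower_semicont_on :: "'a::topological_space set \<Rightarrow> ('a \<Rightarrow> real) \<Rightarrow> bool" where
  "lower_semicont_on S f \<longleftrightarrow>
    (\<forall>z\<in>S. \<forall>a. a < f z \<longrightarrow> (\<forall>\<^sub>F y in at z within S. a < f y))"

text \<open>The equation \<open>u\<^sub>t = \<bar>Du\<bar> div (Du / \<bar>Du\<bar>)\<close> reads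
  \<open>u\<^sub>t + F(Du, D\<^sup>2u) = 0\<close> with \<open>F = mcf_F\<close>, since
  \<open>\<bar>p\<bar> div (p / \<bar>p\<bar>) = Tr ((I - p \<otimes> p / \<bar>p\<bar>\<^sup>2) D\<^sup>2u)\<close> for \<open>p = Du \<noteq> 0\<close>.\<close>

definition mcf_subsolution ::
    "real \<Rightarrow> ((real^'n) \<times> real \<Rightarrow> real) \<Rightarrow> ((real^'n) \<times> real \<Rightarrow> real) \<Rightarrow> (real^'n \<Rightarrow> real)
      \<Rightarrow> ((real^'n) \<times> real \<Rightarrow> real) \<Rightarrow> bool" where
  "mcf_subsolution T um up u0 u \<longleftrightarrow>
    upper_semicont_on (UNIV \<times> {0..<T}) u \<and>
    (\<forall>z\<in>UNIV \<times> {0..<T}. um z \<le> u z \<and> u z \<le> up z) \<and>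
    (\<forall>x. u (x, 0) \<le> u0 x) \<and>
    (\<forall>\<phi>. \<forall>z\<in>UNIV \<times> {0<..<T}.
       C2 \<phi> \<and> (\<forall>y\<in>UNIV \<times> {0..<T}. u y - \<phi> y \<le> u z - \<phi> z) \<and> um z < u z \<longrightarrow>
       ereal (time_deriv \<phi> z) + mcf_F_lower (space_grad \<phi> z) (space_hess \<phi> z) \<le> 0)"

definition mcf_supersolution ::
    "real \<Rightarrow> ((real^'n) \<times> real \<Rightarrow> real) \<Rightarrow> ((real^'n) \<times> real \<Rightarrow> real) \<Rightarrow> (real^'n \<Rightarrow> real)
      \<Rightarrow> ((real^'n) \<times> real \<Rightarrow> real) \<Rightarrow> bool" where
  "mcf_supersolution T um up u0 u \<longleftrightarrow>
    lower_semicont_on (UNIV \<times> {0..<T}) u \<and>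
    (\<forall>z\<in>UNIV \<times> {0..<T}. um z \<le> u z \<and> u z \<le> up z) \<and>
    (\<forall>x. u0 x \<le> u (x, 0)) \<and>
    (\<forall>\<phi>. \<forall>z\<in>UNIV \<times> {0<..<T}.
       C2 \<phi> \<and> (\<forall>y\<in>UNIV \<times> {0..<T}. u z - \<phi> z \<le> u y - \<phi> y) \<and> u z < up z \<longrightarrow>
       0 \<le> ereal (time_deriv \<phi> z) + mcf_F_upper (space_grad \<phi> z) (space_hess \<phi> z))"

definition mcf_viscosity_solution ::
    "real \<Rightarrow> ((real^'n) \<times> real \<Rightarrow> real) \<Rightarrow> ((real^'n) \<times> real \<Rightarrow> real) \<Rightarrow> (real^'n \<Rightarrow> real)
      \<Rightarrow> ((real^'n) \<times> real \<Rightarrow> real) \<Rightarrow> bool" where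
  "mcf_viscosity_solution T um up u0 u \<longleftrightarrow>
    mcf_subsolution T um up u0 u \<and> mcf_supersolution T um up u0 u"

end

theory Submission
  imports Defs
begin

text \<open>Let \<open>F = T\<^sub>h(E)\<close>. Away from the obstacle, cutting \<open>F\<close> with a superlevel set of a smooth function that
  touches \<open>F\<close> from outside, or dually adding to \<open>F\<close>, changes the perimeter by at most the integral
  of the divergence of the unit normal field (a calibration). Minimality of \<open>F\<close> thus gives
  \<open>d\<^sub>E / h + div \<nu> \<le> 0\<close> at points near the contact, a discrete form of the mean curvature equation. For a test
  function with nonzero gradient touching the limit from below, the level sets of \<open>u\<^sub>h\<close> are touched nearby, and
  \<open>d\<^sub>E / h\<close> is bounded from below by \<open>- \<phi>\<^sub>t / \<bar>D\<phi>\<bar>\<close> up to a small error. Test functions with zero gradient are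
  reduced to the former case by doubling the space variable, and otherwise excluded by comparison with shrinking
  balls. The subsolution property is the supersolution property of \<open>-u\<close> for the complements of the
  level sets. The hull property of the initial sets excludes jumps of the discrete flow to the whole space: it makes
  all sublevel sets below the supremum of \<open>u\<^sub>0\<close> bounded, and they remain bounded along the flow.\<close>

section \<open>Perimeter and divergence\<close>

text \<open>No regularity of minimizers is available, so curvature at a contact point has no direct
  meaning. The inequality is obtained in integrated form over a small piece cut off the set, and a
  point where it holds is extracted because the piece has positive measure; hence the insistence on
  representatives without null parts. Cutting from \<open>F\<close> and adding to \<open>F\<close>
  (cutting from \<open>- F\<close>) share the predicate \<open>cut_step\<close>, and the passage to
  the limit is carried out once, in \<open>scheme_limit\<close>; only cutting from \<open>F\<close>
  sees the obstacle.

  In that common setting the discrete functions carry no semicontinuity, so minima are replaced by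
  near-minima with a defect \<open>\<sigma>\<close>. One step moves sets by a distance of order
  \<open>h\<close>, and the argument compares such displacements; therefore \<open>\<sigma>\<close>
  is chosen after \<open>h\<close> and small compared with it.

  Penalties are fourth powers. Their derivatives up to order two vanish at the centre, so they do
  not disturb a contact. When the gradient vanishes, a ball of radius R survives for a time of order
  R^2, while a quartic penalty asks only for a time of order R^4.\<close>

lemma C1I:
  fixes f :: "'a::euclidean_space \<Rightarrow> 'b::real_normed_vector"
  assumes "\<And>x. (f has_derivative f' x) (at x)"
    and "\<And>b. b \<in> Basis \<Longrightarrow> continuous_on UNIV (\<lambda>x. f' x b)"
  shows "C1 f"
proof -
  have "partial_deriv b f = (\<lambda>x. f' x b)" for b
    using frechet_derivative_at[OF assms(1)] by (auto simp: partial_deriv_def)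
  then show ?thesis
    using assms by (auto simp: C1_def differentiable_def)
qed

lemma partial_deriv_eq:
  assumes "(f has_derivative f') (at x)"
  shows "partial_deriv b f x = f' b"
  using frechet_derivative_at[OF assms] by (simp add: partial_deriv_def)

lemma C1_has_derivative:
  fixes f :: "'a::euclidean_space \<Rightarrow> 'b::real_normed_vector"
  assumes "C1 f"
  shows "(f has_derivative (\<lambda>v. \<Sum>b\<in>Basis. (v \<bullet> b) *\<^sub>R partial_deriv b f x)) (at x)"
proof -
  obtain f' where f': "(f has_derivative f') (at x)"
    using assms by (auto simp: C1_def differentiable_def)
  have "f' v = (\<Sum>b\<in>Basis. (v \<bullet> b) *\<^sub>R partial_deriv b f x)" for v
  proof -
    have "f' v = f' (\<Sum>b\<in>Basis. (v \<bullet> b) *\<^sub>R b)"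
      by (simp add: euclidean_representation)
    also have "\<dots> = (\<Sum>b\<in>Basis. (v \<bullet> b) *\<^sub>R f' b)"
      using has_derivative_linear[OF f'] by (simp add: linear_sum linear_cmul)
    finally show ?thesis
      by (simp add: partial_deriv_eq[OF f'])
  qed
  then have "f' = (\<lambda>v. \<Sum>b\<in>Basis. (v \<bullet> b) *\<^sub>R partial_deriv b f x)" by (rule ext)
  with f' show ?thesis by simp
qed

lemma C1_continuous_on: "C1 f \<Longrightarrow> continuous_on S f"
  by (meson C1_has_derivative continuous_at_imp_continuous_on has_derivative_continuous)

lemma C1_cont_partial: "C1 f \<Longrightarrow> b \<in> Basis \<Longrightarrow> continuous_on S (partial_deriv b f)"
  unfolding C1_def using continuous_on_subset by blast

lemma axis_Basis [simp]: "axis i (1::real) \<in> Basis"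
  by (simp add: axis_in_Basis_iff)

lemma C1_component:
  fixes X :: "real^'n \<Rightarrow> real^'n"
  assumes "C1 X"
  shows "C1 (\<lambda>x. X x $ i)" "partial_deriv b (\<lambda>x. X x $ i) x = partial_deriv b X x $ i"
proof -
  note d = C1_has_derivative[OF assms]
  have di: "((\<lambda>x. X x $ i) has_derivative (\<lambda>v. (\<Sum>b\<in>Basis. (v \<bullet> b) *\<^sub>R partial_deriv b X x) $ i)) (at x)" for x
    using bounded_linear.has_derivative[OF bounded_linear_vec_nth d] .
  show "partial_deriv b (\<lambda>x. X x $ i) x = partial_deriv b X x $ i"
    by (rule trans[OF partial_deriv_eq[OF di] arg_cong[where f="\<lambda>v. v $ i", OF partial_deriv_eq[OF d, symmetric]]])
  show "C1 (\<lambda>x. X x $ i)"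
  proof (rule C1I[OF di])
    fix b :: "real^'n" assume b: "b \<in> Basis"
    have "continuous_on UNIV (\<lambda>x. partial_deriv b X x $ i)"
      using C1_cont_partial[OF assms b] by (intro continuous_intros)
    moreover have "(\<Sum>c\<in>Basis. (b \<bullet> c) *\<^sub>R partial_deriv c X x) = partial_deriv b X x" for x
      by (rule partial_deriv_eq[OF d, symmetric])
    ultimately show "continuous_on UNIV (\<lambda>x. (\<Sum>c\<in>Basis. (b \<bullet> c) *\<^sub>R partial_deriv c X x) $ i)"
      by (simp only:)
  qed
qed

lemma partial_deriv_zero_on_open:
  assumes "open S" "x \<in> S" "\<And>y. y \<in> S \<Longrightarrow> f y = 0"
  shows "partial_deriv b f x = 0"
proof -
  have "(f has_derivative (\<lambda>_. 0)) (at x)"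
    by (rule has_derivative_transform_within_open[OF _ assms(1,2)]) (use assms in auto)
  then show ?thesis by (rule partial_deriv_eq)
qed

section \<open>Divergence theorem for compactly supported C1 fields\<close>

lemma continuous_bounded_support_bound:
  fixes f :: "'a::euclidean_space \<Rightarrow> 'b::real_normed_vector"
  assumes "continuous_on UNIV f" "\<And>x. R < norm x \<Longrightarrow> f x = 0"
  obtains B where "0 \<le> B" "\<And>x. norm (f x) \<le> B * indicator (cball 0 R) x"
proof -
  have "bounded (f ` cball 0 R)"
    by (meson assms(1) compact_cball compact_continuous_image compact_imp_bounded continuous_on_subset subset_UNIV)
  then obtain B where "\<And>x. x \<in> cball 0 R \<Longrightarrow> norm (f x) \<le> B"
    unfolding bounded_iff by blast
  then have "norm (f x) \<le> max B 0 * indicator (cball 0 R) x" for x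
  proof (cases "norm x \<le> R")
    case True
    then have "norm (f x) \<le> max B 0" using \<open>\<And>x. x \<in> cball 0 R \<Longrightarrow> norm (f x) \<le> B\<close>[of x] by simp
    then show ?thesis using True by simp
  qed (use assms(2)[of x] in auto)
  then show ?thesis using that[of "max B 0"] by auto
qed

lemma lborel_indicator_cball_integrable: "integrable lborel (\<lambda>x::'a::euclidean_space. B * indicator (cball a R) x :: real)"
proof -
  have "integrable lborel (indicator (cball a R) :: 'a \<Rightarrow> real)"
    by (rule integrable_real_indicator) (use emeasure_lborel_cball_finite[of a R] in \<open>auto simp: less_top\<close>)
  then show ?thesis by simp
qed

lemma lborel_integrable_bounded_support:
  fixes f :: "'a::euclidean_space \<Rightarrow> real"
  assumes "continuous_on UNIV f" "\<And>x. R < norm x \<Longrightarrow> f x = 0"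
  shows "integrable lborel f"
proof -
  obtain B where "\<And>x. norm (f x) \<le> B * indicator (cball 0 R) x"
    using continuous_bounded_support_bound[OF assms] by blast
  then show ?thesis
    by (intro Bochner_Integration.integrable_bound[OF lborel_indicator_cball_integrable[of B 0 R]])
      (use assms(1) in \<open>auto intro!: borel_measurable_continuous_onI AE_I2 intro: order_trans[OF _ abs_ge_self]\<close>)
qed

text \<open>The difference quotients \<open>q k\<close> integrate to zero by translation invariance
  of Lebesgue measure; the mean value theorem gives both their pointwise limit and an integrable
  bound, so dominated convergence applies.\<close>

lemma integral_partial_deriv_zero:
  fixes f :: "'a::euclidean_space \<Rightarrow> real"
  assumes "C1 f" and b: "b \<in> Basis" and supp: "\<And>x. R < norm x \<Longrightarrow> f x = 0"
  shows "integral\<^sup>L lborel (partial_deriv b f) = 0"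
proof -
  let ?p = "partial_deriv b f"
  have nb: "norm b = 1" using b by simp
  have cp: "continuous_on UNIV ?p" using C1_cont_partial[OF assms(1) b] .
  have ps: "?p x = 0" if "R < norm x" for x
    by (rule partial_deriv_zero_on_open[of "- cball 0 R"]) (use that supp in auto)
  obtain B where B: "0 \<le> B" "\<And>x. norm (?p x) \<le> B * indicator (cball 0 R) x"
    using continuous_bounded_support_bound[OF cp ps] by blast
  have B1: "\<bar>?p x\<bar> \<le> B" for x
    using B(2)[of x] B(1) by (cases "norm x \<le> R") auto
  define q where "q k x = real (Suc k) * (f (x + (1 / real (Suc k)) *\<^sub>R b) - f x)" for k x
  have dline: "((\<lambda>t. f (x + t *\<^sub>R b)) has_real_derivative ?p (x + t *\<^sub>R b)) (at t)" for x t
  proof -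
    have "((\<lambda>t. f (x + t *\<^sub>R b)) has_derivative
        (\<lambda>s. \<Sum>c\<in>Basis. ((s *\<^sub>R b) \<bullet> c) *\<^sub>R partial_deriv c f (x + t *\<^sub>R b))) (at t)"
      by (rule has_derivative_compose[OF _ C1_has_derivative[OF assms(1)]])
        (auto intro!: derivative_eq_intros)
    moreover have "(\<Sum>c\<in>Basis. ((s *\<^sub>R b) \<bullet> c) *\<^sub>R partial_deriv c f (x + t *\<^sub>R b)) = ?p (x + t *\<^sub>R b) * s" for s
    proof -
      have "(\<Sum>c\<in>Basis. ((s *\<^sub>R b) \<bullet> c) *\<^sub>R partial_deriv c f (x + t *\<^sub>R b))
        = (\<Sum>c\<in>Basis. if c = b then s * ?p (x + t *\<^sub>R b) else 0)"
        by (rule sum.cong) (use b in \<open>auto simp: inner_Basis\<close>)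
      then show ?thesis using b by simp
    qed
    ultimately show ?thesis
      by (simp only: has_field_derivative_def)
  qed
  have If: "integrable lborel f"
    using lborel_integrable_bounded_support[OF C1_continuous_on[OF assms(1)] supp] .
  have shift: "integrable lborel (\<lambda>x. f (x + c))" "integral\<^sup>L lborel (\<lambda>x. f (x + c)) = integral\<^sup>L lborel f" for c
  proof -
    have m: "(\<lambda>x::'a. c + x) \<in> measurable lborel borel" by simp
    have e: "distr lborel borel ((+) c) = (lborel :: 'a measure)" by (rule lborel_distr_plus)
    have fm: "f \<in> borel_measurable borel"
      using C1_continuous_on[OF assms(1)] by (rule borel_measurable_continuous_onI)
    show "integrable lborel (\<lambda>x. f (x + c))"
      using integrable_distr_eq[OF m fm] If unfolding e by (simp add: add.commute)
    show "integral\<^sup>L lborel (\<lambda>x. f (x + c)) = integral\<^sup>L lborel f"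
      using integral_distr[OF m fm] unfolding e by (simp add: add.commute)
  qed
  have q0: "integral\<^sup>L lborel (q k) = 0" for k
    unfolding q_def using shift If by simp
  have mvt: "\<exists>\<tau>. 0 < \<tau> \<and> \<tau> < 1 / real (Suc k) \<and> q k x = ?p (x + \<tau> *\<^sub>R b)" for k x
  proof -
    have "\<exists>\<tau>. 0 < \<tau> \<and> \<tau> < 1 / real (Suc k) \<and>
       f (x + (1 / real (Suc k)) *\<^sub>R b) - f (x + 0 *\<^sub>R b) = (1 / real (Suc k) - 0) * ?p (x + \<tau> *\<^sub>R b)"
      by (rule MVT2) (use dline in auto)
    then show ?thesis by (auto simp: q_def field_simps)
  qed
  \<comment> \<open>The intermediate point lies within distance 1 of \<open>x\<close>, so the
    supports stay in the ball of radius \<open>R + 1\<close> uniformly in \<open>k\<close>.\<close>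
  have bound: "norm (q k x) \<le> B * indicator (cball 0 (R + 1)) x" for k x
  proof -
    obtain \<tau> where t: "0 < \<tau>" "\<tau> < 1 / real (Suc k)" "q k x = ?p (x + \<tau> *\<^sub>R b)"
      using mvt by blast
    have t1: "\<tau> \<le> 1"
    proof -
      have "1 / real (Suc k) \<le> 1" by simp
      then show ?thesis using t by linarith
    qed
    show ?thesis
    proof (cases "norm x \<le> R + 1")
      case True then show ?thesis using t B1 by simp
    next
      case False
      have "norm x \<le> norm (x + \<tau> *\<^sub>R b) + norm (\<tau> *\<^sub>R b)"
        by (metis add_diff_cancel_right' norm_triangle_ineq4)
      then have "R < norm (x + \<tau> *\<^sub>R b)" using False t1 t(1) nb by simp
      then show ?thesis using t(3) ps by (simp add: False)
    qed
  qed
  have lim: "(\<lambda>k. q k x) \<longlonglongrightarrow> ?p x" for x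
  proof -
    have "\<forall>k. \<exists>\<tau>. 0 < \<tau> \<and> \<tau> < 1 / real (Suc k) \<and> q k x = ?p (x + \<tau> *\<^sub>R b)" using mvt by blast
    then obtain \<tau> where t: "\<And>k. 0 < \<tau> k" "\<And>k. \<tau> k < 1 / real (Suc k)" "\<And>k. q k x = ?p (x + \<tau> k *\<^sub>R b)"
      by metis
    have "\<tau> \<longlonglongrightarrow> 0"
      by (rule tendsto_sandwich[OF _ _ tendsto_const lim_1_over_n[THEN LIMSEQ_Suc]])
        (use t in \<open>auto intro!: always_eventually less_imp_le\<close>)
    then have "(\<lambda>k. x + \<tau> k *\<^sub>R b) \<longlonglongrightarrow> x + 0 *\<^sub>R b"
      by (intro tendsto_intros)
    then have "(\<lambda>k. ?p (x + \<tau> k *\<^sub>R b)) \<longlonglongrightarrow> ?p x"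
      using cp by (intro isCont_tendsto_compose[of x ?p]) (auto simp: continuous_on_eq_continuous_at)
    then show ?thesis using t(3) by presburger
  qed
  have fm: "f \<in> borel_measurable borel"
    using C1_continuous_on[OF assms(1)] by (rule borel_measurable_continuous_onI)
  have "(\<lambda>k. integral\<^sup>L lborel (q k)) \<longlonglongrightarrow> integral\<^sup>L lborel ?p"
  proof (rule integral_dominated_convergence)
    show "?p \<in> borel_measurable lborel"
      using cp by (simp add: borel_measurable_continuous_onI)
    show "q k \<in> borel_measurable lborel" for k
      unfolding q_def using fm by simp
    show "integrable lborel (\<lambda>x. B * indicator (cball 0 (R + 1)) x :: real)"
      by (rule lborel_indicator_cball_integrable)
    show "AE x in lborel. (\<lambda>k. q k x) \<longlonglongrightarrow> ?p x" using lim by simp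
    show "AE x in lborel. norm (q k x) \<le> B * indicator (cball 0 (R + 1)) x" for k using bound by simp
  qed
  then show ?thesis using q0 LIMSEQ_unique by (simp add: LIMSEQ_const_iff)
qed

section \<open>Test fields and the perimeter of complements\<close>

definition test_field :: "(real^'n \<Rightarrow> real^'n) \<Rightarrow> bool" where
  "test_field X \<longleftrightarrow> C1 X \<and> compact (closure {x. X x \<noteq> 0})"

lemma test_fieldI:
  fixes X :: "real^'n \<Rightarrow> real^'n"
  assumes "C1 X" "\<And>x. R < norm x \<Longrightarrow> X x = 0"
  shows "test_field X"
proof -
  have "{x. X x \<noteq> 0} \<subseteq> cball 0 R" using assms(2) by (force simp: not_less)
  then show ?thesis
    using assms(1) unfolding test_field_def
    by (meson bounded_cball bounded_subset compact_closure)
qed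

lemma test_fieldE:
  fixes X :: "real^'n \<Rightarrow> real^'n"
  assumes "test_field X"
  obtains R where "0 < R" "\<And>x. R < norm x \<Longrightarrow> X x = 0"
proof -
  have "bounded {x. X x \<noteq> 0}"
    using assms unfolding test_field_def by (metis bounded_subset closure_subset compact_imp_bounded)
  then obtain R where "0 < R" "\<And>x. X x \<noteq> 0 \<Longrightarrow> norm x \<le> R"
    by (auto simp: bounded_pos)
  then show ?thesis using that[of R] by (meson leD)
qed

lemma C1_continuous_divergence:
  fixes X :: "real^'n \<Rightarrow> real^'n"
  assumes "C1 X" shows "continuous_on S (divergence X)"
  unfolding divergence_def
  by (intro continuous_intros C1_cont_partial[OF assms]) simp

lemma divergence_outside:
  fixes X :: "real^'n \<Rightarrow> real^'n"
  assumes "\<And>x. R < norm x \<Longrightarrow> X x = 0" "R < norm x"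
  shows "divergence X x = 0"
proof -
  have "partial_deriv b X x = 0" for b
    by (rule partial_deriv_zero_on_open[of "- cball 0 R"]) (use assms in auto)
  then show ?thesis by (simp add: divergence_def)
qed

lemma test_field_integrable:
  fixes X :: "real^'n \<Rightarrow> real^'n"
  assumes "test_field X"
  shows "integrable lborel (divergence X)"
proof -
  obtain R where R: "\<And>x. R < norm x \<Longrightarrow> X x = 0" using test_fieldE[OF assms] by blast
  show ?thesis
    by (rule lborel_integrable_bounded_support[OF C1_continuous_divergence divergence_outside[of R]])
      (use R assms in \<open>auto simp: test_field_def\<close>)
qed

lemma test_field_integrable_lebesgue:
  fixes X :: "real^'n \<Rightarrow> real^'n"
  assumes "test_field X"
  shows "integrable lebesgue (divergence X)"
  using test_field_integrable[OF assms] by (simp add: integrable_completion borel_measurable_integrable)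

lemma test_field_set_integrable:
  fixes X :: "real^'n \<Rightarrow> real^'n"
  assumes "test_field X" "D \<in> sets lebesgue"
  shows "set_integrable lebesgue D (divergence X)"
  unfolding set_integrable_def using assms(2) test_field_integrable_lebesgue[OF assms(1)]
  by (intro integrable_mult_indicator)

lemma integral_divergence_zero:
  fixes X :: "real^'n \<Rightarrow> real^'n"
  assumes "test_field X"
  shows "integral\<^sup>L lebesgue (divergence X) = 0"
proof -
  obtain R where R: "\<And>x. R < norm x \<Longrightarrow> X x = 0" using test_fieldE[OF assms] by blast
  have C: "C1 X" using assms by (simp add: test_field_def)
  have z: "integral\<^sup>L lborel (\<lambda>x. partial_deriv (axis i 1) X x $ i) = 0" for i
  proof -
    have "integral\<^sup>L lborel (partial_deriv (axis i 1) (\<lambda>x. X x $ i)) = 0"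
      by (rule integral_partial_deriv_zero[OF C1_component(1)[OF C], where R=R]) (use R in auto)
    then show ?thesis by (simp add: C1_component(2)[OF C, abs_def])
  qed
  have i: "integrable lborel (\<lambda>x. partial_deriv (axis i 1) X x $ i)" for i
  proof (rule lborel_integrable_bounded_support)
    show "continuous_on UNIV (\<lambda>x. partial_deriv (axis i 1) X x $ i)"
      by (intro continuous_intros C1_cont_partial[OF C]) simp
    show "partial_deriv (axis i 1) X x $ i = 0" if "R < norm x" for x
      by (subst partial_deriv_zero_on_open[of "- cball 0 R"]) (use that R in auto)
  qed
  have "integral\<^sup>L lborel (divergence X) = 0"
    unfolding divergence_def using i z by simp
  then show ?thesis
    using test_field_integrable[OF assms] by (simp add: integral_completion borel_measurable_integrable)
qed

lemma test_field_uminus: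
  fixes X :: "real^'n \<Rightarrow> real^'n"
  assumes "test_field X"
  shows "test_field (\<lambda>x. - X x)" "divergence (\<lambda>x. - X x) x = - divergence X x"
proof -
  have C: "C1 X" using assms by (simp add: test_field_def)
  have d: "((\<lambda>x. - X x) has_derivative (\<lambda>v. - (\<Sum>b\<in>Basis. (v \<bullet> b) *\<^sub>R partial_deriv b X x))) (at x)" for x
    using C1_has_derivative[OF C] by (rule has_derivative_minus)
  have p: "partial_deriv b (\<lambda>x. - X x) x = - partial_deriv b X x" for b x
    by (rule trans[OF partial_deriv_eq[OF d] arg_cong[where f=uminus, OF partial_deriv_eq[OF C1_has_derivative[OF C], symmetric]]])
  show "divergence (\<lambda>x. - X x) x = - divergence X x"
    by (simp add: divergence_def p sum_negf)
  have "C1 (\<lambda>x. - X x)"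
    using d C unfolding C1_def differentiable_def p[abs_def] by (auto intro: continuous_on_minus)
  then show "test_field (\<lambda>x. - X x)" using assms by (simp add: test_field_def)
qed

lemma perimeter_alt:
  fixes D :: "(real^'n) set"
  shows "perimeter D = (SUP X\<in>{X. test_field X \<and> (\<forall>x. norm (X x) \<le> 1)}. ennreal (LINT x:D|lebesgue. divergence X x))"
  unfolding perimeter_def test_field_def by (simp add: conj_assoc)

lemma perimeter_leI:
  fixes D :: "(real^'n) set"
  assumes "\<And>X. test_field X \<Longrightarrow> (\<And>x. norm (X x) \<le> 1) \<Longrightarrow> (LINT x:D|lebesgue. divergence X x) \<le> c"
  shows "perimeter D \<le> ennreal c"
  unfolding perimeter_alt by (intro SUP_least ennreal_leI) (use assms in auto)

lemma perimeter_geD: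
  fixes D :: "(real^'n) set"
  assumes "test_field X" "\<And>x. norm (X x) \<le> 1" "perimeter D < \<infinity>"
  shows "(LINT x:D|lebesgue. divergence X x) \<le> enn2real (perimeter D)"
proof -
  have "ennreal (LINT x:D|lebesgue. divergence X x) \<le> perimeter D"
    unfolding perimeter_alt by (rule SUP_upper) (use assms in auto)
  also have "\<dots> = ennreal (enn2real (perimeter D))" using assms(3) by simp
  finally show ?thesis by simp
qed

lemma set_integral_Compl:
  fixes f :: "'a \<Rightarrow> real"
  assumes "integrable M f" "D \<in> sets M" "space M = UNIV"
  shows "(LINT x:-D|M. f x) = integral\<^sup>L M f - (LINT x:D|M. f x)"
proof -
  have s: "set_integrable M A f" if "A \<in> sets M" for A
    unfolding set_integrable_def using assms(1) that by (intro integrable_mult_indicator)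
  have "-D \<in> sets M" using assms(2,3) by (metis Compl_eq_Diff_UNIV sets.compl_sets)
  then have "(LINT x:D \<union> -D|M. f x) = (LINT x:D|M. f x) + (LINT x:-D|M. f x)"
    by (intro set_integral_Un s assms) auto
  then show ?thesis by (simp add: set_lebesgue_integral_def)
qed

text \<open>A divergence has total integral zero, so testing \<open>- D\<close> with
  \<open>X\<close> is testing \<open>D\<close> with \<open>- X\<close>, which is again admissible.
  This makes adding a set to \<open>F\<close> the same as removing it from
  \<open>- F\<close>.\<close>

lemma perimeter_Compl:
  fixes D :: "(real^'n) set"
  assumes "D \<in> sets lebesgue"
  shows "perimeter (- D) = perimeter D"
proof -
  have le: "perimeter (- D) \<le> perimeter D" if D: "D \<in> sets lebesgue" for D :: "(real^'n) set"
    unfolding perimeter_alt[of "-D"]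
  proof (rule SUP_least)
    fix X :: "real^'n \<Rightarrow> real^'n" assume X: "X \<in> {X. test_field X \<and> (\<forall>x. norm (X x) \<le> 1)}"
    have i: "integrable lebesgue (divergence X)"
      using test_field_integrable_lebesgue X by blast
    have dv: "divergence (\<lambda>x. - X x) = (\<lambda>x. - divergence X x)"
      using X test_field_uminus(2)[of X] by auto
    have "(LINT x:-D|lebesgue. divergence X x) = (LINT x:D|lebesgue. divergence (\<lambda>x. - X x) x)"
      using set_integral_Compl[OF i D] integral_divergence_zero[of X] X
      by (simp add: dv set_lebesgue_integral_def)
    then show "ennreal (LINT x:-D|lebesgue. divergence X x) \<le> perimeter D"
      unfolding perimeter_alt[of D]
      by (intro SUP_upper2[of "\<lambda>x. - X x"]) (use X test_field_uminus(1)[of X] in auto)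
  qed
  have "- D \<in> sets lebesgue" using assms by (simp add: Compl_in_sets_lebesgue)
  from le[OF this] le[OF assms] show ?thesis by simp
qed

lemma perimeter_empty [simp]: "perimeter ({}::(real^'n) set) = 0"
  using perimeter_leI[of "{}::(real^'n) set" 0] by (simp add: set_lebesgue_integral_def)

lemma perimeter_UNIV [simp]: "perimeter (UNIV::(real^'n) set) = 0"
  using perimeter_Compl[of "{}::(real^'n) set"] by simp

section \<open>Cutting a set along a calibrated hypersurface\<close>

text \<open>The one-sided difference quotients have the same limit. Gluing along tangents gives C1
  functions such as \<open>sqpos\<close> and \<open>rsq\<close>, and C1 is the regularity demanded
  of fields in \<open>perimeter\<close>.\<close>

lemma has_real_derivative_glue_tangent:
  fixes f :: "real \<Rightarrow> real"
  assumes "(f has_real_derivative d) (at c)"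
  shows "((\<lambda>x. if c \<le> x then f x else f c + d * (x - c)) has_real_derivative d) (at c)"
proof -
  let ?F = "\<lambda>x. if c \<le> x then f x else f c + d * (x - c)"
  have f: "((\<lambda>h. (f (c + h) - f c) / h) \<longlongrightarrow> d) (at 0)"
    using assms by (simp add: DERIV_def)
  have "((\<lambda>h. (?F (c + h) - ?F c) / h) \<longlongrightarrow> d) (at_right 0)"
  proof (rule Lim_transform_eventually)
    show "((\<lambda>h. (f (c + h) - f c) / h) \<longlongrightarrow> d) (at_right 0)"
      using f by (simp add: filterlim_split_at_real filterlim_at_split)
    show "\<forall>\<^sub>F h in at_right 0. (f (c + h) - f c) / h = (?F (c + h) - ?F c) / h"
      by (auto simp: eventually_at_filter)
  qed
  moreover have "((\<lambda>h. (?F (c + h) - ?F c) / h) \<longlongrightarrow> d) (at_left 0)"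
  proof (rule Lim_transform_eventually)
    show "((\<lambda>h. d) \<longlongrightarrow> d) (at_left (0::real))" by simp
    show "\<forall>\<^sub>F h in at_left 0. d = (?F (c + h) - ?F c) / h"
      by (auto simp: eventually_at_filter)
  qed
  ultimately show ?thesis
    by (simp add: DERIV_def filterlim_split_at)
qed

definition sqpos :: "real \<Rightarrow> real" where "sqpos s = (max 0 s)\<^sup>2"

lemma sqpos_deriv [derivative_intros]:
  "(sqpos has_real_derivative 2 * max 0 s) (at s)"
proof (cases "s = 0")
  case True
  have "((\<lambda>x. if 0 \<le> x then x\<^sup>2 else (0::real)\<^sup>2 + 0 * (x - 0)) has_real_derivative 0) (at 0)"
    by (rule has_real_derivative_glue_tangent) (auto intro!: derivative_eq_intros)
  moreover have "sqpos = (\<lambda>x. if 0 \<le> x then x\<^sup>2 else (0::real)\<^sup>2 + 0 * (x - 0))"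
    by (auto simp: sqpos_def max_def fun_eq_iff)
  ultimately show ?thesis using True by simp
next
  case False
  show ?thesis
  proof (cases "0 < s")
    case True
    have "((\<lambda>s. s\<^sup>2) has_real_derivative 2 * s) (at s)"
      by (auto intro!: derivative_eq_intros)
    then have "(sqpos has_real_derivative 2 * s) (at s)"
      by (rule has_field_derivative_transform_within_open[where S="{0<..}"])
        (use True in \<open>auto simp: sqpos_def\<close>)
    then show ?thesis using True by simp
  next
    case neg: False
    have "((\<lambda>s. 0) has_real_derivative 0) (at s)" by simp
    then have "(sqpos has_real_derivative 0) (at s)"
      by (rule has_field_derivative_transform_within_open[where S="{..<0}"])
        (use neg False in \<open>auto simp: sqpos_def\<close>)
    then show ?thesis using neg by simp
  qed
qed

text \<open>A C1 step from 0 on \<open>s \<le> 0\<close> to 1 on \<open>1 \<le> s\<close>; written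
  out, 1 - ((1 - s_+^2)_+)^2.\<close>

definition smoothstep :: "real \<Rightarrow> real" where "smoothstep s = 1 - sqpos (1 - sqpos s)"

definition smoothstep' :: "real \<Rightarrow> real" where
  "smoothstep' s = 4 * max 0 (1 - sqpos s) * max 0 s"

lemma sqpos_nonneg [simp]: "0 \<le> sqpos s" by (simp add: sqpos_def)

lemma smoothstep_deriv [derivative_intros]:
  "(smoothstep has_real_derivative smoothstep' s) (at s)"
  unfolding smoothstep_def[abs_def] smoothstep'_def
  by (rule derivative_eq_intros DERIV_chain2[of sqpos] refl sqpos_deriv)+ simp

lemma continuous_sqpos [continuous_intros]:
  "continuous_on S f \<Longrightarrow> continuous_on S (\<lambda>x. sqpos (f x))"
  unfolding sqpos_def by (intro continuous_intros)

lemma continuous_smoothstep [continuous_intros]: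
  "continuous_on S f \<Longrightarrow> continuous_on S (\<lambda>x. smoothstep (f x))"
  unfolding smoothstep_def by (intro continuous_intros)

lemma continuous_smoothstep' [continuous_intros]:
  "continuous_on S f \<Longrightarrow> continuous_on S (\<lambda>x. smoothstep' (f x))"
  unfolding smoothstep'_def by (intro continuous_intros)

lemma smoothstep_range: "0 \<le> smoothstep s" "smoothstep s \<le> 1"
proof -
  have "max 0 (1 - sqpos s) \<le> 1" "0 \<le> max 0 (1 - sqpos s)" by auto
  then have "sqpos (1 - sqpos s) \<le> 1"
    unfolding sqpos_def[of "1 - _"] by (simp add: power_le_one)
  then show "0 \<le> smoothstep s" "smoothstep s \<le> 1"
    by (auto simp: smoothstep_def)
qed

lemma sqpos_ge_1: "1 \<le> s \<Longrightarrow> 1 \<le> sqpos s"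
  by (simp add: sqpos_def)

lemma smoothstep_eqs:
  "s \<le> 0 \<Longrightarrow> smoothstep s = 0" "s \<le> 0 \<Longrightarrow> smoothstep' s = 0"
  "1 \<le> s \<Longrightarrow> smoothstep s = 1" "1 \<le> s \<Longrightarrow> smoothstep' s = 0"
  using sqpos_ge_1[of s]
  by (auto simp: smoothstep_def smoothstep'_def sqpos_def[of "1 - _"] ) (auto simp: sqpos_def)

lemma smoothstep'_nonneg: "0 \<le> smoothstep' s"
  by (simp add: smoothstep'_def)

text \<open>The function 1 / sqrt q, continued below \<open>q0\<close> by its tangent line, so that
  the normalised gradient extends as a C1 field through critical points.\<close>

definition rsq :: "real \<Rightarrow> real \<Rightarrow> real" where
  "rsq q0 q = (if q0 \<le> q then 1 / sqrt q else 1 / sqrt q0 + (- 1 / (2 * q0 * sqrt q0)) * (q - q0))"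

definition rsq' :: "real \<Rightarrow> real \<Rightarrow> real" where
  "rsq' q0 q = - 1 / (2 * max q0 q * sqrt (max q0 q))"

lemma inverse_sqrt_deriv:
  assumes "0 < q"
  shows "((\<lambda>q. 1 / sqrt q) has_real_derivative - 1 / (2 * q * sqrt q)) (at q)"
  using assms by (auto intro!: derivative_eq_intros simp: field_simps)

lemma rsq_deriv:
  assumes "0 < q0"
  shows "(rsq q0 has_real_derivative rsq' q0 q) (at q)"
proof (cases q q0 rule: linorder_cases)
  case equal
  have "rsq q0 = (\<lambda>x. if q0 \<le> x then 1 / sqrt x else 1 / sqrt q0 + (- 1 / (2 * q0 * sqrt q0)) * (x - q0))"
    by (rule ext) (simp only: rsq_def)
  moreover have "rsq' q0 q0 = - 1 / (2 * q0 * sqrt q0)"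
    unfolding rsq'_def max.idem ..
  ultimately show ?thesis
    using has_real_derivative_glue_tangent[OF inverse_sqrt_deriv[OF assms]] equal by (simp only:)
next
  case less
  have "((\<lambda>q. a + c * (q - q0)) has_real_derivative c) (at q)" for a c
    by (auto intro!: derivative_eq_intros)
  then have "(rsq q0 has_real_derivative - 1 / (2 * q0 * sqrt q0)) (at q)"
    by (rule has_field_derivative_transform_within_open[where S="{..<q0}"])
      (use less in \<open>auto simp: rsq_def\<close>)
  then show ?thesis using less by (simp add: rsq'_def)
next
  case greater
  have "((\<lambda>q. 1 / sqrt q) has_real_derivative - 1 / (2 * q * sqrt q)) (at q)"
    using assms greater by (intro inverse_sqrt_deriv) simp
  then have "(rsq q0 has_real_derivative - 1 / (2 * q * sqrt q)) (at q)"
    by (rule has_field_derivative_transform_within_open[where S="{q0<..}"])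
      (use greater in \<open>auto simp: rsq_def\<close>)
  then show ?thesis using greater by (simp add: rsq'_def)
qed

lemma rsq_continuous: "0 < q0 \<Longrightarrow> continuous_on S (rsq q0)"
  by (meson DERIV_isCont continuous_at_imp_continuous_on rsq_deriv)

lemma rsq'_continuous: "0 < q0 \<Longrightarrow> continuous_on S (rsq' q0)"
  unfolding rsq'_def by (intro continuous_intros) auto

definition unit_field :: "real \<Rightarrow> 'a::euclidean_space \<Rightarrow> 'a" where
  "unit_field q0 p = rsq q0 (p \<bullet> p) *\<^sub>R p"

lemma unit_field_eq:
  assumes "0 < q0" "q0 \<le> p \<bullet> p"
  shows "unit_field q0 p = (1 / norm p) *\<^sub>R p"
  using assms by (simp add: unit_field_def rsq_def norm_eq_sqrt_inner)

text \<open>Below \<open>q0\<close> put t = sqrt (q / q0) < 1. Then \<open>rsq q0 q\<close> is (3 -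
  t^2) / (2 sqrt q0), and the second bound reads 3 t - t^3 \<le> 2, that is (1 - t)^2 (2 + t) \<ge>
  0. It makes \<open>unit_field\<close> admissible in the perimeter even where it is not of unit
  length.\<close>

lemma rsq_bounds:
  assumes "0 < q0" "0 \<le> q"
  shows "0 \<le> rsq q0 q" "rsq q0 q * sqrt q \<le> 1" "rsq q0 q \<le> 3 / (2 * sqrt q0)"
proof -
  have s0: "0 < sqrt q0" using assms by simp
  define t where "t = sqrt q / sqrt q0"
  have t0: "0 \<le> t" using assms s0 by (simp add: t_def)
  have q: "q = t\<^sup>2 * q0" using assms s0 by (simp add: t_def power_divide)
  have sq: "sqrt q = t * sqrt q0" using s0 by (simp add: t_def)
  have e: "rsq q0 q = (3 - t\<^sup>2) / (2 * sqrt q0)" if "q < q0"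
    using that s0 assms unfolding rsq_def q by (simp add: field_simps)
  have t1: "t\<^sup>2 \<le> 1" if "q < q0"
    using that assms(1) unfolding q by simp
  show "0 \<le> rsq q0 q"
  proof (cases "q0 \<le> q")
    case True then show ?thesis using assms by (simp add: rsq_def)
  next
    case False then show ?thesis using e t1 s0 by simp
  qed
  show "rsq q0 q \<le> 3 / (2 * sqrt q0)"
  proof (cases "q0 \<le> q")
    case True
    then have "1 / sqrt q \<le> 1 / sqrt q0" using s0 by (simp add: frac_le)
    also have "\<dots> \<le> 3 / (2 * sqrt q0)" using s0 by (simp add: field_simps)
    finally show ?thesis using True by (simp add: rsq_def)
  next
    case False then show ?thesis using e s0 by (simp add: divide_right_mono)
  qed
  show "rsq q0 q * sqrt q \<le> 1"
  proof (cases "q0 \<le> q")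
    case True then show ?thesis using assms by (simp add: rsq_def)
  next
    case False
    have "rsq q0 q * sqrt q = (3 - t\<^sup>2) * t / 2"
      using e False s0 sq by simp
    also have "\<dots> \<le> 1"
    proof -
      have "0 \<le> (1 - t)\<^sup>2 * (2 + t)" using t0 by simp
      then show ?thesis by (simp add: power2_eq_square algebra_simps)
    qed
    finally show ?thesis .
  qed
qed

lemma norm_unit_field_le:
  assumes "0 < q0"
  shows "norm (unit_field q0 p) \<le> 1"
proof -
  have "norm (unit_field q0 p) = rsq q0 (p \<bullet> p) * sqrt (p \<bullet> p)"
    using rsq_bounds(1)[OF assms, of "p \<bullet> p"] by (simp add: unit_field_def norm_eq_sqrt_inner[of p])
  then show ?thesis using rsq_bounds(2)[OF assms, of "p \<bullet> p"] by simp
qed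

lemma unit_field_deriv:
  assumes "0 < q0" "(G has_derivative G') (at x)"
  shows "((\<lambda>x. unit_field q0 (G x)) has_derivative
     (\<lambda>v. rsq q0 (G x \<bullet> G x) *\<^sub>R G' v + (rsq' q0 (G x \<bullet> G x) * (2 * (G x \<bullet> G' v))) *\<^sub>R G x)) (at x)"
proof -
  have "((\<lambda>x. rsq q0 (G x \<bullet> G x)) has_derivative (\<lambda>v. (G x \<bullet> G' v + G' v \<bullet> G x) * rsq' q0 (G x \<bullet> G x))) (at x)"
    by (rule DERIV_compose_FDERIV[OF rsq_deriv[OF assms(1)]]) (intro has_derivative_inner assms(2))
  from has_derivative_scaleR[OF this assms(2)]
  show ?thesis
    unfolding unit_field_def by (simp add: inner_commute algebra_simps)
qed

lemma divergence_eq: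
  assumes "(X has_derivative X') (at x)"
  shows "divergence X x = (\<Sum>i\<in>UNIV. X' (axis i 1) $ i)"
  by (simp add: divergence_def partial_deriv_eq[OF assms])

lemma linear_axis_sum:
  fixes f :: "real^'n \<Rightarrow> real"
  assumes "linear f"
  shows "(\<Sum>i\<in>UNIV. f (axis i 1) * w $ i) = f w"
proof -
  have "f w = f (\<Sum>i\<in>UNIV. w $ i *\<^sub>R axis i 1)"
    by (metis basis_expansion scalar_mult_eq_scaleR)
  then show ?thesis
    using assms by (simp add: linear_sum linear_cmul mult.commute)
qed

text \<open>A function of the squared distance, hence differentiable at \<open>x0\<close>; as 3
  \<rho>^2 = (2 \<rho>)^2 - \<rho>^2, the transition takes place exactly between radii \<rho> and 2
  \<rho>.\<close>

definition cutoff :: "'a::euclidean_space \<Rightarrow> real \<Rightarrow> 'a \<Rightarrow> real" where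
  "cutoff x0 \<rho> x = 1 - smoothstep (((x - x0) \<bullet> (x - x0) - \<rho>\<^sup>2) / (3 * \<rho>\<^sup>2))"

definition cutoff' :: "'a::euclidean_space \<Rightarrow> real \<Rightarrow> 'a \<Rightarrow> 'a \<Rightarrow> real" where
  "cutoff' x0 \<rho> x v = - smoothstep' (((x - x0) \<bullet> (x - x0) - \<rho>\<^sup>2) / (3 * \<rho>\<^sup>2)) * (2 * ((x - x0) \<bullet> v) / (3 * \<rho>\<^sup>2))"

lemma cutoff_deriv:
  assumes "0 < \<rho>"
  shows "(cutoff x0 \<rho> has_derivative cutoff' x0 \<rho> x) (at x)"
proof -
  have "((\<lambda>x. ((x - x0) \<bullet> (x - x0) - \<rho>\<^sup>2) * c) has_derivative (\<lambda>v. 2 * ((x - x0) \<bullet> v) * c)) (at x)" for c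
    by (auto intro!: derivative_eq_intros simp: inner_commute)
  from this[of "1 / (3 * \<rho>\<^sup>2)"]
  have "((\<lambda>x. ((x - x0) \<bullet> (x - x0) - \<rho>\<^sup>2) / (3 * \<rho>\<^sup>2)) has_derivative (\<lambda>v. 2 * ((x - x0) \<bullet> v) / (3 * \<rho>\<^sup>2))) (at x)"
    by simp
  from DERIV_compose_FDERIV[OF smoothstep_deriv this]
  have "((\<lambda>x. 1 - smoothstep (((x - x0) \<bullet> (x - x0) - \<rho>\<^sup>2) / (3 * \<rho>\<^sup>2))) has_derivative
      (\<lambda>v. 0 - 2 * ((x - x0) \<bullet> v) / (3 * \<rho>\<^sup>2) * smoothstep' (((x - x0) \<bullet> (x - x0) - \<rho>\<^sup>2) / (3 * \<rho>\<^sup>2)))) (at x)"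
    by (intro has_derivative_diff has_derivative_const) 
  then show ?thesis
    by (simp add: cutoff_def[abs_def] cutoff'_def[abs_def] mult.commute)
qed

lemma cutoff_eqs:
  assumes "0 < \<rho>"
  shows "dist x0 x \<le> \<rho> \<Longrightarrow> cutoff x0 \<rho> x = 1" "dist x0 x \<le> \<rho> \<Longrightarrow> cutoff' x0 \<rho> x v = 0"
    "2 * \<rho> \<le> dist x0 x \<Longrightarrow> cutoff x0 \<rho> x = 0" "2 * \<rho> \<le> dist x0 x \<Longrightarrow> cutoff' x0 \<rho> x v = 0"
    "0 \<le> cutoff x0 \<rho> x" "cutoff x0 \<rho> x \<le> 1"
proof -
  have d: "(x - x0) \<bullet> (x - x0) = (dist x0 x)\<^sup>2"
    by (simp add: dist_norm norm_minus_commute power2_norm_eq_inner)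
  show "cutoff x0 \<rho> x = 1" "cutoff' x0 \<rho> x v = 0" if "dist x0 x \<le> \<rho>"
  proof -
    have "(dist x0 x)\<^sup>2 \<le> \<rho>\<^sup>2" using that by (simp add: power_mono)
    then have "((x - x0) \<bullet> (x - x0) - \<rho>\<^sup>2) / (3 * \<rho>\<^sup>2) \<le> 0"
      unfolding d by (simp add: divide_nonpos_nonneg)
    then show "cutoff x0 \<rho> x = 1" "cutoff' x0 \<rho> x v = 0"
      by (simp_all add: cutoff_def cutoff'_def smoothstep_eqs)
  qed
  show "cutoff x0 \<rho> x = 0" "cutoff' x0 \<rho> x v = 0" if "2 * \<rho> \<le> dist x0 x"
  proof -
    have "(2 * \<rho>)\<^sup>2 \<le> (dist x0 x)\<^sup>2" using that assms by (intro power_mono) auto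
    then have "1 \<le> ((x - x0) \<bullet> (x - x0) - \<rho>\<^sup>2) / (3 * \<rho>\<^sup>2)"
      unfolding d using assms by (simp add: field_simps)
    then show "cutoff x0 \<rho> x = 0" "cutoff' x0 \<rho> x v = 0"
      by (simp_all add: cutoff_def cutoff'_def smoothstep_eqs)
  qed
  show "0 \<le> cutoff x0 \<rho> x" "cutoff x0 \<rho> x \<le> 1"
    using smoothstep_range by (auto simp: cutoff_def)
qed

section \<open>The perimeter after a calibrated cut\<close>

lemma set_integral_mono_on:
  fixes f g :: "'a \<Rightarrow> real"
  assumes "set_integrable M D f" "set_integrable M D g" "\<And>x. x \<in> D \<Longrightarrow> f x \<le> g x"
  shows "(LINT x:D|M. f x) \<le> (LINT x:D|M. g x)"
  using assms by (intro set_integral_mono) auto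

text \<open>The field \<open>(1 - \<zeta>) X + \<zeta> \<nu>\<close>, where \<open>\<zeta>\<close> is a smoothed indicator function of \<open>A\<close>
  whose gradient points along \<open>\<nu>\<close>, is a competitor in the perimeter of \<open>D\<close>. The derivative of
  \<open>\<zeta>\<close> contributes \<open>\<nabla>\<zeta> \<bullet> (\<nu> - X) \<ge> 0\<close> to its divergence.\<close>

lemma perimeter_cut:
  fixes D :: "(real^'n) set" and G :: "real^'n \<Rightarrow> real^'n"
  assumes D: "D \<in> sets lebesgue" "perimeter D < \<infinity>"
    and pos: "0 < \<rho>" "0 < q0" "0 < \<gamma>"
    and g: "\<And>x. (g has_derivative (\<lambda>v. G x \<bullet> v)) (at x)"
    and G: "\<And>x. (G has_derivative G' x) (at x)"
    and G': "\<And>b. b \<in> Basis \<Longrightarrow> continuous_on UNIV (\<lambda>x. G' x b)"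
    and local: "\<And>x. \<lbrakk>x \<in> D; dist x0 x < 2 * \<rho>; 0 < g x\<rbrakk> \<Longrightarrow> dist x0 x \<le> \<rho>"
    and grad: "\<And>x. \<lbrakk>x \<in> D; dist x0 x < 2 * \<rho>; 0 < g x; g x < \<gamma>\<rbrakk> \<Longrightarrow> q0 \<le> G x \<bullet> G x"
  defines "A \<equiv> {x. dist x0 x < 2 * \<rho> \<and> 0 < g x}"
    and "\<nu> \<equiv> \<lambda>x. unit_field q0 (G x)"
  shows "perimeter (D - A) < \<infinity>"
    and "enn2real (perimeter (D - A)) + (LINT x:D \<inter> A|lebesgue. divergence \<nu> x) \<le> enn2real (perimeter D)"
    and "C1 \<nu>" and "A \<in> sets lebesgue"
proof -
  define P where "P = enn2real (perimeter D)"
  define \<nu>' where "\<nu>' x v = rsq q0 (G x \<bullet> G x) *\<^sub>R G' x v + (rsq' q0 (G x \<bullet> G x) * (2 * (G x \<bullet> G' x v))) *\<^sub>R G x" for x v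
  have cG: "continuous_on UNIV G"
    using G by (meson continuous_at_imp_continuous_on has_derivative_continuous)
  have cg: "continuous_on UNIV g"
    using g by (meson continuous_at_imp_continuous_on has_derivative_continuous)
  have d\<nu>: "(\<nu> has_derivative \<nu>' x) (at x)" for x
    unfolding \<nu>_def \<nu>'_def by (rule unit_field_deriv[OF pos(2) G])
  have c\<nu>': "continuous_on UNIV (\<lambda>x. \<nu>' x b)" if "b \<in> Basis" for b
    unfolding \<nu>'_def
    by (intro continuous_intros cG G'[OF that] continuous_on_compose2[OF rsq_continuous[OF pos(2), of UNIV]]
        continuous_on_compose2[OF rsq'_continuous[OF pos(2), of UNIV]]) auto
  show C1\<nu>: "C1 \<nu>" by (rule C1I[OF d\<nu> c\<nu>'])
  have n\<nu>: "norm (\<nu> x) \<le> 1" for x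
    unfolding \<nu>_def by (rule norm_unit_field_le[OF pos(2)])
  have "open A"
  proof -
    have "A = {x. dist x0 x < 2 * \<rho>} \<inter> {x. 0 < g x}" by (auto simp: A_def)
    then show ?thesis
      using cg by (auto intro!: open_Int open_Collect_less continuous_intros)
  qed
  then show mA: "A \<in> sets lebesgue" by simp
  \<comment> \<open>The first factor tends to the indicator of \<open>g > 0\<close>, the second
    makes the support bounded. On \<open>D\<close> the cutoff is invisible: \<open>local\<close>
    puts all relevant points of \<open>D\<close> into the ball where it equals 1, so its gradient
    contributes nothing.\<close>
  define \<zeta> where "\<zeta> k x = smoothstep (real (Suc k) * g x) * cutoff x0 \<rho> x" for k x
  define \<zeta>' where "\<zeta>' k x v = smoothstep (real (Suc k) * g x) * cutoff' x0 \<rho> x v +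
      (real (Suc k) * (G x \<bullet> v)) * smoothstep' (real (Suc k) * g x) * cutoff x0 \<rho> x" for k x v
  have d\<zeta>: "(\<zeta> k has_derivative \<zeta>' k x) (at x)" for k x
  proof -
    have "((\<lambda>x. smoothstep (real (Suc k) * g x)) has_derivative
       (\<lambda>v. (real (Suc k) * (G x \<bullet> v)) * smoothstep' (real (Suc k) * g x))) (at x)"
      by (rule DERIV_compose_FDERIV[OF smoothstep_deriv]) (rule has_derivative_mult_right[OF g])
    from has_derivative_mult[OF this cutoff_deriv[OF pos(1), of x0 x]]
    show ?thesis by (simp add: \<zeta>_def[abs_def] \<zeta>'_def[abs_def])
  qed
  have \<zeta>_range: "0 \<le> \<zeta> k x" "\<zeta> k x \<le> 1" for k x
    unfolding \<zeta>_def using smoothstep_range cutoff_eqs(5,6)[OF pos(1)]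
    by (blast intro: mult_nonneg_nonneg mult_le_one)+
  have \<zeta>_out: "\<zeta> k x = 0" if "2 * \<rho> \<le> dist x0 x" for k x
    using cutoff_eqs(3)[OF pos(1) that] by (simp add: \<zeta>_def)
  have c\<zeta>: "continuous_on UNIV (\<zeta> k)" for k
    using d\<zeta> by (meson continuous_at_imp_continuous_on has_derivative_continuous)
  have c\<zeta>': "continuous_on UNIV (\<lambda>x. \<zeta>' k x v)" for k v
    unfolding \<zeta>'_def cutoff'_def cutoff_def
    using pos by (intro continuous_intros cG cg) auto
  have \<zeta>_lim: "(\<lambda>k. \<zeta> k x) \<longlonglongrightarrow> indicator A x" if "x \<in> D" for x
  proof (cases "x \<in> A")
    case True
    then have gx: "0 < g x" and dx: "dist x0 x < 2 * \<rho>" by (auto simp: A_def)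
    have c1: "cutoff x0 \<rho> x = 1"
      using cutoff_eqs(1)[OF pos(1) local[OF that dx gx]] .
    obtain k0 :: nat where k0: "1 / g x < real k0" using reals_Archimedean2 by blast
    have "\<zeta> k x = 1" if "k0 \<le> k" for k
    proof -
      have "1 / g x \<le> real (Suc k)" using k0 that by linarith
      then have "1 \<le> real (Suc k) * g x" using gx by (simp add: field_simps)
      then show ?thesis by (simp add: \<zeta>_def c1 smoothstep_eqs)
    qed
    then have "\<forall>\<^sub>F k in sequentially. \<zeta> k x = 1" by (auto simp: eventually_sequentially)
    then show ?thesis using True by (simp add: tendsto_eventually)
  next
    case False
    have "\<zeta> k x = 0" for k
    proof (cases "dist x0 x < 2 * \<rho>")
      case True
      then have "g x \<le> 0" using False by (auto simp: A_def)
      then show ?thesis by (simp add: \<zeta>_def smoothstep_eqs mult_nonneg_nonpos)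
    qed (use \<zeta>_out in auto)
    then show ?thesis using False by simp
  qed
  \<comment> \<open>On \<open>D\<close> the function \<open>\<zeta> k\<close> varies only where g
    lies between 0 and \<open>1 / real (Suc k)\<close>; from \<open>k1\<close> on this layer is
    inside \<open>g < \<gamma>\<close>, where \<open>grad\<close> applies.\<close>
  obtain k1 :: nat where k1: "1 / \<gamma> < real k1" using reals_Archimedean2 by blast
  have key: "0 \<le> \<zeta>' k x (\<nu> x - Y)" if x: "x \<in> D" and k: "k1 \<le> k" and Y: "norm Y \<le> 1" for k x Y
  proof (cases "dist x0 x < 2 * \<rho>")
    case False
    then have "cutoff x0 \<rho> x = 0" "cutoff' x0 \<rho> x v = 0" for v
      using cutoff_eqs(3,4)[OF pos(1)] by (metis not_less)+
    then show ?thesis by (simp add: \<zeta>'_def)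
  next
    case dx: True
    show ?thesis
    proof (cases "0 < g x")
      case False
      then have "real (Suc k) * g x \<le> 0" by (simp add: mult_nonneg_nonpos)
      then show ?thesis by (simp add: \<zeta>'_def smoothstep_eqs)
    next
      case gx: True
      have dr: "dist x0 x \<le> \<rho>" using local[OF x dx gx] .
      have z: "\<zeta>' k x v = (real (Suc k) * (G x \<bullet> v)) * smoothstep' (real (Suc k) * g x)" for v
        using cutoff_eqs(1,2)[OF pos(1) dr] by (simp add: \<zeta>'_def)
      show ?thesis
      proof (cases "1 \<le> real (Suc k) * g x")
        case True then show ?thesis by (simp add: z smoothstep_eqs)
      next
        case False
        have "1 / \<gamma> \<le> real (Suc k)" using k1 k by linarith
        then have "1 / real (Suc k) \<le> \<gamma>" using pos(3) by (simp add: field_simps)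
        moreover have "g x < 1 / real (Suc k)" using False by (simp add: field_simps)
        ultimately have "g x < \<gamma>" by simp
        from grad[OF x dx gx this] have q: "q0 \<le> G x \<bullet> G x" .
        \<comment> \<open>Here \<open>\<nu> x\<close> is exactly the unit vector along
          \<open>G x\<close>, so it maximises the product with \<open>G x\<close> among all vectors
          of norm at most 1.\<close>
        have "G x \<bullet> \<nu> x = norm (G x)"
          using unit_field_eq[OF pos(2) q]
          by (simp add: \<nu>_def dot_square_norm power2_eq_square)
        moreover have "G x \<bullet> Y \<le> norm (G x)"
          using norm_cauchy_schwarz[of "G x" Y] Y
          by (metis mult.right_neutral mult_left_mono norm_ge_zero order_trans)
        ultimately have "0 \<le> G x \<bullet> (\<nu> x - Y)" by (simp add: inner_diff_right)
        then show ?thesis by (simp add: z smoothstep'_nonneg)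
      qed
    qed
  qed
  have mDA: "D - A \<in> sets lebesgue" "D \<inter> A \<in> sets lebesgue" using D(1) mA by auto
  have cdiv\<nu>: "continuous_on UNIV (divergence \<nu>)"
    using C1\<nu> by (rule C1_continuous_divergence)
  obtain B where B: "\<And>x. dist x0 x \<le> 2 * \<rho> \<Longrightarrow> \<bar>divergence \<nu> x\<bar> \<le> B"
  proof -
    have "bounded (divergence \<nu> ` cball x0 (2 * \<rho>))"
      by (meson cdiv\<nu> compact_cball compact_continuous_image compact_imp_bounded continuous_on_subset subset_UNIV)
    then obtain B where "\<forall>y\<in>divergence \<nu> ` cball x0 (2 * \<rho>). norm y \<le> B"
      unfolding bounded_iff by blast
    then show ?thesis using that[of B] by auto
  qed
  have Iball: "integrable lebesgue (\<lambda>x. B * indicator (cball x0 (2 * \<rho>)) x :: real)"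
    using lborel_indicator_cball_integrable[of B x0 "2 * \<rho>"]
    by (simp only: integrable_completion[OF borel_measurable_integrable])
  have bound: "(LINT x:D - A|lebesgue. divergence X x) + (LINT x:D \<inter> A|lebesgue. divergence \<nu> x) \<le> P"
    if X: "test_field X" and nX: "\<And>x. norm (X x) \<le> 1" for X
  proof -
    have CX: "C1 X" using X by (simp add: test_field_def)
    define X' where "X' x v = (\<Sum>b\<in>Basis. (v \<bullet> b) *\<^sub>R partial_deriv b X x)" for x v
    have dX: "(X has_derivative X' x) (at x)" for x
      unfolding X'_def by (rule C1_has_derivative[OF CX])
    have X'eq: "X' x b = partial_deriv b X x" for x b
      by (rule partial_deriv_eq[OF dX, symmetric])
    have cX: "continuous_on UNIV X" using CX by (rule C1_continuous_on)
    define Y where "Y k x = X x + \<zeta> k x *\<^sub>R (\<nu> x - X x)" for k x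
    define Y' where "Y' k x v = X' x v + (\<zeta> k x *\<^sub>R (\<nu>' x v - X' x v) + \<zeta>' k x v *\<^sub>R (\<nu> x - X x))" for k x v
    have dY: "(Y k has_derivative Y' k x) (at x)" for k x
      unfolding Y_def[abs_def] Y'_def
      by (intro has_derivative_add has_derivative_scaleR has_derivative_diff dX d\<nu> d\<zeta>)
    have C1Y: "C1 (Y k)" for k
    proof (rule C1I[OF dY])
      fix b :: "real^'n" assume b: "b \<in> Basis"
      have cX': "continuous_on UNIV (\<lambda>x. X' x b)"
        unfolding X'eq using C1_cont_partial[OF CX b] by simp
      show "continuous_on UNIV (\<lambda>x. Y' k x b)"
        unfolding Y'_def
        by (intro continuous_intros cX' c\<nu>'[OF b] c\<zeta>' c\<zeta> cX C1_continuous_on[OF C1\<nu>])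
    qed
    have tY: "test_field (Y k)" for k
    proof -
      obtain R where R: "0 < R" "\<And>x. R < norm x \<Longrightarrow> X x = 0" using test_fieldE[OF X] by blast
      show ?thesis
      proof (rule test_fieldI[OF C1Y, where R = "R + (norm x0 + 2 * \<rho>)"])
        fix x :: "real^'n" assume x: "R + (norm x0 + 2 * \<rho>) < norm x"
        have "norm x \<le> norm x0 + dist x0 x"
          by (metis dist_norm norm_minus_commute norm_triangle_sub)
        then have "2 * \<rho> \<le> dist x0 x" "R < norm x" using x R(1) pos(1) norm_ge_zero[of x0] by linarith+
        then show "Y k x = 0" using R \<zeta>_out by (simp add: Y_def)
      qed
    qed
    have nY: "norm (Y k x) \<le> 1" for k x
    proof -
      have "Y k x = (1 - \<zeta> k x) *\<^sub>R X x + \<zeta> k x *\<^sub>R \<nu> x"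
        by (simp add: Y_def algebra_simps)
      also have "norm \<dots> \<le> (1 - \<zeta> k x) * norm (X x) + \<zeta> k x * norm (\<nu> x)"
        using \<zeta>_range[of k x] by (intro order_trans[OF norm_triangle_ineq]) simp
      also have "\<dots> \<le> (1 - \<zeta> k x) * 1 + \<zeta> k x * 1"
        using \<zeta>_range[of k x] nX n\<nu> by (intro add_mono mult_left_mono) auto
      finally show ?thesis by simp
    qed
    have divY: "divergence (Y k) x = (1 - \<zeta> k x) * divergence X x + \<zeta> k x * divergence \<nu> x + \<zeta>' k x (\<nu> x - X x)" for k x
    proof -
      have lin: "linear (\<zeta>' k x)" using d\<zeta> by (rule has_derivative_linear)
      have z: "\<zeta>' k x (\<nu> x - X x) = (\<Sum>i\<in>UNIV. \<zeta>' k x (axis i 1) * (\<nu> x - X x) $ i)"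
        by (rule linear_axis_sum[OF lin, symmetric])
      show ?thesis
        unfolding divergence_eq[OF dY] divergence_eq[OF dX] divergence_eq[OF d\<nu>] z Y'_def
        by (simp add: sum.distrib sum_distrib_left sum_subtractf algebra_simps)
    qed
    define F where "F k x = (1 - \<zeta> k x) * divergence X x + \<zeta> k x * divergence \<nu> x" for k x
    define Dom where "Dom x = \<bar>divergence X x\<bar> + B * indicator (cball x0 (2 * \<rho>)) x" for x
    have IDom: "integrable lebesgue Dom"
      unfolding Dom_def using test_field_integrable_lebesgue[OF X] Iball by simp
    have mF: "F k \<in> borel_measurable lebesgue" for k
    proof -
      have "continuous_on UNIV (F k)"
        unfolding F_def[abs_def] by (intro continuous_intros c\<zeta> cdiv\<nu> C1_continuous_divergence[OF CX])
      then have "F k \<in> borel_measurable lborel" by (simp add: borel_measurable_continuous_onI)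
      then show ?thesis by (rule measurable_completion)
    qed
    have FDom: "\<bar>F k x\<bar> \<le> Dom x" for k x
    proof -
      have "\<bar>F k x\<bar> \<le> (1 - \<zeta> k x) * \<bar>divergence X x\<bar> + \<zeta> k x * \<bar>divergence \<nu> x\<bar>"
        unfolding F_def using \<zeta>_range[of k x] by (intro order_trans[OF abs_triangle_ineq]) (simp add: abs_mult)
      also have "\<dots> \<le> Dom x"
      proof (cases "dist x0 x \<le> 2 * \<rho>")
        case True
        have "\<zeta> k x * \<bar>divergence \<nu> x\<bar> \<le> 1 * B"
          using \<zeta>_range[of k x] B[OF True] by (intro mult_mono) auto
        moreover have "(1 - \<zeta> k x) * \<bar>divergence X x\<bar> \<le> 1 * \<bar>divergence X x\<bar>"
          using \<zeta>_range[of k x] by (intro mult_right_mono) auto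
        ultimately show ?thesis using True by (simp add: Dom_def)
      next
        case False
        then show ?thesis using \<zeta>_out by (simp add: Dom_def)
      qed
      finally show ?thesis .
    qed
    have IF: "set_integrable lebesgue D (F k)" for k
    proof -
      have "integrable lebesgue (F k)"
        by (rule Bochner_Integration.integrable_bound[OF IDom mF]) (use FDom in \<open>auto intro!: AE_I2 order_trans[OF _ abs_ge_self]\<close>)
      then show ?thesis unfolding set_integrable_def using D(1) by (intro integrable_mult_indicator)
    qed
    have FP: "(LINT x:D|lebesgue. F k x) \<le> P" if "k1 \<le> k" for k
    proof -
      have "(LINT x:D|lebesgue. F k x) \<le> (LINT x:D|lebesgue. divergence (Y k) x)"
      proof (rule set_integral_mono_on[OF IF test_field_set_integrable[OF tY D(1)]])
        fix x assume "x \<in> D"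
        then show "F k x \<le> divergence (Y k) x"
          using key[OF _ that nX, of x x] by (simp add: divY F_def)
      qed
      also have "\<dots> \<le> P" unfolding P_def by (rule perimeter_geD[OF tY nY D(2)])
      finally show ?thesis .
    qed
    define H where "H x = indicator (D - A) x * divergence X x + indicator (D \<inter> A) x * divergence \<nu> x" for x
    have "(\<lambda>k. LINT x|lebesgue. indicator D x *\<^sub>R F k x) \<longlonglongrightarrow> integral\<^sup>L lebesgue H"
    proof (rule integral_dominated_convergence[OF _ _ IDom])
      show "H \<in> borel_measurable lebesgue"
      proof -
        have "divergence X \<in> borel_measurable lebesgue" "divergence \<nu> \<in> borel_measurable lebesgue"
          using cdiv\<nu> C1_continuous_divergence[OF CX, of UNIV]
          by (auto intro!: measurable_completion simp: borel_measurable_continuous_onI)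
        then show ?thesis unfolding H_def[abs_def] using mDA by measurable
      qed
      show "(\<lambda>x. indicator D x *\<^sub>R F k x) \<in> borel_measurable lebesgue" for k
        using IF[of k] unfolding set_integrable_def by (rule borel_measurable_integrable)
      show "AE x in lebesgue. (\<lambda>k. indicator D x *\<^sub>R F k x) \<longlonglongrightarrow> H x"
      proof (rule AE_I2)
        fix x
        show "(\<lambda>k. indicator D x *\<^sub>R F k x) \<longlonglongrightarrow> H x"
        proof (cases "x \<in> D")
          case True
          have "(\<lambda>k. F k x) \<longlonglongrightarrow> (1 - indicator A x) * divergence X x + indicator A x * divergence \<nu> x"
            unfolding F_def by (intro tendsto_intros \<zeta>_lim[OF True])
          then show ?thesis using True by (cases "x \<in> A") (simp_all add: H_def)
        qed (simp add: H_def)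
      qed
      show "AE x in lebesgue. norm (indicator D x *\<^sub>R F k x) \<le> Dom x" for k
      proof (rule AE_I2)
        fix x
        have "0 \<le> Dom x" using FDom[of k x] by linarith
        then show "norm (indicator D x *\<^sub>R F k x) \<le> Dom x" using FDom[of k x] by (auto simp: indicator_def)
      qed
    qed
    then have "integral\<^sup>L lebesgue H \<le> P"
      by (rule LIMSEQ_le_const2) (use FP in \<open>auto simp: set_lebesgue_integral_def\<close>)
    moreover have "integral\<^sup>L lebesgue H = (LINT x:D - A|lebesgue. divergence X x) + (LINT x:D \<inter> A|lebesgue. divergence \<nu> x)"
    proof -
      have i1: "set_integrable lebesgue (D - A) (divergence X)"
        by (rule test_field_set_integrable[OF X mDA(1)])
      have i2: "set_integrable lebesgue (D \<inter> A) (divergence \<nu>)"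
        unfolding set_integrable_def
      proof (rule Bochner_Integration.integrable_bound[OF Iball])
        have "divergence \<nu> \<in> borel_measurable lebesgue"
          using cdiv\<nu> by (auto intro!: measurable_completion simp: borel_measurable_continuous_onI)
        then show "(\<lambda>x. indicator (D \<inter> A) x *\<^sub>R divergence \<nu> x) \<in> borel_measurable lebesgue"
          using mDA(2) by measurable
        show "AE x in lebesgue. norm (indicator (D \<inter> A) x *\<^sub>R divergence \<nu> x) \<le> norm (B * indicator (cball x0 (2 * \<rho>)) x)"
        proof (rule AE_I2)
          fix x
          show "norm (indicator (D \<inter> A) x *\<^sub>R divergence \<nu> x) \<le> norm (B * indicator (cball x0 (2 * \<rho>)) x)"
          proof (cases "x \<in> D \<inter> A")
            case True
            then have "dist x0 x \<le> 2 * \<rho>" by (simp add: A_def)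
            then show ?thesis using B[of x] True by simp
          qed simp
        qed
      qed
      show ?thesis
        using i1 i2 unfolding H_def set_lebesgue_integral_def set_integrable_def by simp
    qed
    ultimately show ?thesis by simp
  qed
  define I where "I = (LINT x:D \<inter> A|lebesgue. divergence \<nu> x)"
  \<comment> \<open>Testing with the zero field gives \<open>I \<le> P\<close>. The sign matters
    because \<open>ennreal\<close> would truncate a negative bound to 0.\<close>
  have tf0: "test_field (\<lambda>x. 0 :: real^'n)"
    by (rule test_fieldI[where R=0]) (auto intro!: C1I derivative_eq_intros)
  have "divergence (\<lambda>x. 0 :: real^'n) = (\<lambda>x. 0)"
    by (rule ext) (simp add: divergence_eq[OF has_derivative_const])
  then have PI: "0 \<le> P - I"
    using bound[OF tf0] by (simp add: I_def set_lebesgue_integral_def)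
  have le: "perimeter (D - A) \<le> ennreal (P - I)"
    by (rule perimeter_leI) (use bound in \<open>auto simp: I_def algebra_simps\<close>)
  show "perimeter (D - A) < \<infinity>"
    using le by (metis ennreal_less_top infinity_ennreal_def le_less_trans)
  have "enn2real (perimeter (D - A)) \<le> P - I"
    using enn2real_leI[OF PI le] .
  then show "enn2real (perimeter (D - A)) + (LINT x:D \<inter> A|lebesgue. divergence \<nu> x) \<le> enn2real (perimeter D)"
    by (simp add: I_def P_def)
qed

section \<open>One-sided minimality\<close>

text \<open>Agrees with \<open>signed_dist\<close> only if \<open>E\<close> is neither empty nor the
  whole space, since \<open>infdist\<close> to the empty set is 0 by convention rather than
  infinite.\<close>

definition sd :: "'a::euclidean_space set \<Rightarrow> 'a \<Rightarrow> real" where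
  "sd E x = infdist x E - infdist x (- E)"

lemma Inf_ereal_dist:
  assumes "E \<noteq> {}"
  shows "(INF y\<in>E. ereal (dist x y)) = ereal (infdist x E)"
proof -
  obtain a where a: "a \<in> E" using assms by blast
  have "(INF y\<in>E. ereal (dist x y)) \<le> ereal (dist x a)" using a by (rule INF_lower)
  moreover have "0 \<le> (INF y\<in>E. ereal (dist x y))" by (rule INF_greatest) simp
  ultimately have "\<bar>INF y\<in>E. ereal (dist x y)\<bar> \<noteq> \<infinity>"
    by (cases "INF y\<in>E. ereal (dist x y)") auto
  from ereal_INF[OF this] assms show ?thesis by (simp add: infdist_def)
qed

lemma signed_dist_eq:
  assumes "E \<noteq> {}" "E \<noteq> UNIV"
  shows "signed_dist E x = ereal (sd E x)"
proof -
  have "- E \<noteq> {}" using assms(2) by blast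
  then show ?thesis
    using assms(1) by (simp add: signed_dist_def Inf_ereal_dist sd_def)
qed

lemma sd_Compl: "sd (- E) x = - sd E x"
  by (simp add: sd_def)

lemma continuous_sd: "continuous_on S (sd E)"
  unfolding sd_def[abs_def] by (intro continuous_intros)

lemma sd_ge:
  assumes "E \<noteq> {}" "0 < c" "\<And>y. y \<in> E \<Longrightarrow> c \<le> dist x y"
  shows "c \<le> sd E x"
proof -
  have "x \<in> - E" using assms(2) assms(3)[of x] by auto
  then have "infdist x (- E) = 0" by simp
  moreover have "c \<le> infdist x E" using assms(1,3) by (simp add: infdist_notempty cINF_greatest)
  ultimately show ?thesis by (simp add: sd_def)
qed

lemma sd_ge_minus:
  assumes "y \<notin> E"
  shows "- dist x y \<le> sd E x"
  using infdist_le[of y "- E" x] infdist_nonneg[of x E] assms by (simp add: sd_def)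

lemma continuous_bounded_set_integrable:
  fixes f :: "'a::euclidean_space \<Rightarrow> real"
  assumes "continuous_on UNIV f" "S \<in> sets lebesgue" "bounded S"
  shows "set_integrable lebesgue S f"
proof -
  obtain a where a: "S \<subseteq> cbox (- a) a" using bounded_subset_cbox_symmetric[OF assms(3)] by blast
  have "f absolutely_integrable_on cbox (- a) a"
    by (rule absolutely_integrable_continuous) (use assms(1) continuous_on_subset in blast)
  then show ?thesis using set_integrable_subset assms(2) a by blast
qed

text \<open>Minimality against removal of bounded pieces from the free region \<open>U\<close>, with
  the energy difference written in real numbers. The density clause excludes null parts of
  \<open>D\<close> in \<open>U\<close>. Both a flow step and its complement satisfy this, with
  different \<open>U\<close>.\<close>

definition cut_minimal :: "real \<Rightarrow> (real^'n) set \<Rightarrow> (real^'n) set \<Rightarrow> (real^'n) set \<Rightarrow> bool" where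
  "cut_minimal h U D' D \<longleftrightarrow>
    D' \<noteq> {} \<and> D \<in> sets lebesgue \<and> perimeter D < \<infinity> \<and>
    (\<forall>x\<in>D \<inter> U. \<forall>r>0. \<not> negligible (D \<inter> ball x r)) \<and>
    (\<forall>A\<in>sets lebesgue. A \<subseteq> U \<longrightarrow> bounded A \<longrightarrow> perimeter (D - A) < \<infinity> \<longrightarrow>
       enn2real (perimeter D) + (1 / h) * (LINT x:D \<inter> A|lebesgue. sd D' x) \<le> enn2real (perimeter (D - A)))"

text \<open>\<open>sd\<close> does not reflect the infinite signed distance from \<open>{}\<close>
  and \<open>UNIV\<close>, so the steps from these sets need alternatives of their own.
  \<open>D = UNIV\<close> is granted outright only after \<open>D' = UNIV\<close>: an unjustified
  jump to the whole space would destroy the ball barrier.\<close>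

definition cut_step :: "real \<Rightarrow> (real^'n) set \<Rightarrow> (real^'n) set \<Rightarrow> (real^'n) set \<Rightarrow> bool" where
  "cut_step h U D' D \<longleftrightarrow> D = {} \<or> D = UNIV \<and> D' = UNIV \<or> cut_minimal h U D' D"

text \<open>The gain in \<open>perimeter_cut\<close> combined with minimality bounds the integral of
  \<open>sd D' x / h\<close> plus the divergence of the normal field over the cut piece by 0. The
  piece has positive measure near \<open>y\<close>, so the integrand is nonpositive somewhere in it:
  a discrete Euler-Lagrange inequality at a point that cannot be prescribed.\<close>

lemma cut_minimal_variation:
  fixes D :: "(real^'n) set" and G :: "real^'n \<Rightarrow> real^'n"
  assumes cm: "cut_minimal h U D' D" and h: "0 < h"
    and pos: "0 < \<rho>" "0 < q0" "0 < \<gamma>"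
    and g: "\<And>x. (g has_derivative (\<lambda>v. G x \<bullet> v)) (at x)"
    and G: "\<And>x. (G has_derivative G' x) (at x)"
    and G': "\<And>b. b \<in> Basis \<Longrightarrow> continuous_on UNIV (\<lambda>x. G' x b)"
    and local: "\<And>x. \<lbrakk>x \<in> D; dist x0 x < 2 * \<rho>; 0 < g x\<rbrakk> \<Longrightarrow> dist x0 x \<le> \<rho>"
    and grad: "\<And>x. \<lbrakk>x \<in> D; dist x0 x < 2 * \<rho>; 0 < g x; g x < \<gamma>\<rbrakk> \<Longrightarrow> q0 \<le> G x \<bullet> G x"
    and U: "\<And>x. \<lbrakk>dist x0 x < 2 * \<rho>; 0 < g x\<rbrakk> \<Longrightarrow> x \<in> U"
    and y: "y \<in> D" "dist x0 y < 2 * \<rho>" "0 < g y"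
  obtains x where "x \<in> D" "dist x0 x < 2 * \<rho>" "0 < g x"
    "sd D' x / h + divergence (\<lambda>x. unit_field q0 (G x)) x \<le> 0"
proof -
  define A where "A = {x. dist x0 x < 2 * \<rho> \<and> 0 < g x}"
  define f where "f x = sd D' x / h + divergence (\<lambda>x. unit_field q0 (G x)) x" for x
  have D: "D \<in> sets lebesgue" "perimeter D < \<infinity>" using cm by (auto simp: cut_minimal_def)
  note cut = perimeter_cut[OF D pos g G G' local grad, folded A_def]
  have oA: "open A"
  proof -
    have "continuous_on UNIV g"
      using g by (meson continuous_at_imp_continuous_on has_derivative_continuous)
    moreover have "A = {x. dist x0 x < 2 * \<rho>} \<inter> {x. 0 < g x}" by (auto simp: A_def)
    ultimately show ?thesis
      by (auto intro!: open_Int open_Collect_less continuous_intros)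
  qed
  have bA: "bounded A" by (rule bounded_subset[of "ball x0 (2 * \<rho>)"]) (auto simp: A_def)
  have mDA: "D \<inter> A \<in> sets lebesgue" using D(1) cut(4) by blast
  have bDA: "bounded (D \<inter> A)" using bA by (simp add: bounded_Int)
  have AU: "A \<subseteq> U" using U by (auto simp: A_def)
  have i1: "set_integrable lebesgue (D \<inter> A) (sd D')"
    by (rule continuous_bounded_set_integrable[OF continuous_sd mDA bDA])
  have i2: "set_integrable lebesgue (D \<inter> A) (divergence (\<lambda>x. unit_field q0 (G x)))"
    by (rule continuous_bounded_set_integrable[OF C1_continuous_divergence[OF cut(3)] mDA bDA])
  have "enn2real (perimeter D) + (1 / h) * (LINT x:D \<inter> A|lebesgue. sd D' x) \<le> enn2real (perimeter (D - A))"
    using cm cut(1,4) AU bA unfolding cut_minimal_def by blast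
  with cut(2) have le: "(1 / h) * (LINT x:D \<inter> A|lebesgue. sd D' x)
      + (LINT x:D \<inter> A|lebesgue. divergence (\<lambda>x. unit_field q0 (G x)) x) \<le> 0"
    by linarith
  have i1': "set_integrable lebesgue (D \<inter> A) (\<lambda>x. sd D' x / h)"
    using i1 by (simp add: set_integrable_def)
  have If: "set_integrable lebesgue (D \<inter> A) f"
    unfolding f_def by (rule set_integral_add(1)[OF i1' i2])
  have "(LINT x:D \<inter> A|lebesgue. f x) = (LINT x:D \<inter> A|lebesgue. sd D' x / h)
     + (LINT x:D \<inter> A|lebesgue. divergence (\<lambda>x. unit_field q0 (G x)) x)"
    unfolding f_def by (rule set_integral_add(2)[OF i1' i2])
  with le have le0: "(LINT x:D \<inter> A|lebesgue. f x) \<le> 0" by simp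
  have witness: "thesis" if "x \<in> D \<inter> A" "f x \<le> 0" for x
    by (rule \<open>\<And>x. \<lbrakk>x \<in> D; dist x0 x < 2 * \<rho>; 0 < g x; _ x \<le> 0\<rbrakk> \<Longrightarrow> thesis\<close>[of x])
      (use that in \<open>auto simp: A_def f_def\<close>)
  show ?thesis
  proof (rule ccontr)
    \<comment> \<open>A strictly positive integrand with integral at most 0 would make
      \<open>D \<inter> A\<close> null, against the density of \<open>D\<close> at
      \<open>y\<close>.\<close>
    assume neg: "\<not> thesis"
    have fpos: "0 < f x" if "x \<in> D \<inter> A" for x
      using witness[OF that] neg by force
    have "AE x in lebesgue. 0 \<le> indicator (D \<inter> A) x *\<^sub>R f x"
      using fpos by (intro AE_I2) (auto simp: indicator_def less_imp_le)
    moreover have "integrable lebesgue (\<lambda>x. indicator (D \<inter> A) x *\<^sub>R f x)"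
      using If by (simp add: set_integrable_def)
    moreover have "(LINT x|lebesgue. indicator (D \<inter> A) x *\<^sub>R f x) = 0"
      using le0 integral_nonneg_AE[OF calculation(1)] by (simp add: set_lebesgue_integral_def)
    ultimately have ae: "AE x in lebesgue. indicator (D \<inter> A) x *\<^sub>R f x = 0"
      using integral_nonneg_eq_0_iff_AE by blast
    have "AE x in lebesgue. x \<notin> D \<inter> A"
      using ae by (rule AE_mp) (use fpos in \<open>force intro!: AE_I2\<close>)
    then have "D \<inter> A \<in> null_sets lebesgue" using mDA by (simp add: AE_iff_null_sets)
    then have neg: "negligible (D \<inter> A)" by (simp add: negligible_iff_null_sets)
    obtain r where r: "0 < r" "ball y r \<subseteq> A"
      using oA y by (auto simp: open_contains_ball A_def)
    have "y \<in> D \<inter> U" using y U by auto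
    then have "\<not> negligible (D \<inter> ball y r)" using cm r(1) unfolding cut_minimal_def by blast
    moreover have "negligible (D \<inter> ball y r)"
      by (rule negligible_subset[OF neg]) (use r in auto)
    ultimately show False by blast
  qed
qed

section \<open>Balls as barriers\<close>

definition ball_profile :: "'a::euclidean_space \<Rightarrow> real \<Rightarrow> 'a \<Rightarrow> real" where
  "ball_profile y \<rho> x = (\<rho>\<^sup>2 - (x - y) \<bullet> (x - y)) / 2"

lemma ball_profile_deriv: "(ball_profile y \<rho> has_derivative (\<lambda>v. (y - x) \<bullet> v)) (at x)"
  unfolding ball_profile_def[abs_def]
  by (auto intro!: derivative_eq_intros simp: inner_commute inner_diff_right algebra_simps fun_eq_iff diff_divide_distrib)

lemma ball_profile_pos:
  assumes "0 < \<rho>"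
  shows "0 < ball_profile y \<rho> x \<longleftrightarrow> dist y x < \<rho>"
proof -
  have "(x - y) \<bullet> (x - y) = (dist y x)\<^sup>2"
    by (simp add: dist_norm norm_minus_commute power2_norm_eq_inner)
  then show ?thesis
    using assms power2_less_imp_less[of "dist y x" \<rho>] power_strict_mono[of "dist y x" \<rho> 2]
    unfolding ball_profile_def by auto
qed

text \<open>The threshold is the value of the profile at radius \<open>\<rho> / 2\<close>, namely
  (\<rho>^2 - \<rho>^2 / 4) / 2.\<close>

lemma ball_profile_grad:
  assumes "ball_profile y \<rho> x < 3 * \<rho>\<^sup>2 / 8"
  shows "(\<rho> / 2)\<^sup>2 \<le> (y - x) \<bullet> (y - x)"
proof -
  have "(x - y) \<bullet> (x - y) = (y - x) \<bullet> (y - x)" by (simp add: algebra_simps inner_commute)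
  then show ?thesis using assms unfolding ball_profile_def by (simp add: power2_eq_square field_simps)
qed

text \<open>If \<open>D\<close> met the ball, cutting the ball off would give a point where the
  distance term is at least \<open>(r - \<rho>) / h\<close> and the divergence of the field towards
  the centre at least -3 n / \<rho>, n being the dimension. The condition on \<open>r\<close> makes
  their sum positive.\<close>

lemma cut_step_ball:
  fixes D :: "(real^'n) set"
  assumes cs: "cut_step h U D' D" and h: "0 < h" and \<rho>: "0 < \<rho>"
    and r: "3 * real CARD('n) * h < (r - \<rho>) * \<rho>"
    and D': "D' \<inter> ball y r = {}" and U: "ball y \<rho> \<subseteq> U"
  shows "D \<inter> ball y \<rho> = {}"
proof (rule ccontr)
  assume "D \<inter> ball y \<rho> \<noteq> {}"
  then obtain z where z: "z \<in> D" "dist y z < \<rho>" by auto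
  have "0 < 3 * real CARD('n) * h" using h by simp
  then have "0 < (r - \<rho>) * \<rho>" using r by linarith
  then have r\<rho>: "\<rho> < r" using \<rho> by (simp add: zero_less_mult_iff)
  have "D' \<noteq> UNIV" using D' r\<rho> \<rho> by auto
  with z cs have cm: "cut_minimal h U D' D" by (auto simp: cut_step_def)
  then have D'ne: "D' \<noteq> {}" by (simp add: cut_minimal_def)
  define g where "g = ball_profile y \<rho>"
  define q0 where "q0 = (\<rho> / 2)\<^sup>2"
  have q0: "0 < q0" using \<rho> by (simp add: q0_def)
  have gpos: "0 < g x \<longleftrightarrow> dist y x < \<rho>" for x
    unfolding g_def by (rule ball_profile_pos[OF \<rho>])
  obtain x where x: "dist y x < \<rho>" "sd D' x / h + divergence (\<lambda>x. unit_field q0 (y - x)) x \<le> 0"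
  proof (rule cut_minimal_variation[OF cm h \<rho> q0, where \<gamma> = "3 * \<rho>\<^sup>2 / 8" and g = g and G = "\<lambda>x. y - x" and G' = "\<lambda>x v. - v" and ?x0.0 = y and y = z])
    show "0 < 3 * \<rho>\<^sup>2 / 8" using \<rho> by simp
    show "(g has_derivative (\<lambda>v. (y - x) \<bullet> v)) (at x)" for x
      unfolding g_def by (rule ball_profile_deriv)
    show "((\<lambda>x. y - x) has_derivative (\<lambda>v. - v)) (at x)" for x
      by (auto intro!: derivative_eq_intros)
    show "dist y x \<le> \<rho>" if "0 < g x" for x using that gpos[of x] by simp
    show "q0 \<le> (y - x) \<bullet> (y - x)" if "g x < 3 * \<rho>\<^sup>2 / 8" for x
      using that unfolding g_def q0_def by (rule ball_profile_grad)
    show "x \<in> U" if "0 < g x" for x using that gpos[of x] U by auto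
    show "0 < g z" "dist y z < 2 * \<rho>" "z \<in> D" using z gpos[of z] \<rho> by auto
  qed (use gpos that in auto)
  have "dist y x + dist x w \<ge> r" if "w \<in> D'" for w
    using D' that dist_triangle[of y w x] by fastforce
  then have "r - \<rho> \<le> sd D' x"
    by (intro sd_ge[OF D'ne]) (use x(1) r\<rho> in \<open>force\<close>)+
  define m where "m = (y - x) \<bullet> (y - x)"
  have m0: "0 \<le> m" by (simp add: m_def)
  have "((\<lambda>x. y - x) has_derivative (\<lambda>v. - v)) (at x)"
    by (auto intro!: derivative_eq_intros)
  from unit_field_deriv[OF q0 this]
  have "divergence (\<lambda>x. unit_field q0 (y - x)) x
     = (\<Sum>i\<in>UNIV. - rsq q0 m - 2 * rsq' q0 m * ((y - x) $ i * (y - x) $ i))"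
    unfolding m_def by (subst divergence_eq) (auto intro!: sum.cong simp: inner_axis algebra_simps)
  also have "\<dots> = - real CARD('n) * rsq q0 m - 2 * rsq' q0 m * m"
    by (simp add: sum_subtractf sum_distrib_left[symmetric] m_def inner_vec_def)
  \<comment> \<open>\<open>rsq\<close> is decreasing, so the second term is nonnegative, and
    \<open>rsq\<close> is at most 3 / (2 sqrt q0) with sqrt q0 = \<rho> / 2. The truncation keeps
    the bound valid up to the centre, near which the spheres have unbounded curvature.\<close>
  also have "\<dots> \<ge> - real CARD('n) * (3 / \<rho>)"
  proof -
    have "rsq q0 m \<le> 3 / \<rho>"
      using rsq_bounds(3)[OF q0 m0] \<rho> by (simp add: q0_def)
    then have "real CARD('n) * rsq q0 m \<le> real CARD('n) * (3 / \<rho>)" by (intro mult_left_mono) auto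
    moreover have "rsq' q0 m \<le> 0"
      using q0 by (simp add: rsq'_def divide_nonpos_nonneg)
    then have "rsq' q0 m * m \<le> 0" using m0 by (simp add: mult_nonpos_nonneg)
    ultimately show ?thesis by linarith
  qed
  finally have "(r - \<rho>) / h \<le> real CARD('n) * (3 / \<rho>)"
    using x(2) \<open>r - \<rho> \<le> sd D' x\<close> h divide_right_mono[of "r - \<rho>" "sd D' x" h] by linarith
  then have "(r - \<rho>) * \<rho> \<le> 3 * real CARD('n) * h" using h \<rho> by (simp add: field_simps)
  with r show False by simp
qed

section \<open>The discrete flow\<close>

lemma perimeter_Diff_ball:
  fixes D :: "(real^'n) set"
  assumes "D \<in> sets lebesgue" "perimeter D < \<infinity>" and \<rho>: "0 < \<rho>"
  shows "perimeter (D - ball y \<rho>) < \<infinity>"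
proof -
  have "perimeter (D - {x. dist y x < 2 * \<rho> \<and> 0 < ball_profile y \<rho> x}) < \<infinity>"
  proof (rule perimeter_cut(1)[OF assms(1,2), where G = "\<lambda>x. y - x" and G' = "\<lambda>x v. - v" and ?q0.0 = "(\<rho> / 2)\<^sup>2" and \<gamma> = "3 * \<rho>\<^sup>2 / 8"])
    show "((\<lambda>x. y - x) has_derivative (\<lambda>v. - v)) (at x)" for x
      by (auto intro!: derivative_eq_intros)
    show "dist y x \<le> \<rho>" if "0 < ball_profile y \<rho> x" for x
      using that ball_profile_pos[OF \<rho>, of y x] by simp
    show "(\<rho> / 2)\<^sup>2 \<le> (y - x) \<bullet> (y - x)" if "ball_profile y \<rho> x < 3 * \<rho>\<^sup>2 / 8" for x
      using that by (rule ball_profile_grad)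
    show "(ball_profile y \<rho> has_derivative (\<lambda>v. (y - x) \<bullet> v)) (at x)" for x
      by (rule ball_profile_deriv)
    show "0 < \<rho>" "0 < (\<rho> / 2)\<^sup>2" "0 < 3 * \<rho>\<^sup>2 / 8" using \<rho> by simp_all
    show "continuous_on UNIV (\<lambda>x. - b)" for b :: "real^'n" by (rule continuous_on_const)
  qed
  moreover have "{x. dist y x < 2 * \<rho> \<and> 0 < ball_profile y \<rho> x} = ball y \<rho>"
    unfolding ball_profile_pos[OF \<rho>] using \<rho> by (auto simp: ball_def)
  ultimately show ?thesis by simp
qed

lemma perimeter_Un_ball:
  fixes D :: "(real^'n) set"
  assumes D: "D \<in> sets lebesgue" "perimeter D < \<infinity>" and \<rho>: "0 < \<rho>"
  shows "perimeter (D \<union> ball y \<rho>) < \<infinity>"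
proof -
  have m: "- D \<in> sets lebesgue" using D by (simp add: Compl_in_sets_lebesgue)
  have "perimeter (- D - ball y \<rho>) < \<infinity>"
    using D m perimeter_Compl[OF D(1)] by (intro perimeter_Diff_ball \<rho>) auto
  moreover have "- (- D - ball y \<rho>) = D \<union> ball y \<rho>" by blast
  moreover have "- D - ball y \<rho> \<in> sets lebesgue" using m by auto
  ultimately show ?thesis using perimeter_Compl[of "- D - ball y \<rho>"] by simp
qed

lemma perimeter_ball: "0 < \<rho> \<Longrightarrow> perimeter (ball (y::real^'n) \<rho>) < \<infinity>"
  using perimeter_Un_ball[of "{}" \<rho> y] by simp

text \<open>The field x / (2 R), cut off between radii R and 2 R, has norm at most 1 and constant
  positive divergence on \<open>D\<close>.\<close>

lemma perimeter_pos:
  fixes D :: "(real^'n) set"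
  assumes "open D" "bounded D" "D \<noteq> {}"
  shows "0 < perimeter D"
proof -
  obtain R where R: "0 < R" "\<And>x. x \<in> D \<Longrightarrow> norm x < R"
    using assms(2) bounded_pos_less by blast
  define c where "c = 1 / (2 * R)"
  have c: "0 < c" using R by (simp add: c_def)
  define X where "X x = (c * cutoff 0 R x) *\<^sub>R x" for x :: "real^'n"
  define X' where "X' x v = (c * cutoff 0 R x) *\<^sub>R v + (c * cutoff' 0 R x v) *\<^sub>R x" for x v :: "real^'n"
  have dX: "(X has_derivative X' x) (at x)" for x
  proof -
    have "((\<lambda>x. c * cutoff 0 R x) has_derivative (\<lambda>v. c * cutoff' 0 R x v)) (at x)"
      by (rule has_derivative_mult_right[OF cutoff_deriv[OF R(1)]])
    from has_derivative_scaleR[OF this has_derivative_ident]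
    show ?thesis unfolding X_def X'_def .
  qed
  have C1X: "C1 X"
  proof (rule C1I[OF dX])
    show "continuous_on UNIV (\<lambda>x. X' x b)" for b
      unfolding X'_def cutoff_def cutoff'_def using R(1) by (intro continuous_intros) auto
  qed
  have tX: "test_field X"
    by (rule test_fieldI[OF C1X, where R = "2 * R"]) (use R(1) in \<open>simp add: X_def cutoff_eqs(3)\<close>)
  have nX: "norm (X x) \<le> 1" for x
  proof (cases "norm x \<le> 2 * R")
    case True
    have "c * cutoff 0 R x * norm x \<le> c * 1 * (2 * R)"
      using c R(1) True cutoff_eqs(5,6)[OF R(1), of 0 x] by (intro mult_mono) auto
    then show ?thesis using c R(1) cutoff_eqs(5)[OF R(1), of 0 x] by (simp add: X_def c_def abs_mult)
  next
    case False
    then show ?thesis using R(1) by (simp add: X_def cutoff_eqs(3))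
  qed
  have div: "divergence X x = c * real CARD('n)" if "x \<in> D" for x
  proof -
    have "dist 0 x \<le> R" using R(2)[OF that] by simp
    then show ?thesis
      unfolding divergence_eq[OF dX] X'_def by (simp add: cutoff_eqs(1,2)[OF R(1)])
  qed
  have mD: "D \<in> lmeasurable" using assms by (simp add: lmeasurable_open)
  have "\<not> negligible D" using assms open_not_negligible by blast
  then have "0 < measure lebesgue D"
    using mD negligible_iff_measure0 by (metis measure_nonneg order_le_less)
  moreover have "(LINT x:D|lebesgue. divergence X x) = c * real CARD('n) * measure lebesgue D"
  proof -
    have "(LINT x:D|lebesgue. divergence X x) = (LINT x:D|lebesgue. c * real CARD('n))"
      using mD div by (intro set_lebesgue_integral_cong) (auto simp: fmeasurableD)
    also have "\<dots> = c * real CARD('n) * measure lebesgue D"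
      using mD by (simp add: set_lebesgue_integral_def fmeasurableD)
    finally show ?thesis .
  qed
  ultimately have "0 < (LINT x:D|lebesgue. divergence X x)" using c by simp
  then have "0 < ennreal (LINT x:D|lebesgue. divergence X x)" by simp
  also have "\<dots> \<le> perimeter D"
    unfolding perimeter_alt by (rule SUP_upper) (use tX nX in auto)
  finally show ?thesis .
qed

section \<open>Signed-distance integrals and energies as real numbers\<close>

lemma signed_dist_pos_eq:
  assumes "E \<noteq> {}" "E \<noteq> UNIV"
  shows "signed_dist_pos E F = (\<integral>\<^sup>+x\<in>F. ennreal (sd E x) \<partial>lebesgue)"
  using assms by (simp add: signed_dist_pos_def signed_dist_eq)

lemma signed_dist_neg_eq:
  assumes "E \<noteq> {}" "E \<noteq> UNIV"
  shows "signed_dist_neg E F = (\<integral>\<^sup>+x\<in>F. ennreal (- sd E x) \<partial>lebesgue)"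
  using assms by (simp add: signed_dist_neg_def signed_dist_eq)

lemma borel_measurable_sd [measurable]: "sd E \<in> borel_measurable lebesgue"
  using continuous_sd[of UNIV E]
  by (auto intro!: measurable_completion simp: borel_measurable_continuous_onI)

lemma nn_set_integral_split:
  assumes [measurable]: "f \<in> borel_measurable M" "A \<in> sets M" "B \<in> sets M" and "A \<inter> B = {}"
  shows "(\<integral>\<^sup>+x\<in>A \<union> B. f x \<partial>M) = (\<integral>\<^sup>+x\<in>A. f x \<partial>M) + (\<integral>\<^sup>+x\<in>B. f x \<partial>M)"
  using assms by (intro nn_integral_disjoint_pair) auto

lemma signed_dist_split:
  assumes "E \<noteq> {}" "E \<noteq> UNIV" "A \<in> sets lebesgue" "B \<in> sets lebesgue" "A \<inter> B = {}"
  shows "signed_dist_pos E (A \<union> B) = signed_dist_pos E A + signed_dist_pos E B"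
    "signed_dist_neg E (A \<union> B) = signed_dist_neg E A + signed_dist_neg E B"
proof -
  have [measurable]: "sd E \<in> borel_measurable lebesgue" by (rule borel_measurable_sd)
  show "signed_dist_pos E (A \<union> B) = signed_dist_pos E A + signed_dist_pos E B"
    "signed_dist_neg E (A \<union> B) = signed_dist_neg E A + signed_dist_neg E B"
    unfolding signed_dist_pos_eq[OF assms(1,2)] signed_dist_neg_eq[OF assms(1,2)]
    by (intro nn_set_integral_split assms; measurable)+
qed

lemma signed_dist_bounded:
  fixes E :: "(real^'n) set"
  assumes E: "E \<noteq> {}" "E \<noteq> UNIV" and A: "A \<in> sets lebesgue" "bounded A"
  shows "signed_dist_pos E A < \<infinity>" "signed_dist_neg E A < \<infinity>"
    "(LINT x:A|lebesgue. sd E x) = enn2real (signed_dist_pos E A) - enn2real (signed_dist_neg E A)"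
proof -
  have I: "set_integrable lebesgue A (sd E)"
    by (rule continuous_bounded_set_integrable[OF continuous_sd A])
  have e1: "(\<integral>\<^sup>+x\<in>A. ennreal (sd E x) \<partial>lebesgue) = (\<integral>\<^sup>+x. ennreal (indicator A x *\<^sub>R sd E x) \<partial>lebesgue)"
    by (intro nn_integral_cong) (auto simp: indicator_def)
  have e2: "(\<integral>\<^sup>+x\<in>A. ennreal (- sd E x) \<partial>lebesgue) = (\<integral>\<^sup>+x. ennreal (- (indicator A x *\<^sub>R sd E x)) \<partial>lebesgue)"
    by (intro nn_integral_cong) (auto simp: indicator_def)
  show "signed_dist_pos E A < \<infinity>" "signed_dist_neg E A < \<infinity>"
    using I unfolding signed_dist_pos_eq[OF E] signed_dist_neg_eq[OF E] e1 e2 set_integrable_def real_integrable_def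
    by (auto simp: less_top)
  show "(LINT x:A|lebesgue. sd E x) = enn2real (signed_dist_pos E A) - enn2real (signed_dist_neg E A)"
    using real_lebesgue_integral_def[of lebesgue "\<lambda>x. indicator A x *\<^sub>R sd E x"] I
    unfolding signed_dist_pos_eq[OF E] signed_dist_neg_eq[OF E] e1 e2 set_integrable_def set_lebesgue_integral_def
    by simp
qed

lemma enn2ereal_finite: "x < \<infinity> \<Longrightarrow> enn2ereal x = ereal (enn2real x)"
  by (cases x rule: ennreal_cases) (auto simp: enn2ereal_ennreal)

lemma flow_energy_real:
  assumes "perimeter F < \<infinity>" "signed_dist_pos E F < \<infinity>" "signed_dist_neg E F < \<infinity>"
  shows "flow_energy h E F = ereal (enn2real (perimeter F) + (1 / h) * (enn2real (signed_dist_pos E F) - enn2real (signed_dist_neg E F)))"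
  using assms by (simp add: flow_energy_def enn2ereal_finite)

lemma flow_energy_PInf:
  assumes "perimeter F < \<infinity>" "signed_dist_pos E F = \<infinity>" "signed_dist_neg E F < \<infinity>" "0 < h"
  shows "flow_energy h E F = \<infinity>"
  using assms by (simp add: flow_energy_def enn2ereal_finite)

lemma flow_energy_MInf:
  assumes "perimeter F < \<infinity>" "signed_dist_pos E F < \<infinity>" "signed_dist_neg E F = \<infinity>" "0 < h"
  shows "flow_energy h E F = - \<infinity>"
  using assms by (simp add: flow_energy_def enn2ereal_finite)

lemma flow_stepD:
  assumes "flow_step \<Omega> h E F"
  shows "flow_competitor \<Omega> E F" "\<And>G. flow_competitor \<Omega> E G \<Longrightarrow> flow_energy h E F \<le> flow_energy h E G"
    "F \<in> sets lebesgue" "\<Omega> \<subseteq> F" "perimeter F < \<infinity>" "closed F"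
    "\<And>G. flow_minimizer \<Omega> h E G \<Longrightarrow> negligible (G - F)"
    "\<And>x r. x \<in> F \<Longrightarrow> x \<notin> \<Omega> \<Longrightarrow> 0 < r \<Longrightarrow> \<not> negligible (F \<inter> ball x r)"
  using assms by (auto simp: flow_step_def flow_minimizer_def flow_competitor_def)

section \<open>Steps from the whole space, from the empty set, and of infinite energy\<close>

lemma closed_Compl_negligible:
  fixes F :: "(real^'n) set"
  assumes "closed F" "negligible (- F)"
  shows "F = UNIV"
  using assms open_not_negligible[of "- F"] by blast

text \<open>The signed distance is minus infinity everywhere, so \<open>UNIV\<close> has energy
  minus infinity and is a minimizer. The maximal one contains it up to a null set, and is
  closed.\<close>

lemma flow_step_UNIV:
  fixes F :: "(real^'n) set"
  assumes fs: "flow_step \<Omega> h UNIV F" and h: "0 < h"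
  shows "F = UNIV"
proof -
  have sdU: "signed_dist UNIV x = - \<infinity>" for x :: "real^'n"
    by (simp add: signed_dist_def Inf_ereal_dist top_ereal_def zero_ereal_def[symmetric])
  have p: "signed_dist_pos UNIV (UNIV :: (real^'n) set) = 0"
    by (simp add: signed_dist_pos_def sdU e2ennreal_neg)
  have n: "signed_dist_neg UNIV (UNIV :: (real^'n) set) = \<infinity>"
    by (simp add: signed_dist_neg_def sdU emeasure_lborel_UNIV ennreal_top_mult)
  have "flow_energy h UNIV (UNIV :: (real^'n) set) = - \<infinity>"
    by (rule flow_energy_MInf) (use p n h in auto)
  moreover have "flow_competitor \<Omega> UNIV UNIV"
    by (simp add: flow_competitor_def p)
  ultimately have "flow_minimizer \<Omega> h UNIV UNIV" by (simp add: flow_minimizer_def)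
  then have "negligible (UNIV - F)" by (rule flow_stepD(7)[OF fs])
  then show ?thesis
    using closed_Compl_negligible[OF flow_stepD(6)[OF fs]] by (simp add: Compl_eq_Diff_UNIV)
qed

text \<open>Every set of positive measure has infinite energy, while the empty set has energy 0. A
  nonempty null set is excluded by the choice of representative.\<close>

lemma flow_step_empty:
  fixes F :: "(real^'n) set"
  assumes fs: "flow_step {} h {} F" and h: "0 < h"
  shows "F = {}"
proof (rule ccontr)
  assume "F \<noteq> {}"
  then obtain x where "x \<in> F" by blast
  from flow_stepD(8)[OF fs this, of 1] have "\<not> negligible F"
    using negligible_subset[of F "F \<inter> ball x 1"] by auto
  then have F0: "emeasure lebesgue F \<noteq> 0"
    using flow_stepD(3)[OF fs] negligible_iff_emeasure0 by blast
  have sdE: "signed_dist {} x = \<infinity>" for x :: "real^'n"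
    by (simp add: signed_dist_def Inf_ereal_dist top_ereal_def zero_ereal_def[symmetric])
  have p: "signed_dist_pos {} F = \<infinity>"
    unfolding signed_dist_pos_def sdE e2ennreal_infty nn_integral_cmult_indicator[OF flow_stepD(3)[OF fs]]
    by (simp only: ennreal_top_mult F0 if_False infinity_ennreal_def)
  have n: "signed_dist_neg {} F = 0"
    by (simp add: signed_dist_neg_def sdE e2ennreal_neg)
  have "flow_energy h {} F = \<infinity>"
    by (rule flow_energy_PInf) (use p n h flow_stepD(5)[OF fs] in auto)
  moreover have "flow_energy h {} ({} :: (real^'n) set) = 0"
    by (simp add: flow_energy_def signed_dist_pos_def signed_dist_neg_def zero_ennreal.rep_eq)
  moreover have "flow_competitor {} {} ({} :: (real^'n) set)"
    by (simp add: flow_competitor_def signed_dist_pos_def)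
  ultimately show False using flow_stepD(2)[OF fs, of "{}"] by simp
qed

text \<open>If the energy of a minimizer is infinite, then adding a ball yields another minimizer,
  so that the maximal minimizer is the whole space.\<close>

lemma flow_step_finite:
  fixes F :: "(real^'n) set"
  assumes fs: "flow_step \<Omega> h E F" and h: "0 < h" and E: "E \<noteq> {}" "E \<noteq> UNIV" and F: "F \<noteq> UNIV"
  shows "signed_dist_pos E F < \<infinity>" "signed_dist_neg E F < \<infinity>"
proof -
  note fsD = flow_stepD[OF fs]
  have "signed_dist_pos E F < \<infinity> \<and> signed_dist_neg E F < \<infinity>"
  proof (rule ccontr)
    assume inf: "\<not> ?thesis"
    have neg: "negligible (ball 0 R - F)" if R: "0 < R" for R
    proof -
      let ?B = "ball (0 :: real^'n) R"
      let ?FR = "F \<union> ?B"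
      have mB: "?B - F \<in> sets lebesgue" using fsD(3) by auto
      have bB: "bounded (?B - F)" by (rule bounded_subset[of ?B]) auto
      have FR: "?FR = F \<union> (?B - F)" by blast
      have pF: "signed_dist_pos E ?FR = signed_dist_pos E F + signed_dist_pos E (?B - F)"
        and nF: "signed_dist_neg E ?FR = signed_dist_neg E F + signed_dist_neg E (?B - F)"
        unfolding FR by (rule signed_dist_split[OF E fsD(3) mB]; blast)+
      note fin = signed_dist_bounded(1,2)[OF E mB bB]
      have per: "perimeter ?FR < \<infinity>" by (rule perimeter_Un_ball[OF fsD(3,5) R])
      have comp: "flow_competitor \<Omega> E ?FR"
        using fsD(1) per fin pF nF by (auto simp: flow_competitor_def)
      \<comment> \<open>An infinite energy is either minus infinity, which a bounded addition does
        not change, or plus infinity, and then every competitor has the same energy and is a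
        minimizer.\<close>
      have "flow_energy h E ?FR \<le> flow_energy h E G" if G: "flow_competitor \<Omega> E G" for G
      proof (cases "signed_dist_pos E F < \<infinity>")
        case True
        then have "signed_dist_neg E F = \<infinity>" using inf by (auto simp: less_top[symmetric])
        then have "flow_energy h E ?FR = - \<infinity>"
          by (intro flow_energy_MInf per h) (use True fin pF nF in auto)
        then show ?thesis by simp
      next
        case False
        then have "signed_dist_neg E F < \<infinity>" "signed_dist_pos E F = \<infinity>"
          using fsD(1) by (auto simp: flow_competitor_def less_top[symmetric])
        then have "flow_energy h E F = \<infinity>"
          by (intro flow_energy_PInf fsD(5) h) auto
        then have "flow_energy h E G = \<infinity>" using fsD(2)[OF G] by simp
        then show ?thesis by simp
      qed
      then have "flow_minimizer \<Omega> h E ?FR" using comp by (simp add: flow_minimizer_def)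
      then have "negligible (?FR - F)" by (rule fsD(7))
      then show ?thesis by (rule negligible_subset) blast
    qed
    have "- F = (\<Union>k. ball 0 (real (Suc k)) - F)"
    proof -
      have "\<exists>k. norm x < real (Suc k)" for x :: "real^'n"
        using reals_Archimedean2[of "norm x"] by (metis less_trans of_nat_less_iff lessI)
      then show ?thesis by auto
    qed
    moreover have "negligible (\<Union>k. ball (0 :: real^'n) (real (Suc k)) - F)"
      by (rule negligible_Union_nat) (use neg in auto)
    ultimately show False
      using closed_Compl_negligible[OF fsD(6)] F by simp
  qed
  then show "signed_dist_pos E F < \<infinity>" "signed_dist_neg E F < \<infinity>" by auto
qed

section \<open>Flow steps are minimal from both sides\<close>

text \<open>The energies involved are finite, so the contribution of \<open>F \<inter> F'\<close>
  cancels and only integrals over the two bounded differences remain.\<close>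

lemma flow_step_compare:
  fixes F F' :: "(real^'n) set"
  assumes fs: "flow_step \<Omega> h E F" and h: "0 < h" and E: "E \<noteq> {}" "E \<noteq> UNIV" and F: "F \<noteq> UNIV"
    and F': "F' \<in> sets lebesgue" "\<Omega> \<subseteq> F'" "perimeter F' < \<infinity>"
    and bd: "bounded (F - F')" "bounded (F' - F)"
  shows "enn2real (perimeter F) + (1 / h) * ((LINT x:F - F'|lebesgue. sd E x) - (LINT x:F' - F|lebesgue. sd E x))
    \<le> enn2real (perimeter F')"
proof -
  note fsD = flow_stepD[OF fs]
  note fin = flow_step_finite[OF fs h E F]
  have m: "F - F' \<in> sets lebesgue" "F' - F \<in> sets lebesgue" "F \<inter> F' \<in> sets lebesgue"
    using fsD(3) F'(1) by auto
  have e: "F = (F \<inter> F') \<union> (F - F')" "F' = (F \<inter> F') \<union> (F' - F)" by blast+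
  note b1 = signed_dist_bounded[OF E m(1) bd(1)]
  note b2 = signed_dist_bounded[OF E m(2) bd(2)]
  have s1: "signed_dist_pos E F = signed_dist_pos E (F \<inter> F') + signed_dist_pos E (F - F')"
    "signed_dist_neg E F = signed_dist_neg E (F \<inter> F') + signed_dist_neg E (F - F')"
    by (subst e(1), rule signed_dist_split[OF E m(3,1)], blast)+
  have s2: "signed_dist_pos E F' = signed_dist_pos E (F \<inter> F') + signed_dist_pos E (F' - F)"
    "signed_dist_neg E F' = signed_dist_neg E (F \<inter> F') + signed_dist_neg E (F' - F)"
    by (subst e(2), rule signed_dist_split[OF E m(3,2)], blast)+
  have b0: "signed_dist_pos E (F \<inter> F') < \<infinity>" "signed_dist_neg E (F \<inter> F') < \<infinity>"
    using fin s1 by (auto simp: ennreal_add_less_top)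
  have fin': "signed_dist_pos E F' < \<infinity>" "signed_dist_neg E F' < \<infinity>"
    using s2 b0 b2 by auto
  have "flow_competitor \<Omega> E F'" using F' fin' by (simp add: flow_competitor_def)
  then have "flow_energy h E F \<le> flow_energy h E F'" by (rule fsD(2))
  then have "enn2real (perimeter F) + (1 / h) * (enn2real (signed_dist_pos E F) - enn2real (signed_dist_neg E F))
    \<le> enn2real (perimeter F') + (1 / h) * (enn2real (signed_dist_pos E F') - enn2real (signed_dist_neg E F'))"
    unfolding flow_energy_real[OF fsD(5) fin] flow_energy_real[OF F'(3) fin'] by simp
  then show ?thesis
    using b0 b1 b2 unfolding s1 s2 b1(3) b2(3)
    by (simp add: enn2real_plus algebra_simps add_divide_distrib)
qed

lemma flow_step_cut_minimal:
  fixes F :: "(real^'n) set"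
  assumes fs: "flow_step \<Omega> h E F" and h: "0 < h" and E: "E \<noteq> {}" "E \<noteq> UNIV" and F: "F \<noteq> UNIV"
  shows "cut_minimal h (- \<Omega>) E F"
  unfolding cut_minimal_def
proof (intro conjI ballI allI impI)
  note fsD = flow_stepD[OF fs]
  show "E \<noteq> {}" "F \<in> sets lebesgue" "perimeter F < \<infinity>" using E fsD by auto
  show "\<not> negligible (F \<inter> ball x r)" if "x \<in> F \<inter> - \<Omega>" "0 < r" for x r using fsD(8) that by auto
  fix A :: "(real^'n) set"
  assume A: "A \<in> sets lebesgue" "A \<subseteq> - \<Omega>" "bounded A" "perimeter (F - A) < \<infinity>"
  have "F - A \<in> sets lebesgue" "\<Omega> \<subseteq> F - A" using A fsD by auto
  moreover have e: "F - (F - A) = F \<inter> A" "F - A - F = {}" by auto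
  moreover have "bounded (F \<inter> A)" using A(3) by (simp add: bounded_Int)
  ultimately have "enn2real (perimeter F) + (1 / h) * ((LINT x:F \<inter> A|lebesgue. sd E x) - (LINT x:{}|lebesgue. sd E x))
    \<le> enn2real (perimeter (F - A))"
    using flow_step_compare[OF fs h E F, of "F - A"] A(4) by (simp only: e bounded_empty)
  then show "enn2real (perimeter F) + 1 / h * (LINT x:F \<inter> A|lebesgue. sd E x) \<le> enn2real (perimeter (F - A))"
    by (simp add: set_lebesgue_integral_def)
qed

text \<open>Removing \<open>A\<close> from \<open>- F\<close> means adding \<open>A\<close> to
  \<open>F\<close>, which respects the obstacle whatever \<open>A\<close> is; hence the free region
  is the whole space. Density holds because \<open>- F\<close> is open.\<close>

lemma flow_step_cut_minimal_Compl:
  fixes F :: "(real^'n) set"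
  assumes fs: "flow_step \<Omega> h E F" and h: "0 < h" and E: "E \<noteq> {}" "E \<noteq> UNIV" and F: "F \<noteq> UNIV"
  shows "cut_minimal h UNIV (- E) (- F)"
  unfolding cut_minimal_def
proof (intro conjI ballI allI impI)
  note fsD = flow_stepD[OF fs]
  show "- E \<noteq> {}" using E by auto
  show mF: "- F \<in> sets lebesgue" using fsD(3) by (simp add: Compl_in_sets_lebesgue)
  show "perimeter (- F) < \<infinity>" using fsD perimeter_Compl by metis
  show "\<not> negligible (- F \<inter> ball x r)" if "x \<in> - F \<inter> UNIV" "0 < r" for x r
  proof -
    have "open (- F \<inter> ball x r)" "x \<in> - F \<inter> ball x r" using that fsD(6) by auto
    then show ?thesis using open_not_negligible by blast
  qed
  fix A :: "(real^'n) set"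
  assume A: "A \<in> sets lebesgue" "bounded A" "perimeter (- F - A) < \<infinity>"
  have c: "- (- F - A) = F \<union> A" by blast
  have mFA: "F \<union> A \<in> sets lebesgue" "\<Omega> \<subseteq> F \<union> A" using A fsD by auto
  have pFA: "perimeter (F \<union> A) = perimeter (- F - A)"
    using perimeter_Compl[of "- F - A"] mF A(1) unfolding c by auto
  have e: "F - (F \<union> A) = {}" "F \<union> A - F = - F \<inter> A" by auto
  have "bounded (- F \<inter> A)" using A(2) by (simp add: bounded_Int)
  then have "enn2real (perimeter F) + (1 / h) * ((LINT x:{}|lebesgue. sd E x) - (LINT x:- F \<inter> A|lebesgue. sd E x))
    \<le> enn2real (perimeter (F \<union> A))"
    using flow_step_compare[OF fs h E F mFA] A(3) unfolding e pFA by (simp only: bounded_empty)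
  then show "enn2real (perimeter (- F)) + 1 / h * (LINT x:- F \<inter> A|lebesgue. sd (- E) x) \<le> enn2real (perimeter (- F - A))"
    using perimeter_Compl[OF fsD(3)] by (simp add: set_lebesgue_integral_def sd_Compl pFA)
qed

section \<open>Boundedness of sublevel sets along the flow\<close>

text \<open>Points of \<open>S\<close> can be picked with norms increasing by more than
  \<open>2 * r\<close>, which yields infinitely many disjoint balls of equal volume.\<close>

lemma emeasure_Union_balls:
  fixes S :: "'a::euclidean_space set"
  assumes "\<not> bounded S" and r: "0 < r"
  shows "emeasure lebesgue (\<Union>y\<in>S. ball y r) = \<infinity>"
proof (rule ccontr)
  let ?U = "\<Union>y\<in>S. ball y r"
  assume "emeasure lebesgue ?U \<noteq> \<infinity>"
  moreover have "open ?U" by blast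
  ultimately have fin: "?U \<in> lmeasurable" by (simp add: fmeasurable_def less_top)
  have "\<exists>y\<in>S. b < norm y" for b using assms(1) by (meson bounded_iff not_less)
  then obtain pick where pick: "\<And>b. pick b \<in> S" "\<And>b. b < norm (pick b)" by metis
  define y where "y = rec_nat (pick 0) (\<lambda>_ p. pick (norm p + 2 * r))"
  have yS: "y k \<in> S" for k by (cases k) (auto simp: y_def pick)
  have step: "norm (y k) + 2 * r < norm (y (Suc k))" for k by (simp add: y_def pick)
  have far: "norm (y i) + 2 * r < norm (y j)" if "i < j" for i j
    using that
  proof (induction j)
    case (Suc j)
    then show ?case using step[of j] step[of i] r by (cases "i = j") auto
  qed simp
  have disj: "ball (y i) r \<inter> ball (y j) r = {}" if "i < j" for i j
  proof -
    have "2 * r < dist (y i) (y j)"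
      using far[OF that] norm_triangle_sub[of "y j" "y i"] by (simp add: dist_norm norm_minus_commute)
    then show ?thesis by (intro disjoint_ballI) simp
  qed
  define c where "c = measure lebesgue (ball (0::'a) r)"
  have cb: "measure lebesgue (ball a r) = c" for a :: 'a
    using content_ball[of r a] content_ball[of r "0::'a"] r by (simp add: c_def)
  have c0: "0 < c" using content_ball[of r "0::'a"] r by (simp add: c_def)
  have "real n * c \<le> measure lebesgue ?U" for n
  proof -
    have "measure lebesgue (\<Union>k<n. ball (y k) r) = (\<Sum>k<n. measure lebesgue (ball (y k) r))"
    proof (rule measure_UNION')
      show "pairwise (\<lambda>i j. disjnt (ball (y i) r) (ball (y j) r)) {..<n}"
        unfolding pairwise_def disjnt_def using disj by (metis Int_commute linorder_neqE_nat)
    qed auto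
    then have "real n * c = measure lebesgue (\<Union>k<n. ball (y k) r)" by (simp add: cb)
    also have "\<dots> \<le> measure lebesgue ?U"
    proof (rule measure_mono_fmeasurable[OF _ _ fin])
      show "(\<Union>k<n. ball (y k) r) \<subseteq> ?U" using yS by blast
      have "open (\<Union>k<n. ball (y k) r)" by blast
      then show "(\<Union>k<n. ball (y k) r) \<in> sets lebesgue" by simp
    qed
    finally show ?thesis .
  qed
  moreover obtain n :: nat where "measure lebesgue ?U / c < real n" using reals_Archimedean2 by blast
  ultimately show False using c0 by (metis mult.commute not_less pos_divide_less_eq)
qed

lemma nn_set_integral_ge_infinite:
  assumes "A \<in> sets M" "emeasure M A = \<infinity>" "A \<subseteq> F" "0 < c" "\<And>x. x \<in> A \<Longrightarrow> ennreal c \<le> f x"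
  shows "(\<integral>\<^sup>+x\<in>F. f x \<partial>M) = \<infinity>"
proof -
  have "\<infinity> = (\<integral>\<^sup>+x. ennreal c * indicator A x \<partial>M)"
    using assms(1,2,4) by (simp add: nn_integral_cmult_indicator ennreal_mult_top)
  also have "\<dots> \<le> (\<integral>\<^sup>+x\<in>F. f x \<partial>M)"
    using assms(3,5) by (intro nn_integral_mono) (auto simp: indicator_def)
  finally show ?thesis by (simp add: top_unique)
qed

text \<open>The source of infinite energies for proper sets \<open>E\<close>: the signed distance is
  at least \<open>r\<close> on the balls around \<open>S\<close>, and their union has infinite
  measure. With \<open>- E\<close> in place of \<open>E\<close> it also handles the negative
  part.\<close>

lemma signed_dist_pos_infinite:
  fixes E :: "(real^'n) set"
  assumes E: "E \<noteq> {}" "E \<noteq> UNIV" and S: "\<not> bounded S" and r: "0 < r"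
    and far: "\<And>y. y \<in> S \<Longrightarrow> ball y (2 * r) \<inter> E = {}" and F: "\<And>y. y \<in> S \<Longrightarrow> ball y r \<subseteq> F"
  shows "signed_dist_pos E F = \<infinity>"
  unfolding signed_dist_pos_eq[OF E]
proof (rule nn_set_integral_ge_infinite[OF _ emeasure_Union_balls[OF S r] _ r])
  have "open (\<Union>y\<in>S. ball y r)" by blast
  then show "(\<Union>y\<in>S. ball y r) \<in> sets lebesgue" by simp
  show "(\<Union>y\<in>S. ball y r) \<subseteq> F" using F by blast
  fix x assume "x \<in> (\<Union>y\<in>S. ball y r)"
  then obtain y where y: "y \<in> S" "dist y x < r" by auto
  have "r \<le> sd E x"
  proof (rule sd_ge[OF E(1) r])
    fix z assume "z \<in> E"
    then have "2 * r \<le> dist y z" using far[OF y(1)] by force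
    then show "r \<le> dist x z" using y(2) dist_triangle[of y z x] by linarith
  qed
  then show "ennreal r \<le> ennreal (sd E x)" by (rule ennreal_leI)
qed

lemma signed_dist_Compl:
  assumes "E \<noteq> {}" "E \<noteq> UNIV"
  shows "signed_dist_pos (- E) F = signed_dist_neg E F"
proof -
  have "- E \<noteq> {}" "- E \<noteq> UNIV" using assms by auto
  then show ?thesis using assms by (simp add: signed_dist_pos_eq signed_dist_neg_eq sd_Compl)
qed

text \<open>Filling the space costs infinite energy because \<open>E\<close> is bounded, whereas a
  ball containing \<open>E\<close> has finite energy. Once \<open>F \<noteq> UNIV\<close>, barriers
  of radius 1 placed far from \<open>E\<close> bound \<open>F\<close>.\<close>

lemma flow_step_bounded:
  fixes F :: "(real^'n) set"
  assumes fs: "flow_step \<Omega> h E F" and h: "0 < h" and E: "E \<noteq> {}" "bounded E" and \<Omega>: "\<Omega> \<subseteq> E"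
  shows "F \<noteq> UNIV" "bounded F"
proof -
  note fsD = flow_stepD[OF fs]
  have EU: "E \<noteq> UNIV" using E(2) not_bounded_UNIV by blast
  obtain R where R: "0 < R" "\<And>x. x \<in> E \<Longrightarrow> norm x < R" using E(2) bounded_pos_less by blast
  show FU: "F \<noteq> UNIV"
  proof
    assume F: "F = UNIV"
    let ?B = "ball (0 :: real^'n) R"
    have EB: "E \<subseteq> ?B" using R by auto
    have pos: "signed_dist_pos E F = \<infinity>"
    proof (rule signed_dist_pos_infinite[OF E(1) EU, where S = "- ball 0 (R + 2)" and r = 1])
      show "\<not> bounded (- ball (0 :: real^'n) (R + 2))"
      proof
        assume "bounded (- ball (0 :: real^'n) (R + 2))"
        then have "bounded (- ball (0 :: real^'n) (R + 2) \<union> ball 0 (R + 2))"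
          unfolding bounded_Un by simp
        moreover have "- ball (0 :: real^'n) (R + 2) \<union> ball 0 (R + 2) = UNIV" by blast
        ultimately show False by (metis not_bounded_UNIV)
      qed
      show "ball y (2 * 1) \<inter> E = {}" if "y \<in> - ball 0 (R + 2)" for y
      proof -
        have "\<not> dist y x < 2" if "x \<in> E" for x
          using R(2)[OF that] \<open>y \<in> - ball 0 (R + 2)\<close> dist_triangle[of 0 y x] by (simp add: dist_commute)
        then show ?thesis by force
      qed
    qed (use F in auto)
    have neg: "signed_dist_neg E F < \<infinity>"
    proof -

      have "signed_dist_neg E F = signed_dist_neg E ?B"
        unfolding signed_dist_neg_eq[OF E(1) EU]
      proof (intro nn_integral_cong)
        fix x :: "real^'n"
        have "ennreal (- sd E x) = 0" if "x \<notin> ?B"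
        proof -
          have "x \<in> - E" using that EB by blast
          then have "infdist x (- E) = 0" by simp
          then show ?thesis by (simp add: sd_def ennreal_neg infdist_nonneg)
        qed
        then show "ennreal (- sd E x) * indicator F x = ennreal (- sd E x) * indicator ?B x"
          using F by (auto simp: indicator_def)
      qed
      then show ?thesis using signed_dist_bounded(2)[OF E(1) EU, of ?B] by simp
    qed
    have en: "flow_energy h E F = \<infinity>" by (rule flow_energy_PInf[OF fsD(5) pos neg h])
    note b = signed_dist_bounded(1,2)[OF E(1) EU, of ?B]
    have "flow_competitor \<Omega> E ?B"
      using b perimeter_ball[OF R(1)] EB \<Omega> by (auto simp: flow_competitor_def)
    then have "flow_energy h E F \<le> flow_energy h E ?B" by (rule fsD(2))
    moreover have "flow_energy h E ?B < \<infinity>"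
      using flow_energy_real[OF perimeter_ball[OF R(1)], of E 0 h] b by simp
    ultimately show False using en by simp
  qed
  \<comment> \<open>With inner radius 1 the barrier condition asks for \<open>r - 1\<close> to
    exceed \<open>3 * real CARD('n) * h\<close>.\<close>
  define r where "r = 2 + 3 * real CARD('n) * h"
  have "0 < 3 * real CARD('n) * h" using h by simp
  then have r: "1 < r" unfolding r_def by linarith
  have cs: "cut_step h (- \<Omega>) E F"
    using flow_step_cut_minimal[OF fs h E(1) EU FU] by (simp add: cut_step_def)
  have "x \<in> ball 0 (R + r)" if "x \<in> F" for x
  proof (rule ccontr)
    assume x: "x \<notin> ball 0 (R + r)"
    have Ex: "E \<inter> ball x r = {}"
    proof -
      have "\<not> dist x z < r" if "z \<in> E" for z
        using R(2)[OF that] x dist_triangle[of 0 x z] by (simp add: dist_commute)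
      then show ?thesis by force
    qed
    have "F \<inter> ball x 1 = {}"
      by (rule cut_step_ball[OF cs h _ _ Ex]) (use \<Omega> Ex r in \<open>auto simp: r_def\<close>)
    then show False using that by (auto simp: disjoint_iff)
  qed
  then show "bounded F" by (meson bounded_ball bounded_subset subsetI)
qed

lemma closed_sublevel:
  fixes f :: "'a::t2_space \<Rightarrow> real"
  assumes "continuous_on UNIV f"
  shows "closed {x. f x \<le> s}"
  using assms by (intro closed_Collect_le) (auto intro: continuous_intros)

text \<open>The hull property enters only here: if the first step fills the whole space, then the superlevel
  sets of \<open>u0\<close> are bounded, and filling them in decreases the perimeter.\<close>

lemma bounded_sublevel:
  fixes u0 :: "real^'n \<Rightarrow> real"
  assumes uc: "uniformly_continuous_on UNIV u0"
    and hull: "\<And>s. s \<in> {-1..1} \<Longrightarrow> minimizing_hull {x. u0 x \<le> s}"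
    and step: "\<And>s h. s \<in> {-1..1} \<Longrightarrow> 0 < h \<Longrightarrow> \<exists>\<Omega> F. flow_step \<Omega> h {x. u0 x \<le> s} F"
    and s: "-1 \<le> s" and p: "s < u0 p" "u0 p \<le> 1"
  shows "bounded {x. u0 x \<le> s}"
proof (rule ccontr)
  assume unb: "\<not> bounded {x. u0 x \<le> s}"
  have modulus: "\<exists>r>0. \<forall>x y. dist x y < 2 * r \<longrightarrow> \<bar>u0 x - u0 y\<bar> < e" if e: "0 < e" for e
  proof -
    obtain d where "0 < d" "\<And>x y. dist y x < d \<Longrightarrow> dist (u0 y) (u0 x) < e"
      using uc[unfolded uniformly_continuous_on_def, rule_format, OF e] by blast
    then show ?thesis by (intro exI[of _ "d / 2"]) (auto simp: dist_real_def)
  qed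
  \<comment> \<open>By uniform continuity, points with \<open>u0 \<le> s\<close> lie at a definite
    depth inside \<open>E = {u0 \<le> s1}\<close>, and points with \<open>u0 > s2\<close> at a
    definite distance outside.\<close>
  obtain s1 where s1: "s < s1" "s1 < u0 p" using p(1) dense by blast
  obtain s2 where s2: "s1 < s2" "s2 < u0 p" using s1(2) dense by blast
  define E where "E = {x. u0 x \<le> s1}"
  have "p \<notin> E" using s1 by (simp add: E_def)
  then have EU: "E \<noteq> UNIV" by blast
  have "{x. u0 x \<le> s} \<noteq> {}" using unb by (metis bounded_empty)
  then obtain a where "u0 a \<le> s" by blast
  then have "a \<in> E" using s1 by (simp add: E_def)
  then have E0: "E \<noteq> {}" by blast
  have CE: "- E \<noteq> {}" "- E \<noteq> UNIV" using E0 EU by auto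
  obtain r where r: "0 < r" "\<And>x y. dist x y < 2 * r \<Longrightarrow> \<bar>u0 x - u0 y\<bar> < s1 - s"
    using modulus[of "s1 - s"] s1 by auto
  \<comment> \<open>Small enough for balls of radius \<open>2 * r\<close> inside \<open>E\<close> to
    keep radius \<open>r\<close> after one step, by the barrier for complements.\<close>
  define h where "h = r\<^sup>2 / (6 * real CARD('n))"
  have h: "0 < h" using r by (simp add: h_def)
  have h2: "3 * real CARD('n) * h < (2 * r - r) * r"
    using r by (simp add: h_def power2_eq_square)
  obtain \<Omega> F where fs: "flow_step \<Omega> h E F"
    using step[of s1 h] h s s1 p unfolding E_def by auto
  have far: "ball y (2 * r) \<inter> - E = {}" if "u0 y \<le> s" for y
    using r(2)[of y] that by (force simp: E_def)
  have sub: "ball y r \<subseteq> F" if "u0 y \<le> s" for y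
  proof (cases "F = UNIV")
    case False
    have "cut_step h UNIV (- E) (- F)"
      using flow_step_cut_minimal_Compl[OF fs h E0 EU False] by (simp add: cut_step_def)
    from cut_step_ball[OF this h r(1) h2, of y] far[OF that] show ?thesis by auto
  qed simp
  \<comment> \<open>Infinite volume at depth at least \<open>r\<close> survives in \<open>F\<close>;
    by \<open>flow_step_finite\<close> this is possible only for \<open>F = UNIV\<close>.\<close>
  have inf: "signed_dist_neg E F = \<infinity>"
    unfolding signed_dist_Compl[OF E0 EU, symmetric]
    by (rule signed_dist_pos_infinite[OF CE unb r(1)]) (use far sub in auto)
  have FU: "F = UNIV"
    using flow_step_finite(2)[OF fs h E0 EU] inf by auto
  \<comment> \<open>As a competitor, \<open>UNIV\<close> cannot have both integrals infinite. The
    finite positive part then bounds the superlevel set \<open>D\<close>.\<close>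
  have posfin: "signed_dist_pos E UNIV < \<infinity>"
    using flow_stepD(1)[OF fs] inf unfolding FU flow_competitor_def by auto
  define D where "D = - {x. u0 x \<le> s2}"
  have bD: "bounded D"
  proof (rule ccontr)
    assume unbD: "\<not> bounded D"
    obtain q where q: "0 < q" "\<And>x y. dist x y < 2 * q \<Longrightarrow> \<bar>u0 x - u0 y\<bar> < s2 - s1"
      using modulus[of "s2 - s1"] s2 by auto
    have "signed_dist_pos E UNIV = \<infinity>"
    proof (rule signed_dist_pos_infinite[OF E0 EU unbD q(1)])
      show "ball y (2 * q) \<inter> E = {}" if "y \<in> D" for y
        using q(2)[of y] that by (force simp: E_def D_def)
    qed simp
    then show False using posfin by simp
  qed
  have cu: "continuous_on UNIV u0" using uc by (rule uniformly_continuous_imp_continuous)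
  have oD: "open D" unfolding D_def using closed_sublevel[OF cu] by (simp add: open_Compl)
  \<comment> \<open>As \<open>D\<close> is bounded, the hull \<open>- D\<close> may be compared with
    \<open>UNIV\<close>, which gives \<open>D\<close> perimeter 0; a nonempty bounded open set has
    positive perimeter.\<close>
  have mH: "minimizing_hull (- D)" unfolding D_def using hull[of s2] s s1 s2 p by simp
  have "compact (closure (UNIV - - D))" using bD by (simp add: Compl_eq_Diff_UNIV[symmetric])
  moreover have "(UNIV :: (real^'n) set) \<in> sets lebesgue" using sets.top[of lebesgue] by simp
  ultimately have "perimeter (- D) \<le> perimeter (UNIV :: (real^'n) set)"
    using mH unfolding minimizing_hull_def by blast
  then have "perimeter D = 0" using perimeter_Compl[of D] oD by simp
  moreover have "p \<in> D" using s2 by (simp add: D_def)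
  then have "D \<noteq> {}" by blast
  ultimately show False using perimeter_pos[OF oD bD] by simp
qed

text \<open>If \<open>u0\<close> exceeds \<open>s\<close> somewhere, all iterates are bounded, hence
  never \<open>UNIV\<close>, and an empty iterate stays empty. Otherwise every iterate is
  \<open>UNIV\<close>. Each case is an alternative of \<open>cut_step\<close>, for the iterates and
  for their complements.\<close>

lemma discrete_evolution_cut_steps:
  fixes u0 up :: "real^'n \<Rightarrow> real"
  assumes uc: "uniformly_continuous_on UNIV u0"
    and u0_range: "\<And>x. u0 x \<in> {-1..1}"
    and hull: "\<And>s. s \<in> {-1..1} \<Longrightarrow> minimizing_hull {x. u0 x \<le> s}"
    and le: "\<And>x. u0 x \<le> up x"
    and step: "\<And>s h. s \<in> {-1..1} \<Longrightarrow> 0 < h \<Longrightarrow> \<exists>\<Omega> F. flow_step \<Omega> h {x. u0 x \<le> s} F"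
    and s: "s \<in> {-1..1}" and h: "0 < h"
    and G0: "G 0 = {x. u0 x \<le> s}" and GS: "\<And>k. flow_step {x. up x \<le> s} h (G k) (G (Suc k))"
  shows "cut_step h {x. s < up x} (G k) (G (Suc k))" "cut_step h UNIV (- G k) (- G (Suc k))"
proof -
  have U: "{x. s < up x} = - {x. up x \<le> s}" by auto
  have sub: "{x. up x \<le> s} \<subseteq> G k" for k
  proof (cases k)
    case 0 then show ?thesis using le G0 by (auto intro: order_trans)
  next
    case (Suc j) then show ?thesis using flow_stepD(4)[OF GS[of j]] by simp
  qed
  have "cut_step h {x. s < up x} (G k) (G (Suc k)) \<and> cut_step h UNIV (- G k) (- G (Suc k))"
  proof (cases "\<exists>p. s < u0 p")
    case True
    then obtain p where p: "s < u0 p" by blast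
    have bd: "bounded (G k)" for k
    proof (induction k)
      case 0
      show ?case unfolding G0
        by (rule bounded_sublevel[OF uc hull step _ p]) (use s u0_range in auto)
    next
      case (Suc k)
      show ?case
      proof (cases "G k = {}")
        case True
        then have "flow_step {} h {} (G (Suc k))" using GS[of k] sub[of k] by simp
        then have "G (Suc k) = {}" by (rule flow_step_empty[OF _ h])
        then show ?thesis by simp
      next
        case False
        show ?thesis by (rule flow_step_bounded(2)[OF GS h False Suc sub])
      qed
    qed
    have nU: "G k \<noteq> UNIV" for k using bd[of k] not_bounded_UNIV by metis
    show ?thesis
    proof (cases "G k = {}")
      case True
      then have "flow_step {} h {} (G (Suc k))" using GS[of k] sub[of k] by simp
      then have "G (Suc k) = {}" by (rule flow_step_empty[OF _ h])
      then show ?thesis using True by (simp add: cut_step_def)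
    next
      case False
      then show ?thesis
        using flow_step_cut_minimal[OF GS h False nU nU] flow_step_cut_minimal_Compl[OF GS h False nU nU]
        unfolding U cut_step_def by blast
    qed
  next
    case False
    have "G k = UNIV" for k
    proof (induction k)
      case 0 then show ?case using False G0 by (auto simp: not_less)
    next
      case (Suc k) then show ?case using flow_step_UNIV[OF _ h] GS[of k] by simp
    qed
    then show ?thesis by (simp add: cut_step_def)
  qed
  then show "cut_step h {x. s < up x} (G k) (G (Suc k))" "cut_step h UNIV (- G k) (- G (Suc k))" by auto
qed

section \<open>Test functions\<close>

lemma C1_line_derivative:
  fixes f :: "'a::euclidean_space \<Rightarrow> real"
  assumes "C1 f"
  shows "((\<lambda>t. f (x + t *\<^sub>R b)) has_real_derivative partial_deriv b f (x + t *\<^sub>R b)) (at t)"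
proof -
  obtain f' where f': "(f has_derivative f') (at (x + t *\<^sub>R b))"
    using assms by (auto simp: C1_def differentiable_def)
  have "((\<lambda>t. f (x + t *\<^sub>R b)) has_derivative (\<lambda>s. f' (s *\<^sub>R b))) (at t)"
    by (rule has_derivative_compose[of "\<lambda>t. x + t *\<^sub>R b" "\<lambda>s. s *\<^sub>R b" t UNIV f f', OF _ f'])
      (auto intro!: derivative_eq_intros)
  moreover have "f' (s *\<^sub>R b) = partial_deriv b f (x + t *\<^sub>R b) * s" for s
    using partial_deriv_eq[OF f', of b] has_derivative_linear[OF f'] by (simp add: linear_cmul)
  ultimately show ?thesis by (simp add: has_field_derivative_def)
qed

lemma C2_second_difference:
  fixes f :: "'a::euclidean_space \<Rightarrow> real"
  assumes "C2 f" and a: "a \<in> Basis" and s: "0 < s"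
  shows "\<exists>\<xi> \<eta>. 0 < \<xi> \<and> \<xi> < s \<and> 0 < \<eta> \<and> \<eta> < s \<and>
    f (z + s *\<^sub>R a + s *\<^sub>R b) - f (z + s *\<^sub>R a) - f (z + s *\<^sub>R b) + f z
      = s\<^sup>2 * partial_deriv b (partial_deriv a f) (z + \<xi> *\<^sub>R a + \<eta> *\<^sub>R b)"
proof -
  have C: "C1 f" "C1 (partial_deriv a f)" using assms by (auto simp: C2_def)
  let ?k = "\<lambda>r. f ((z + s *\<^sub>R b) + r *\<^sub>R a) - f (z + r *\<^sub>R a)"
  have "\<exists>\<xi>. 0 < \<xi> \<and> \<xi> < s \<and> ?k s - ?k 0 = (s - 0) *
      (partial_deriv a f ((z + s *\<^sub>R b) + \<xi> *\<^sub>R a) - partial_deriv a f (z + \<xi> *\<^sub>R a))"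
    by (rule MVT2[OF s]) (intro DERIV_diff C1_line_derivative C)
  then obtain \<xi> where \<xi>: "0 < \<xi>" "\<xi> < s" and e1: "?k s - ?k 0 = s *
      (partial_deriv a f ((z + s *\<^sub>R b) + \<xi> *\<^sub>R a) - partial_deriv a f (z + \<xi> *\<^sub>R a))" by auto
  let ?m = "\<lambda>r. partial_deriv a f ((z + \<xi> *\<^sub>R a) + r *\<^sub>R b)"
  have "\<exists>\<eta>. 0 < \<eta> \<and> \<eta> < s \<and> ?m s - ?m 0 = (s - 0) * partial_deriv b (partial_deriv a f) ((z + \<xi> *\<^sub>R a) + \<eta> *\<^sub>R b)"
    by (rule MVT2[OF s]) (intro C1_line_derivative C)
  then obtain \<eta> where \<eta>: "0 < \<eta>" "\<eta> < s"
    and e2: "?m s - ?m 0 = s * partial_deriv b (partial_deriv a f) ((z + \<xi> *\<^sub>R a) + \<eta> *\<^sub>R b)" by auto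
  have "f (z + s *\<^sub>R a + s *\<^sub>R b) - f (z + s *\<^sub>R a) - f (z + s *\<^sub>R b) + f z = ?k s - ?k 0"
    by (simp add: algebra_simps)
  also have "\<dots> = s * (?m s - ?m 0)" unfolding e1 by (simp add: algebra_simps)
  also have "\<dots> = s\<^sup>2 * partial_deriv b (partial_deriv a f) (z + \<xi> *\<^sub>R a + \<eta> *\<^sub>R b)"
    unfolding e2 by (simp add: power2_eq_square)
  finally show ?thesis using \<xi> \<eta> by blast
qed

text \<open>The same second difference, expanded by the mean value theorem in both orders, equates
  the two mixed derivatives at points close to \<open>z\<close>; continuity concludes. Symmetry
  matters because the envelopes of \<open>mcf_F\<close> range over symmetric matrices.\<close>

lemma C2_mixed_partials:
  fixes f :: "'a::euclidean_space \<Rightarrow> real"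
  assumes f: "C2 f" and a: "a \<in> Basis" and b: "b \<in> Basis"
  shows "partial_deriv a (partial_deriv b f) z = partial_deriv b (partial_deriv a f) z"
proof -
  have cont: "continuous_on UNIV (partial_deriv c (partial_deriv d f))" if "c \<in> Basis" "d \<in> Basis" for c d
    using f that by (auto simp: C2_def intro: C1_cont_partial)
  have close: "\<exists>s0>0. \<forall>\<xi> \<eta>. 0 < \<xi> \<longrightarrow> \<xi> < s0 \<longrightarrow> 0 < \<eta> \<longrightarrow> \<eta> < s0 \<longrightarrow>
      \<bar>partial_deriv c (partial_deriv d f) (z + \<xi> *\<^sub>R d + \<eta> *\<^sub>R c) - partial_deriv c (partial_deriv d f) z\<bar> < e"
    if cd: "c \<in> Basis" "d \<in> Basis" and e: "0 < e" for c d e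
  proof -
    let ?g = "partial_deriv c (partial_deriv d f)"
    obtain \<delta> where \<delta>: "0 < \<delta>" "\<And>y. dist y z < \<delta> \<Longrightarrow> dist (?g y) (?g z) < e"
      using cont[OF cd] e unfolding continuous_on_iff by (metis UNIV_I)
    have "\<bar>?g (z + \<xi> *\<^sub>R d + \<eta> *\<^sub>R c) - ?g z\<bar> < e"
      if "0 < \<xi>" "\<xi> < \<delta> / 2" "0 < \<eta>" "\<eta> < \<delta> / 2" for \<xi> \<eta>
    proof -
      have "dist (z + \<xi> *\<^sub>R d + \<eta> *\<^sub>R c) z \<le> norm (\<xi> *\<^sub>R d) + norm (\<eta> *\<^sub>R c)"
        unfolding dist_norm by (metis add_diff_cancel_left' add.assoc norm_triangle_ineq)
      also have "\<dots> < \<delta>" using that cd by simp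
      finally show ?thesis using \<delta>(2) by (simp add: dist_real_def)
    qed
    then show ?thesis using \<delta>(1) by (intro exI[of _ "\<delta> / 2"]) auto
  qed
  have "\<bar>partial_deriv a (partial_deriv b f) z - partial_deriv b (partial_deriv a f) z\<bar> \<le> e" if e: "0 < e" for e
  proof -
    obtain s1 where s1: "0 < s1" "\<And>\<xi> \<eta>. \<lbrakk>0 < \<xi>; \<xi> < s1; 0 < \<eta>; \<eta> < s1\<rbrakk> \<Longrightarrow>
      \<bar>partial_deriv b (partial_deriv a f) (z + \<xi> *\<^sub>R a + \<eta> *\<^sub>R b) - partial_deriv b (partial_deriv a f) z\<bar> < e / 2"
      using close[OF b a, of "e / 2"] e by auto
    obtain s2 where s2: "0 < s2" "\<And>\<xi> \<eta>. \<lbrakk>0 < \<xi>; \<xi> < s2; 0 < \<eta>; \<eta> < s2\<rbrakk> \<Longrightarrow>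
      \<bar>partial_deriv a (partial_deriv b f) (z + \<xi> *\<^sub>R b + \<eta> *\<^sub>R a) - partial_deriv a (partial_deriv b f) z\<bar> < e / 2"
      using close[OF a b, of "e / 2"] e by auto
    define s where "s = min s1 s2"
    have s: "0 < s" "s \<le> s1" "s \<le> s2" using s1 s2 by (auto simp: s_def)
    obtain \<xi> \<eta> where A: "0 < \<xi>" "\<xi> < s" "0 < \<eta>" "\<eta> < s"
      "f (z + s *\<^sub>R a + s *\<^sub>R b) - f (z + s *\<^sub>R a) - f (z + s *\<^sub>R b) + f z
      = s\<^sup>2 * partial_deriv b (partial_deriv a f) (z + \<xi> *\<^sub>R a + \<eta> *\<^sub>R b)"
      using C2_second_difference[OF f a s(1)] by blast
    obtain \<xi>' \<eta>' where B: "0 < \<xi>'" "\<xi>' < s" "0 < \<eta>'" "\<eta>' < s"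
      "f (z + s *\<^sub>R b + s *\<^sub>R a) - f (z + s *\<^sub>R b) - f (z + s *\<^sub>R a) + f z
      = s\<^sup>2 * partial_deriv a (partial_deriv b f) (z + \<xi>' *\<^sub>R b + \<eta>' *\<^sub>R a)"
      using C2_second_difference[OF f b s(1)] by blast
    have "f (z + s *\<^sub>R b + s *\<^sub>R a) - f (z + s *\<^sub>R b) - f (z + s *\<^sub>R a) + f z
        = f (z + s *\<^sub>R a + s *\<^sub>R b) - f (z + s *\<^sub>R a) - f (z + s *\<^sub>R b) + f z"
      by (simp add: algebra_simps)
    then have "partial_deriv b (partial_deriv a f) (z + \<xi> *\<^sub>R a + \<eta> *\<^sub>R b)
        = partial_deriv a (partial_deriv b f) (z + \<xi>' *\<^sub>R b + \<eta>' *\<^sub>R a)"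
      unfolding A(5) B(5) using s(1) by simp
    with s1(2)[of \<xi> \<eta>] s2(2)[of \<xi>' \<eta>'] A B s show ?thesis by linarith
  qed
  then have "\<bar>partial_deriv a (partial_deriv b f) z - partial_deriv b (partial_deriv a f) z\<bar> \<le> 0"
    by (rule field_le_epsilon) (use \<open>\<And>e. 0 < e \<Longrightarrow> _ \<le> e\<close> in simp)
  then show ?thesis by simp
qed

section \<open>Test functions with explicit derivatives and their perturbations\<close>

text \<open>A test function bundled with its spatial gradient, spatial Hessian and time derivative.
  In this form the class is visibly closed under translation, change of sign and subtraction of
  quartics.\<close>

definition smooth_test ::
  "((real^'n) \<times> real \<Rightarrow> real) \<Rightarrow> ((real^'n) \<times> real \<Rightarrow> real^'n) \<Rightarrow> ((real^'n) \<times> real \<Rightarrow> real^'n^'n) \<Rightarrow>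
    ((real^'n) \<times> real \<Rightarrow> real) \<Rightarrow> bool" where
  "smooth_test \<phi> G H p \<longleftrightarrow>
    (\<forall>x t. ((\<lambda>x. \<phi> (x, t)) has_derivative (\<lambda>v. G (x, t) \<bullet> v)) (at x)) \<and>
    (\<forall>x t. ((\<lambda>t. \<phi> (x, t)) has_real_derivative p (x, t)) (at t)) \<and>
    (\<forall>x t. ((\<lambda>x. G (x, t)) has_derivative (\<lambda>v. H (x, t) *v v)) (at x)) \<and>
    continuous_on UNIV \<phi> \<and> continuous_on UNIV G \<and> continuous_on UNIV H \<and> continuous_on UNIV p \<and>
    (\<forall>z. transpose (H z) = H z)"

lemma smooth_testD:
  assumes "smooth_test \<phi> G H p"
  shows "((\<lambda>x. \<phi> (x, t)) has_derivative (\<lambda>v. G (x, t) \<bullet> v)) (at x)"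
    "((\<lambda>t. \<phi> (x, t)) has_real_derivative p (x, t)) (at t)"
    "((\<lambda>x. G (x, t)) has_derivative (\<lambda>v. H (x, t) *v v)) (at x)"
    "continuous_on UNIV \<phi>" "continuous_on UNIV G" "continuous_on UNIV H" "continuous_on UNIV p"
    "transpose (H z) = H z"
  using assms unfolding smooth_test_def by blast+

lemma C1_slice_derivative:
  fixes f :: "(real^'n) \<times> real \<Rightarrow> real"
  assumes "C1 f"
  shows "((\<lambda>x. f (x, t)) has_derivative (\<lambda>v. (\<chi> i. partial_deriv (axis i 1, 0) f (x, t)) \<bullet> v)) (at x)"
proof -
  obtain f' where f': "(f has_derivative f') (at (x, t))"
    using assms unfolding C1_def differentiable_def by blast
  have d: "((\<lambda>x. f (x, t)) has_derivative (\<lambda>v. f' (v, 0))) (at x)"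
    by (rule has_derivative_compose[of "\<lambda>x. (x, t)" "\<lambda>v. (v, 0)" x UNIV f f', OF _ f'])
      (auto intro!: derivative_eq_intros)
  have "f' (v, 0) = (\<chi> i. partial_deriv (axis i 1, 0) f (x, t)) \<bullet> v" for v
  proof -
    have "linear (\<lambda>v. f' (v, 0))" using d by (rule has_derivative_linear)
    from linear_axis_sum[OF this, of v] show ?thesis
      by (simp add: partial_deriv_eq[OF f'] inner_vec_def)
  qed
  with d show ?thesis by simp
qed

lemma Basis_slice: "(axis i 1, 0) \<in> (Basis :: ((real^'n) \<times> real) set)" "(0, 1) \<in> (Basis :: ((real^'n) \<times> real) set)"
  by (auto simp: Basis_prod_def)

lemma smooth_test_C2:
  fixes \<phi> :: "(real^'n) \<times> real \<Rightarrow> real"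
  assumes "C2 \<phi>"
  shows "smooth_test \<phi> (space_grad \<phi>) (space_hess \<phi>) (time_deriv \<phi>)"
proof -
  have C: "C1 \<phi>" "\<And>b. b \<in> Basis \<Longrightarrow> C1 (partial_deriv b \<phi>)" using assms by (auto simp: C2_def)
  have sym: "space_hess \<phi> z $ i $ j = space_hess \<phi> z $ j $ i" for z i j
    by (simp add: space_hess_def C2_mixed_partials[OF assms Basis_slice(1) Basis_slice(1)])
  show ?thesis
    unfolding smooth_test_def
  proof (intro conjI allI)
    fix x t
    show "((\<lambda>x. \<phi> (x, t)) has_derivative (\<lambda>v. space_grad \<phi> (x, t) \<bullet> v)) (at x)"
      unfolding space_grad_def by (rule C1_slice_derivative[OF C(1)])
    show "((\<lambda>t. \<phi> (x, t)) has_real_derivative time_deriv \<phi> (x, t)) (at t)"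
      using C1_line_derivative[OF C(1), of "(x, 0)" "(0, 1)" t] by (simp add: time_deriv_def)
    show "((\<lambda>x. space_grad \<phi> (x, t)) has_derivative (\<lambda>v. space_hess \<phi> (x, t) *v v)) (at x)"
    proof (subst has_derivative_componentwise_within, rule ballI)
      fix b :: "real^'n" assume "b \<in> Basis"
      then obtain j where b: "b = axis j 1" by (auto simp: Basis_vec_def)
      have e1: "(\<lambda>x. space_grad \<phi> (x, t) \<bullet> b) = (\<lambda>x. partial_deriv (axis j 1, 0) \<phi> (x, t))"
        by (simp add: b space_grad_def inner_axis)
      have e2: "(\<lambda>v. (space_hess \<phi> (x, t) *v v) \<bullet> b)
         = (\<lambda>v. (\<chi> i. partial_deriv (axis i 1, 0) (partial_deriv (axis j 1, 0) \<phi>) (x, t)) \<bullet> v)"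
      proof
        fix v
        have "(space_hess \<phi> (x, t) *v v) \<bullet> b = (\<Sum>i\<in>UNIV. space_hess \<phi> (x, t) $ j $ i * v $ i)"
          by (simp add: b inner_axis matrix_vector_mult_def)
        also have "\<dots> = (\<Sum>i\<in>UNIV. space_hess \<phi> (x, t) $ i $ j * v $ i)"
          by (simp only: sym[of _ j])
        finally show "(space_hess \<phi> (x, t) *v v) \<bullet> b
         = (\<chi> i. partial_deriv (axis i 1, 0) (partial_deriv (axis j 1, 0) \<phi>) (x, t)) \<bullet> v"
          by (simp add: space_hess_def inner_vec_def)
      qed
      show "((\<lambda>x. space_grad \<phi> (x, t) \<bullet> b) has_derivative (\<lambda>v. (space_hess \<phi> (x, t) *v v) \<bullet> b)) (at x)"
        unfolding e1 e2 by (rule C1_slice_derivative[OF C(2)[OF Basis_slice(1)]])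
    qed
  next
    show "continuous_on UNIV \<phi>" by (rule C1_continuous_on[OF C(1)])
    show "continuous_on UNIV (space_grad \<phi>)"
      unfolding space_grad_def[abs_def]
      by (intro continuous_on_vec_lambda C1_cont_partial[OF C(1) Basis_slice(1)])
    show "continuous_on UNIV (space_hess \<phi>)"
      unfolding space_hess_def[abs_def]
      by (intro continuous_on_vec_lambda C1_cont_partial[OF C(2) Basis_slice(1)] Basis_slice(1))
    show "continuous_on UNIV (time_deriv \<phi>)"
      unfolding time_deriv_def[abs_def] by (rule C1_cont_partial[OF C(1) Basis_slice(2)])
    show "transpose (space_hess \<phi> z) = space_hess \<phi> z" for z
      by (simp add: transpose_def vec_eq_iff sym)
  qed
qed

text \<open>Value, gradient and Hessian of the fourth power vanish at 0, so subtracting it from a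
  test function makes a minimum strict without changing the derivatives at the contact.\<close>

definition quart :: "'a::real_inner \<Rightarrow> real" where "quart w = (w \<bullet> w)\<^sup>2"

definition quart_grad :: "'a::real_inner \<Rightarrow> 'a" where "quart_grad w = (4 * (w \<bullet> w)) *\<^sub>R w"

definition quart_hess :: "real^'n \<Rightarrow> real^'n^'n" where
  "quart_hess w = (\<chi> i j. (if i = j then 4 * (w \<bullet> w) else 0) + 8 * (w $ i * w $ j))"

lemma quart_norm: "quart w = norm w ^ 4"
  by (simp add: quart_def power2_norm_eq_inner[symmetric])

lemma quart_deriv: "((\<lambda>x. quart (x - a)) has_derivative (\<lambda>v. quart_grad (x - a) \<bullet> v)) (at x)"
  unfolding quart_def quart_grad_def
  by (auto intro!: derivative_eq_intros simp: inner_commute fun_eq_iff)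

lemma quart_hess_mult: "quart_hess w *v v = (4 * (w \<bullet> w)) *\<^sub>R v + (8 * (w \<bullet> v)) *\<^sub>R w"
proof (simp add: vec_eq_iff matrix_vector_mult_def quart_hess_def, rule allI)
  fix i
  have "(\<Sum>j\<in>UNIV. ((if i = j then 4 * (w \<bullet> w) else 0) + 8 * (w $ i * w $ j)) * v $ j)
    = (\<Sum>j\<in>UNIV. (if i = j then 4 * (w \<bullet> w) * v $ j else 0)) + 8 * w $ i * (\<Sum>j\<in>UNIV. w $ j * v $ j)"
    unfolding sum_distrib_left sum.distrib[symmetric] by (rule sum.cong) (auto simp: algebra_simps)
  also have "\<dots> = 4 * (w \<bullet> w) * v $ i + 8 * (w \<bullet> v) * w $ i"
    by (simp add: inner_vec_def)
  finally show "(\<Sum>j\<in>UNIV. ((if i = j then 4 * (w \<bullet> w) else 0) + 8 * (w $ i * w $ j)) * v $ j)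
    = 4 * (w \<bullet> w) * v $ i + 8 * (w \<bullet> v) * w $ i" .
qed

lemma quart_grad_deriv: "((\<lambda>x. quart_grad (x - a)) has_derivative (\<lambda>v. quart_hess (x - a) *v v)) (at x)"
  unfolding quart_grad_def quart_hess_mult
  by (auto intro!: derivative_eq_intros simp: inner_commute fun_eq_iff algebra_simps)

lemma continuous_quart [continuous_intros]:
  "continuous_on S f \<Longrightarrow> continuous_on S (\<lambda>x. quart (f x))"
  unfolding quart_def by (intro continuous_intros)

lemma continuous_quart_grad [continuous_intros]:
  "continuous_on S f \<Longrightarrow> continuous_on S (\<lambda>x. quart_grad (f x))"
  unfolding quart_grad_def by (intro continuous_intros)

lemma continuous_quart_hess [continuous_intros]:
  "continuous_on S f \<Longrightarrow> continuous_on S (\<lambda>x. quart_hess (f x))"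
  unfolding quart_hess_def
proof (intro continuous_on_vec_lambda)
  fix i j
  assume "continuous_on S f"
  then show "continuous_on S (\<lambda>x. (if i = j then 4 * (f x \<bullet> f x) else 0) + 8 * (f x $ i * f x $ j))"
    by (cases "i = j") (auto intro!: continuous_intros)
qed

lemma quart_zero [simp]: "quart 0 = 0" "quart_grad 0 = 0" "quart_hess 0 = 0"
  by (auto simp: quart_def quart_grad_def quart_hess_def vec_eq_iff)

lemma transpose_quart_hess: "transpose (quart_hess w) = quart_hess w"
  by (auto simp: transpose_def quart_hess_def vec_eq_iff)

lemma transpose_diff: "transpose (A - B) = transpose A - transpose (B :: real^'n^'m)"
  by (simp add: transpose_def vec_eq_iff)

lemma transpose_minus: "transpose (- A) = - transpose (A :: real^'n^'m)"
  by (simp add: transpose_def vec_eq_iff)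

lemma smooth_test_quartic:
  assumes "smooth_test \<phi> G H p"
  shows "smooth_test (\<lambda>z. \<phi> z - quart (fst z - a) - (snd z - b) ^ 4) (\<lambda>z. G z - quart_grad (fst z - a))
    (\<lambda>z. H z - quart_hess (fst z - a)) (\<lambda>z. p z - 4 * (snd z - b) ^ 3)"
proof -
  note D = smooth_testD[OF assms]
  show ?thesis
    unfolding smooth_test_def
  proof (intro conjI allI)
    fix x t
    show "((\<lambda>x. \<phi> (x, t) - quart (fst (x, t) - a) - (snd (x, t) - b) ^ 4) has_derivative
        (\<lambda>v. (G (x, t) - quart_grad (fst (x, t) - a)) \<bullet> v)) (at x)"
      by (auto intro!: derivative_eq_intros D(1) quart_deriv simp: inner_diff_left)
    show "((\<lambda>t. \<phi> (x, t) - quart (fst (x, t) - a) - (snd (x, t) - b) ^ 4) has_real_derivative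
        p (x, t) - 4 * (snd (x, t) - b) ^ 3) (at t)"
      by (auto intro!: derivative_eq_intros D(2))
    show "((\<lambda>x. G (x, t) - quart_grad (fst (x, t) - a)) has_derivative
        (\<lambda>v. (H (x, t) - quart_hess (fst (x, t) - a)) *v v)) (at x)"
      by (auto intro!: derivative_eq_intros D(3) quart_grad_deriv simp: matrix_vector_mult_diff_rdistrib)
    show "transpose (H z - quart_hess (fst z - a)) = H z - quart_hess (fst z - a)" for z
      by (simp add: transpose_diff transpose_quart_hess D(8))
  qed (intro continuous_intros D)+
qed

lemma smooth_test_translate:
  assumes "smooth_test \<phi> G H p"
  shows "smooth_test (\<lambda>z. \<phi> (fst z + c, snd z)) (\<lambda>z. G (fst z + c, snd z))
    (\<lambda>z. H (fst z + c, snd z)) (\<lambda>z. p (fst z + c, snd z))"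
proof -
  note D = smooth_testD[OF assms]
  have sh: "((\<lambda>x. x + c) has_derivative (\<lambda>v. v)) (at x)" for x :: "real^'a"
    by (auto intro!: derivative_eq_intros)
  show ?thesis
    unfolding smooth_test_def
  proof (intro conjI allI)
    fix x t
    show "((\<lambda>x. \<phi> (fst (x, t) + c, snd (x, t))) has_derivative (\<lambda>v. G (fst (x, t) + c, snd (x, t)) \<bullet> v)) (at x)"
      using has_derivative_compose[OF sh D(1)[of t "x + c"]] by simp
    show "((\<lambda>x. G (fst (x, t) + c, snd (x, t))) has_derivative (\<lambda>v. H (fst (x, t) + c, snd (x, t)) *v v)) (at x)"
      using has_derivative_compose[OF sh D(3)[of t "x + c"]] by simp
    show "((\<lambda>t. \<phi> (fst (x, t) + c, snd (x, t))) has_real_derivative p (fst (x, t) + c, snd (x, t))) (at t)"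
      using D(2) by simp
  qed (auto intro!: continuous_on_compose2[OF D(4)] continuous_on_compose2[OF D(5)] continuous_on_compose2[OF D(6)]
      continuous_on_compose2[OF D(7)] continuous_intros simp: D(8))
qed

lemma smooth_test_uminus:
  assumes "smooth_test \<phi> G H p"
  shows "smooth_test (\<lambda>z. - \<phi> z) (\<lambda>z. - G z) (\<lambda>z. - H z) (\<lambda>z. - p z)"
proof -
  note D = smooth_testD[OF assms]
  have mv: "(- A) *v v = - (A *v v)" for A :: "real^'a^'a" and v
    by (simp add: matrix_vector_mult_def vec_eq_iff sum_negf)
  show ?thesis
    unfolding smooth_test_def mv
    by (auto intro!: derivative_eq_intros continuous_intros D simp: transpose_minus)
qed

section \<open>The curvature operator on level sets\<close>

lemma mcf_F_eq: "mcf_F p X = p \<bullet> (X *v p) / (norm p)\<^sup>2 - trace X"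
proof -
  have "trace ((\<chi> i j. p $ i * p $ j / (norm p)\<^sup>2) ** X) = (\<Sum>i\<in>UNIV. \<Sum>k\<in>UNIV. p $ i * p $ k / (norm p)\<^sup>2 * X $ k $ i)"
    by (simp add: trace_def matrix_matrix_mult_def)
  also have "\<dots> = (\<Sum>k\<in>UNIV. \<Sum>i\<in>UNIV. p $ i * p $ k / (norm p)\<^sup>2 * X $ k $ i)"
    by (rule sum.swap)
  also have "\<dots> = p \<bullet> (X *v p) / (norm p)\<^sup>2"
    by (simp add: inner_vec_def matrix_vector_mult_def sum_divide_distrib sum_distrib_left algebra_simps)
  finally have "trace ((\<chi> i j. p $ i * p $ j / (norm p)\<^sup>2) ** X) = p \<bullet> (X *v p) / (norm p)\<^sup>2" .
  moreover have "(A - B) ** X = A ** X - B ** X" for A B :: "real^'a^'a"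
    by (simp add: matrix_matrix_mult_def vec_eq_iff left_diff_distrib sum_subtractf)
  ultimately show ?thesis
    unfolding mcf_F_def by (simp add: trace_sub)
qed

text \<open>This oddness turns the subsolution inequality for \<open>u\<close> into the
  supersolution inequality for \<open>- u\<close>.\<close>

lemma mcf_F_uminus: "mcf_F (- p) (- X) = - mcf_F p X"
  by (simp add: mcf_F_eq matrix_vector_mult_def inner_vec_def trace_def sum_negf algebra_simps)

text \<open>Mean curvature of level sets: differentiating \<open>G\<close> produces the trace of
  \<open>H\<close>, differentiating 1 / |G| the term in the normal direction.\<close>

lemma divergence_unit_field:
  fixes G :: "real^'n \<Rightarrow> real^'n"
  assumes "0 < q0" "q0 \<le> G x \<bullet> G x" "(G has_derivative (\<lambda>v. H *v v)) (at x)"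
  shows "divergence (\<lambda>x. unit_field q0 (G x)) x = - mcf_F (G x) H / norm (G x)"
proof -
  let ?m = "norm (G x)"
  have gg: "G x \<bullet> G x = ?m\<^sup>2" by (simp add: power2_norm_eq_inner)
  have m: "0 < ?m"
    using assms(1,2) by (metis inner_zero_left less_le_trans norm_zero not_less order_refl zero_less_norm_iff)
  have r: "rsq q0 (G x \<bullet> G x) = 1 / ?m" using assms(2) m by (simp add: rsq_def gg)
  have r': "rsq' q0 (G x \<bullet> G x) = - 1 / (2 * ?m\<^sup>2 * ?m)" using assms(2) m by (simp add: rsq'_def gg max_absorb2)
  have col: "(\<Sum>i\<in>UNIV. G x \<bullet> (H *v axis i 1) * G x $ i) = G x \<bullet> (H *v G x)"
  proof (rule linear_axis_sum)
    show "linear (\<lambda>v. G x \<bullet> (H *v v))"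
      by (rule linearI) (simp_all add: matrix_vector_right_distrib inner_add_right scaleR_matrix_vector_assoc[symmetric] matrix_vector_mult_scaleR)
  qed
  have tr: "(\<Sum>i\<in>UNIV. (H *v axis i 1) $ i) = trace H"
    by (simp add: trace_def matrix_vector_mult_basis column_def)
  have "divergence (\<lambda>x. unit_field q0 (G x)) x
    = (\<Sum>i\<in>UNIV. (1 / ?m) * (H *v axis i 1) $ i - (1 / (?m\<^sup>2 * ?m)) * (G x \<bullet> (H *v axis i 1) * G x $ i))"
    unfolding divergence_eq[OF unit_field_deriv[OF assms(1,3)]] r r'
    by (rule sum.cong) (simp_all add: algebra_simps)
  also have "\<dots> = (1 / ?m) * trace H - (1 / (?m\<^sup>2 * ?m)) * (G x \<bullet> (H *v G x))"
    unfolding sum_subtractf sum_distrib_left[symmetric] col tr ..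
  also have "\<dots> = - mcf_F (G x) H / ?m"
    using m unfolding mcf_F_eq by (simp add: field_simps)
  finally show ?thesis .
qed

section \<open>Signed distance from gradient bounds\<close>

lemma directional_growth:
  fixes f :: "'a::euclidean_space \<Rightarrow> real"
  assumes f: "\<And>y. dist x y \<le> R \<Longrightarrow> (f has_derivative (\<lambda>v. Gf y \<bullet> v)) (at y)"
    and Gf: "\<And>y. dist x y \<le> R \<Longrightarrow> norm (Gf y - P) \<le> \<kappa>"
    and P: "P \<noteq> 0" and \<tau>: "0 < \<tau>" "\<tau> \<le> R"
  shows "f x + \<tau> * (norm P - \<kappa>) \<le> f (x + (\<tau> / norm P) *\<^sub>R P)"
proof -
  define e where "e = (1 / norm P) *\<^sub>R P"
  have ne: "norm e = 1" using P by (simp add: e_def)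
  have Pe: "P \<bullet> e = norm P" using P by (simp add: e_def dot_square_norm power2_eq_square)
  have dx: "dist x (x + r *\<^sub>R e) \<le> R" if "0 \<le> r" "r \<le> \<tau>" for r
    using that \<tau> ne by (simp add: dist_norm)
  have d: "((\<lambda>r. f (x + r *\<^sub>R e)) has_real_derivative Gf (x + r *\<^sub>R e) \<bullet> e) (at r)" if "0 \<le> r" "r \<le> \<tau>" for r
  proof -
    have "((\<lambda>r. f (x + r *\<^sub>R e)) has_derivative (\<lambda>s. Gf (x + r *\<^sub>R e) \<bullet> (s *\<^sub>R e))) (at r)"
      by (rule has_derivative_compose[of "\<lambda>r. x + r *\<^sub>R e" "\<lambda>s. s *\<^sub>R e" r UNIV f "\<lambda>v. Gf (x + r *\<^sub>R e) \<bullet> v", OF _ f[OF dx[OF that]]])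
        (auto intro!: derivative_eq_intros)
    moreover have "(\<lambda>s. Gf (x + r *\<^sub>R e) \<bullet> (s *\<^sub>R e)) = (*) (Gf (x + r *\<^sub>R e) \<bullet> e)"
      by (rule ext) simp
    ultimately show ?thesis unfolding has_field_derivative_def by (simp only:)
  qed
  obtain r where r: "0 < r" "r < \<tau>" "f (x + \<tau> *\<^sub>R e) - f (x + 0 *\<^sub>R e) = (\<tau> - 0) * (Gf (x + r *\<^sub>R e) \<bullet> e)"
    using MVT2[OF \<tau>(1), of "\<lambda>r. f (x + r *\<^sub>R e)", OF d] by blast
  have "\<bar>(Gf (x + r *\<^sub>R e) - P) \<bullet> e\<bar> \<le> \<kappa>"
    using Cauchy_Schwarz_ineq2[of "Gf (x + r *\<^sub>R e) - P" e] Gf[OF dx[of r]] r ne by simp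
  then have "norm P - \<kappa> \<le> Gf (x + r *\<^sub>R e) \<bullet> e" using Pe by (simp add: inner_diff_left)
  then have "\<tau> * (norm P - \<kappa>) \<le> \<tau> * (Gf (x + r *\<^sub>R e) \<bullet> e)" using \<tau> by (intro mult_left_mono) auto
  then show ?thesis using r(3) by (simp add: e_def)
qed

text \<open>For \<open>a > 0\<close> the function is Lipschitz with constant
  \<open>norm P + \<kappa>\<close>, which keeps \<open>D\<close> at distance. Otherwise moving along
  \<open>P\<close> raises \<open>f\<close> at rate at least \<open>norm P - \<kappa>\<close>, so
  \<open>D\<close> is left after a length just above \<open>- a / l\<close>. The two denominators
  differ, hence the existential \<open>b\<close>; \<open>aR\<close> keeps the motion in the
  ball.\<close>

lemma sd_lower_bound:
  fixes f :: "'a::euclidean_space \<Rightarrow> real"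
  assumes f: "\<And>y. dist x y \<le> R \<Longrightarrow> (f has_derivative (\<lambda>v. Gf y \<bullet> v)) (at y)"
    and Gf: "\<And>y. dist x y \<le> R \<Longrightarrow> norm (Gf y - P) \<le> \<kappa>"
    and \<kappa>: "0 < \<kappa>" "\<kappa> < norm P" and D: "D \<noteq> {}"
    and Df: "\<And>y. y \<in> D \<Longrightarrow> dist x y \<le> R \<Longrightarrow> f y \<le> c"
    and fx: "c + a \<le> f x" and aR: "\<bar>a\<bar> / (norm P - \<kappa>) < R"
  obtains b where "norm P - \<kappa> \<le> b" "b \<le> norm P + \<kappa>" "a / b \<le> sd D x"
proof -
  have P: "P \<noteq> 0" using \<kappa> by auto
  define l where "l = norm P - \<kappa>"
  define L where "L = norm P + \<kappa>"
  have l: "0 < l" "l \<le> L" using \<kappa> by (auto simp: l_def L_def)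
  have R: "0 < R" using aR l by (smt (verit) divide_nonneg_pos l_def)
  show thesis
  proof (cases "0 < a")
    case True
    have aL: "0 < a / L" using True l by simp
    have aLR: "a / L \<le> R"
    proof -
      have "a / L \<le> a / l" using True l by (intro divide_left_mono) auto
      then show ?thesis using aR True by (simp add: l_def)
    qed
    have "a / L \<le> dist x y" if y: "y \<in> D" for y
    proof (cases "dist x y \<le> R")
      case inR: True
      have "norm (f x - f y) \<le> L * norm (x - y)"
      proof (rule differentiable_bound[of "cball x R" f "\<lambda>y v. Gf y \<bullet> v"])
        fix w assume w: "w \<in> cball x R"
        show "(f has_derivative (\<lambda>v. Gf w \<bullet> v)) (at w within cball x R)"
          using f[of w] w by (auto intro: has_derivative_at_withinI)
        have "norm (Gf w) \<le> L"
          using norm_triangle_sub[of "Gf w" P] Gf[of w] w by (simp add: L_def)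
        then show "onorm (\<lambda>v. Gf w \<bullet> v) \<le> L"
          by (intro onorm_le) (metis Cauchy_Schwarz_ineq2 mult_right_mono norm_ge_zero order_trans real_norm_def)
      qed (use inR R in auto)
      then have "f x - f y \<le> L * dist x y" by (simp add: dist_norm)
      moreover have "a \<le> f x - f y" using Df[OF y inR] fx by linarith
      ultimately have "a \<le> L * dist x y" by linarith
      then show ?thesis using l by (simp add: field_simps)
    qed (use aLR in auto)
    from sd_ge[OF D aL this] that[of L] l show ?thesis by (simp add: l_def L_def)
  next
    case False
    have "a / l \<le> sd D x"
    proof (rule dense_le)
      fix q assume q: "q < a / l"
      define \<tau> where "\<tau> = min (- q) R"
      have al: "- a / l < R" using aR False by (simp add: l_def)
      have qp: "- a / l < - q" using q by simp
      have an: "0 \<le> - a / l" using False l by (simp add: divide_nonpos_pos not_less)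
      have \<tau>: "0 < \<tau>" "\<tau> \<le> R" "- a / l < \<tau>" "\<tau> \<le> - q"
        using al qp an R unfolding \<tau>_def min_def by (auto simp del: minus_divide_left split: if_splits)
      have "f x + \<tau> * l \<le> f (x + (\<tau> / norm P) *\<^sub>R P)"
        unfolding l_def by (rule directional_growth[OF f Gf P \<tau>(1,2)])
      moreover have "- a < \<tau> * l" using \<tau>(3) l by (simp add: field_simps)
      ultimately have "c < f (x + (\<tau> / norm P) *\<^sub>R P)" using fx by linarith
      moreover have dd: "dist x (x + (\<tau> / norm P) *\<^sub>R P) = \<tau>" using P \<tau> by (simp add: dist_norm)
      ultimately have "x + (\<tau> / norm P) *\<^sub>R P \<notin> D" using Df[of "x + (\<tau> / norm P) *\<^sub>R P"] \<tau> by force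
      from sd_ge_minus[OF this, of x] dd \<tau>(4) show "q \<le> sd D x" by simp
    qed
    then show ?thesis using that[of l] l by (simp add: l_def L_def)
  qed
qed

section \<open>The limit of the discrete flow\<close>

text \<open>The common setting for \<open>u\<close> and \<open>- u\<close>. The sets
  \<open>D k\<close> are squeezed between strict and non-strict sublevel sets because the complement
  of {u \<le> -s} is the strict set {-u < s}. \<open>U s\<close> is the region free of the obstacle
  at level \<open>s\<close>.\<close>

locale scheme_limit =
  fixes T :: real and U :: "real \<Rightarrow> (real^'n) set" and hs :: "nat \<Rightarrow> real"
    and v :: "nat \<Rightarrow> (real^'n) \<times> real \<Rightarrow> real" and w :: "(real^'n) \<times> real \<Rightarrow> real"
  assumes hs_pos: "\<And>j. 0 < hs j" and hs_lim: "hs \<longlonglongrightarrow> 0"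
    and levels: "\<And>j s. \<exists>D. (\<forall>k. real k * hs j < T \<longrightarrow>
        {x. v j (x, real k * hs j) < s} \<subseteq> D k \<and> D k \<subseteq> {x. v j (x, real k * hs j) \<le> s}) \<and>
        (\<forall>k. cut_step (hs j) (U s) (D k) (D (Suc k)))"
    and time_steps: "\<And>j x t. 0 \<le> t \<Longrightarrow> t < T \<Longrightarrow> v j (x, t) = v j (x, real (nat \<lfloor>t / hs j\<rfloor>) * hs j)"
    and lim: "\<And>K. compact K \<Longrightarrow> K \<subseteq> UNIV \<times> {0..<T} \<Longrightarrow> uniform_limit K v w sequentially"
    and cont: "continuous_on (UNIV \<times> {0..<T}) w"
begin

lemma eventually_close:
  assumes "0 < e" "0 \<le> a" "b < T"
  shows "\<forall>\<^sub>F j in sequentially. \<forall>x t. dist x0 x \<le> r \<longrightarrow> a \<le> t \<longrightarrow> t \<le> b \<longrightarrow> \<bar>v j (x, t) - w (x, t)\<bar> < e"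
proof -
  have "compact (cball x0 r \<times> {a..b})" by (intro compact_Times) auto
  moreover have "cball x0 r \<times> {a..b} \<subseteq> UNIV \<times> {0..<T}" using assms by auto
  ultimately have "uniform_limit (cball x0 r \<times> {a..b}) v w sequentially" by (rule lim)
  from uniform_limitD[OF this assms(1)] show ?thesis
    by (rule eventually_mono) (auto simp: dist_real_def)
qed

lemma floor_step:
  assumes "0 \<le> t" "0 < h"
  shows "real (nat \<lfloor>t / h\<rfloor>) * h \<le> t" "t - h < real (nat \<lfloor>t / h\<rfloor>) * h"
proof -
  have "0 \<le> t / h" using assms by simp
  then have e: "real (nat \<lfloor>t / h\<rfloor>) = of_int \<lfloor>t / h\<rfloor>" by simp
  have "of_int \<lfloor>t / h\<rfloor> \<le> t / h" "t / h < of_int \<lfloor>t / h\<rfloor> + 1" by linarith+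
  then show "real (nat \<lfloor>t / h\<rfloor>) * h \<le> t" "t - h < real (nat \<lfloor>t / h\<rfloor>) * h"
    using assms(2) unfolding e pos_le_divide_eq[OF assms(2)] pos_divide_less_eq[OF assms(2)]
    by (auto simp: algebra_simps)
qed

end

text \<open>Speeds are compared after division by gradient norms taken at different points;
  \<open>\<kappa>\<close> is the oscillation of the norm that can be afforded. Cross-multiplication
  needs (|c| + |v|) \<kappa> < (v - c) P.\<close>

lemma quotient_gap:
  fixes c v P :: real
  assumes "0 < P" "c < v"
  obtains \<kappa> where "0 < \<kappa>" "\<kappa> < P"
    "\<And>a b. \<lbrakk>P - \<kappa> \<le> a; a \<le> P + \<kappa>; P - \<kappa> \<le> b; b \<le> P + \<kappa>\<rbrakk> \<Longrightarrow> c / a < v / b"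
proof -
  define \<kappa> where "\<kappa> = min (P / 2) ((v - c) * P / (2 * (\<bar>c\<bar> + \<bar>v\<bar> + 1)))"
  have \<kappa>0: "0 < \<kappa>" using assms by (simp add: \<kappa>_def)
  have \<kappa>1: "\<kappa> \<le> P / 2" unfolding \<kappa>_def by (rule min.cobounded1)
  have \<kappa>2: "(\<bar>c\<bar> + \<bar>v\<bar>) * \<kappa> < (v - c) * P"
  proof -
    have "\<kappa> \<le> (v - c) * P / (2 * (\<bar>c\<bar> + \<bar>v\<bar> + 1))" by (simp add: \<kappa>_def)
    then have "2 * (\<bar>c\<bar> + \<bar>v\<bar> + 1) * \<kappa> \<le> (v - c) * P" by (simp add: field_simps)
    moreover have "(\<bar>c\<bar> + \<bar>v\<bar>) * \<kappa> < 2 * (\<bar>c\<bar> + \<bar>v\<bar> + 1) * \<kappa>"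
      using \<kappa>0 by (intro mult_strict_right_mono) auto
    ultimately show ?thesis by linarith
  qed
  have "c / a < v / b" if ab: "P - \<kappa> \<le> a" "a \<le> P + \<kappa>" "P - \<kappa> \<le> b" "b \<le> P + \<kappa>" for a b
  proof -
    have pos: "0 < a" "0 < b" using ab \<kappa>1 assms by auto
    have "\<bar>v * (a - P)\<bar> \<le> \<bar>v\<bar> * \<kappa>" "\<bar>c * (b - P)\<bar> \<le> \<bar>c\<bar> * \<kappa>"
      unfolding abs_mult using ab by (auto intro!: mult_left_mono)
    then have "(v - c) * P - (\<bar>c\<bar> + \<bar>v\<bar>) * \<kappa> \<le> v * a - c * b"
      by (simp add: algebra_simps abs_le_iff)
    then have "c * b < v * a" using \<kappa>2 by linarith
    then show ?thesis using pos by (simp add: field_simps)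
  qed
  moreover have "\<kappa> < P" using \<kappa>1 assms by simp
  ultimately show ?thesis using that \<kappa>0 by blast
qed

lemma norm_diff_diff_le:
  fixes a b c :: "'a::real_normed_vector"
  shows "norm (a - b - c) \<le> norm (a - c) + norm b"
  using norm_triangle_ineq4[of "a - c" b] by (simp add: algebra_simps)

lemma continuous_on_matrix_vector:
  fixes A :: "'a::topological_space \<Rightarrow> real^'n^'m"
  assumes "continuous_on S A"
  shows "continuous_on S (\<lambda>x. A x *v b)"
  unfolding matrix_vector_mult_def
  by (intro continuous_on_vec_lambda continuous_intros assms)

lemma positive_lower_bound:
  fixes xs :: "real list"
  assumes "\<forall>x\<in>set xs. 0 < x"
  shows "\<exists>r>0. \<forall>x\<in>set xs. r \<le> x"
  using assms
proof (induction xs)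
  case (Cons a xs)
  then obtain r where "0 < r" "\<forall>x\<in>set xs. r \<le> x" by auto
  then show ?case using Cons.prems by (intro exI[of _ "min a r"]) (auto intro: min.coboundedI2)
qed (auto intro: exI[of _ 1])

lemma continuous_box:
  fixes f :: "(real^'n) \<times> real \<Rightarrow> 'b::metric_space"
  assumes "continuous_on UNIV f" "0 < e"
  obtains r where "0 < r" "\<And>x t. dist x0 x \<le> r \<Longrightarrow> \<bar>t - t0\<bar> \<le> r \<Longrightarrow> dist (f (x, t)) (f (x0, t0)) < e"
proof -
  obtain \<delta> where \<delta>: "0 < \<delta>" "\<And>y. dist y (x0, t0) < \<delta> \<Longrightarrow> dist (f y) (f (x0, t0)) < e"
    using assms unfolding continuous_on_iff by (metis UNIV_I)
  have "dist (f (x, t)) (f (x0, t0)) < e" if "dist x0 x \<le> \<delta> / 3" "\<bar>t - t0\<bar> \<le> \<delta> / 3" for x t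
  proof (rule \<delta>(2))
    have "dist (x, t) (x0, t0) \<le> dist x x0 + dist t t0"
      unfolding dist_Pair_Pair by (rule sqrt_sum_squares_le_sum) auto
    also have "\<dots> < \<delta>" using that \<delta>(1) unfolding dist_commute[of x] dist_real_def by linarith
    finally show "dist (x, t) (x0, t0) < \<delta>" .
  qed
  then show ?thesis using that[of "\<delta> / 3"] \<delta>(1) by auto
qed

text \<open>A negation of the supersolution inequality at \<open>(x0, t0)\<close> in a form that is stable under
  perturbations of the test function.\<close>

definition strict_test ::
  "((real^'n) \<times> real \<Rightarrow> real^'n) \<Rightarrow> ((real^'n) \<times> real \<Rightarrow> real^'n^'n) \<Rightarrow> ((real^'n) \<times> real \<Rightarrow> real) \<Rightarrow>
    (real^'n) \<times> real \<Rightarrow> real \<Rightarrow> real \<Rightarrow> bool" where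
  "strict_test G H p z \<beta> c \<longleftrightarrow> 0 < \<beta> \<and> p z < - c \<and>
     (\<forall>q Y. q \<noteq> 0 \<longrightarrow> norm (q - G z) < \<beta> \<longrightarrow> norm (Y - H z) < \<beta> \<longrightarrow> transpose Y = Y \<longrightarrow> mcf_F q Y < c)"

section \<open>Contact with a test function of nonzero gradient\<close>

context scheme_limit
begin

lemma limit_locally_below:
  assumes t0: "0 < t0" "t0 < T" and e: "0 < e"
  obtains r where "0 < r"
    "\<And>x t. dist x0 x \<le> r \<Longrightarrow> \<bar>t - t0\<bar> \<le> r \<Longrightarrow> 0 \<le> t \<Longrightarrow> t < T \<Longrightarrow> w (x, t) < w (x0, t0) + e"
proof -
  obtain \<delta> where \<delta>: "0 < \<delta>" "\<And>y. y \<in> UNIV \<times> {0..<T} \<Longrightarrow> dist y (x0, t0) < \<delta> \<Longrightarrow> dist (w y) (w (x0, t0)) < e"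
    using cont[unfolded continuous_on_iff, rule_format, of "(x0, t0)" e] t0 e by auto
  have "w (x, t) < w (x0, t0) + e" if "dist x0 x \<le> \<delta> / 3" "\<bar>t - t0\<bar> \<le> \<delta> / 3" "0 \<le> t" "t < T" for x t
  proof -
    have "dist (x, t) (x0, t0) \<le> dist x x0 + dist t t0"
      unfolding dist_Pair_Pair by (rule sqrt_sum_squares_le_sum) auto
    also have "\<dots> < \<delta>" using that \<delta>(1) unfolding dist_commute[of x] dist_real_def by linarith
    finally have "dist (w (x, t)) (w (x0, t0)) < e" using that by (intro \<delta>(2)) auto
    then show ?thesis unfolding dist_real_def by linarith
  qed
  then show ?thesis using that[of "\<delta> / 3"] \<delta>(1) by auto
qed

lemma localize:
  assumes st: "smooth_test \<phi> G H p" and t0: "0 < t0" "t0 < T" and r0: "0 < r0"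
    and e: "0 < e1" "0 < e2" "0 < e3"
  shows "\<exists>r>0. r \<le> r0 \<and> (\<forall>t. \<bar>t - t0\<bar> \<le> r \<longrightarrow> 0 < t \<and> t < T) \<and>
    (\<forall>x t. dist x0 x \<le> r \<longrightarrow> \<bar>t - t0\<bar> \<le> r \<longrightarrow> norm (G (x, t) - G (x0, t0)) < e1 \<and>
      norm (H (x, t) - H (x0, t0)) < e1 \<and> \<bar>p (x, t) - p (x0, t0)\<bar> < e2 \<and> w (x, t) < w (x0, t0) + e3)"
proof -
  note S = smooth_testD[OF st]
  obtain ra where ra: "0 < ra" "\<And>x t. dist x0 x \<le> ra \<Longrightarrow> \<bar>t - t0\<bar> \<le> ra \<Longrightarrow> dist (G (x, t)) (G (x0, t0)) < e1"
    using continuous_box[OF S(5) e(1)] by metis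
  obtain rb where rb: "0 < rb" "\<And>x t. dist x0 x \<le> rb \<Longrightarrow> \<bar>t - t0\<bar> \<le> rb \<Longrightarrow> dist (H (x, t)) (H (x0, t0)) < e1"
    using continuous_box[OF S(6) e(1)] by metis
  obtain rc where rc: "0 < rc" "\<And>x t. dist x0 x \<le> rc \<Longrightarrow> \<bar>t - t0\<bar> \<le> rc \<Longrightarrow> dist (p (x, t)) (p (x0, t0)) < e2"
    using continuous_box[OF S(7) e(2)] by metis
  obtain rd where rd: "0 < rd" "\<And>x t. dist x0 x \<le> rd \<Longrightarrow> \<bar>t - t0\<bar> \<le> rd \<Longrightarrow> 0 \<le> t \<Longrightarrow> t < T \<Longrightarrow> w (x, t) < w (x0, t0) + e3"
    using limit_locally_below[OF t0 e(3), of x0] by auto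
  obtain r where r: "0 < r" "r \<le> r0" "r \<le> ra" "r \<le> rb" "r \<le> rc" "r \<le> rd" "r \<le> t0 / 2" "r \<le> (T - t0) / 2"
    using positive_lower_bound[of "[r0, ra, rb, rc, rd, t0 / 2, (T - t0) / 2]"] r0 ra(1) rb(1) rc(1) rd(1) t0
    by auto
  have bt: "0 < t \<and> t < T" if "\<bar>t - t0\<bar> \<le> r" for t
    using that r(7,8) t0 unfolding abs_le_iff by (simp add: field_simps)
  show ?thesis
  proof (intro exI[of _ r] conjI[OF r(1)] conjI[OF r(2)] conjI[of "\<forall>t. _ t"] allI impI bt)
    fix x t assume "dist x0 x \<le> r" "\<bar>t - t0\<bar> \<le> r"
    then show "norm (G (x, t) - G (x0, t0)) < e1 \<and> norm (H (x, t) - H (x0, t0)) < e1 \<and>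
        \<bar>p (x, t) - p (x0, t0)\<bar> < e2 \<and> w (x, t) < w (x0, t0) + e3"
      using ra(2)[of x t] rb(2)[of x t] rc(2)[of x t] rd(2)[of x t] bt[of t] r
      by (simp add: dist_norm dist_real_def)
  qed
qed

text \<open>At a near-minimum of \<open>v j\<close> minus the test function on the time grid,
  \<open>D k\<close> and its predecessor \<open>D k'\<close> lie locally in sublevel sets of that
  function at their respective times. Cutting \<open>D k\<close> bounds
  \<open>sd (D k') x / h\<close> above by the curvature term \<open>c / norm (?G x)\<close>; the
  decrease of the test function in time bounds it below by \<open>v2 / b\<close>. As
  \<open>c < v2\<close>, these are incompatible.\<close>

lemma no_strict_test_nonzero:
  assumes st: "smooth_test \<phi> G H p" and t0: "0 < t0" "t0 < T" and r0: "0 < r0" and \<gamma>: "0 < \<gamma>"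
    and U: "\<And>s. s < w (x0, t0) + \<gamma> \<Longrightarrow> ball x0 r0 \<subseteq> U s"
    and min: "\<And>x t. \<lbrakk>dist x0 x \<le> r0; \<bar>t - t0\<bar> \<le> r0; 0 \<le> t; t < T\<rbrakk> \<Longrightarrow>
      w (x0, t0) - \<phi> (x0, t0) \<le> w (x, t) - \<phi> (x, t)"
    and G0: "G (x0, t0) \<noteq> 0" and strict: "strict_test G H p (x0, t0) \<beta> c"
  shows False
proof -
  define P where "P = G (x0, t0)"
  define X where "X = H (x0, t0)"
  have \<beta>: "0 < \<beta>" and pc: "p (x0, t0) < - c"
    and near: "\<And>q Y. \<lbrakk>q \<noteq> 0; norm (q - P) < \<beta>; norm (Y - X) < \<beta>; transpose Y = Y\<rbrakk> \<Longrightarrow> mcf_F q Y < c"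
    using strict by (auto simp: strict_test_def P_def X_def)
  \<comment> \<open>The room between \<open>c\<close> and \<open>- p (x0, t0)\<close> absorbs three
    errors: oscillation of the time derivative (\<open>v1\<close>), the defect of the near-minimum
    (\<open>v2\<close>), and oscillation of the gradient norm (from \<open>v2\<close> to
    \<open>c\<close>).\<close>
  obtain v1 where v1: "c < v1" "v1 < - p (x0, t0)" using dense[of c "- p (x0, t0)"] pc by auto
  obtain v2 where v2: "c < v2" "v2 < v1" using dense[OF v1(1)] by auto
  have P0: "0 < norm P" using G0 by (simp add: P_def)
  obtain \<kappa> where \<kappa>: "0 < \<kappa>" "\<kappa> < norm P"
    and gap: "\<And>a b. \<lbrakk>norm P - \<kappa> \<le> a; a \<le> norm P + \<kappa>; norm P - \<kappa> \<le> b; b \<le> norm P + \<kappa>\<rbrakk> \<Longrightarrow> c / a < v2 / b"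
    using quotient_gap[OF P0 v2(1)] by blast
  define l where "l = norm P - \<kappa>"
  have l: "0 < l" using \<kappa> by (simp add: l_def)
  \<comment> \<open>Halved because the oscillation of \<open>G1\<close>, \<open>H1\<close> and the
    derivatives of the quartic added at \<open>xh\<close> each use up one
    \<open>\<beta>'\<close>.\<close>
  define \<beta>' where "\<beta>' = min \<kappa> \<beta> / 2"
  have \<beta>': "0 < \<beta>'" "2 * \<beta>' \<le> \<kappa>" "2 * \<beta>' \<le> \<beta>" using \<kappa> \<beta> by (auto simp: \<beta>'_def)
  define \<psi> where "\<psi> z = \<phi> z - quart (fst z - x0) - (snd z - t0) ^ 4" for z
  define G1 where "G1 z = G z - quart_grad (fst z - x0)" for z
  define H1 where "H1 z = H z - quart_hess (fst z - x0)" for z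
  define p1 where "p1 z = p z - 4 * (snd z - t0) ^ 3" for z
  have st1: "smooth_test \<psi> G1 H1 p1"
    unfolding \<psi>_def G1_def H1_def p1_def by (rule smooth_test_quartic[OF st])
  note S = smooth_testD[OF st1]
  have at0: "\<psi> (x0, t0) = \<phi> (x0, t0)" "G1 (x0, t0) = P" "H1 (x0, t0) = X" "p1 (x0, t0) = p (x0, t0)"
    by (auto simp: \<psi>_def G1_def H1_def p1_def P_def X_def)
  have "0 < - v1 - p (x0, t0)" using v1 by simp
  then obtain r where r: "0 < r" "r \<le> r0" and bt': "\<forall>t. \<bar>t - t0\<bar> \<le> r \<longrightarrow> 0 < t \<and> t < T"
    and loc: "\<forall>x t. dist x0 x \<le> r \<longrightarrow> \<bar>t - t0\<bar> \<le> r \<longrightarrow> norm (G1 (x, t) - P) < \<beta>' \<and>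
      norm (H1 (x, t) - X) < \<beta>' \<and> \<bar>p1 (x, t) - p (x0, t0)\<bar> < - v1 - p (x0, t0) \<and> w (x, t) < w (x0, t0) + \<gamma> / 2"
    using localize[OF st1 t0 r0 \<beta>'(1), of "- v1 - p (x0, t0)" "\<gamma> / 2" x0, unfolded at0] half_gt_zero[OF \<gamma>] by blast
  have bt: "0 < t" "t < T" if "\<bar>t - t0\<bar> \<le> r" for t using bt' that by blast+
  have bG: "norm (G1 (x, t) - P) < \<beta>'" and bH: "norm (H1 (x, t) - X) < \<beta>'"
    and bw: "w (x, t) < w (x0, t0) + \<gamma> / 2" and bp: "p1 (x, t) < - v1"
    if "dist x0 x \<le> r" "\<bar>t - t0\<bar> \<le> r" for x t
    using loc[rule_format, OF that] by linarith+
  obtain \<rho>0 where \<rho>0: "0 < \<rho>0" "\<And>y :: real^'n. norm y < \<rho>0 \<Longrightarrow> norm (quart_grad y) < \<beta>' \<and> norm (quart_hess y) < \<beta>'"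
  proof -
    have "continuous_on UNIV (\<lambda>y :: real^'n. quart_grad y)" "continuous_on UNIV (\<lambda>y :: real^'n. quart_hess y)"
      by (intro continuous_intros)+
    then obtain d1 d2 where "0 < d1" "\<And>y :: real^'n. dist y 0 < d1 \<Longrightarrow> dist (quart_grad y) (quart_grad 0) < \<beta>'"
      "0 < d2" "\<And>y :: real^'n. dist y 0 < d2 \<Longrightarrow> dist (quart_hess y) (quart_hess 0) < \<beta>'"
      using \<beta>'(1) unfolding continuous_on_iff by (metis UNIV_I)
    then show ?thesis using that[of "min d1 d2"] by simp
  qed
  define \<rho> where "\<rho> = min (\<rho>0 / 2) (r / 4)"
  have \<rho>: "0 < \<rho>" "\<rho> \<le> r / 4" "2 * \<rho> \<le> \<rho>0" using \<rho>0 r by (auto simp: \<rho>_def)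
  \<comment> \<open>Near-minima will satisfy |x - x0|^4 + (t - t0)^4 < 4 \<epsilon>, which the first
    bound keeps within radius \<open>r / 2\<close>; the second keeps the level \<open>s\<close>
    below the obstacle.\<close>
  define \<epsilon> where "\<epsilon> = min ((r / 2) ^ 4 / 8) (\<gamma> / 8)"
  have \<epsilon>: "0 < \<epsilon>" "\<epsilon> \<le> (r / 2) ^ 4 / 8" "\<epsilon> \<le> \<gamma> / 8" using r \<gamma> by (auto simp: \<epsilon>_def)
  obtain re where re: "0 < re" "\<And>t. \<bar>t - t0\<bar> \<le> re \<Longrightarrow> dist (\<psi> (x0, t)) (\<psi> (x0, t0)) < \<epsilon>"
    using continuous_box[OF S(4) \<epsilon>(1), of x0 t0] by (metis dist_self less_imp_le)
  have ev1: "\<forall>\<^sub>F j in sequentially. \<forall>x t. dist x0 x \<le> r \<longrightarrow> t0 - r \<le> t \<longrightarrow> t \<le> t0 + r \<longrightarrow> \<bar>v j (x, t) - w (x, t)\<bar> < \<epsilon>"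
    by (rule eventually_close[OF \<epsilon>(1)]) (use bt[of "t0 - r"] bt[of "t0 + r"] r(1) in auto)
  \<comment> \<open>\<open>h * B\<close> dominates the displacement |v2| h / l of one step, so that
    \<open>sd_lower_bound\<close> can work in a ball of radius \<open>r / 4\<close>.\<close>
  define B where "B = (\<bar>v2\<bar> + 1) / l"
  have B: "0 < B" using l by (simp add: B_def)
  obtain h0 where h0: "0 < h0" "h0 \<le> r / 2" "h0 \<le> re" "h0 \<le> r / (4 * B)"
    using positive_lower_bound[of "[r / 2, re, r / (4 * B)]"] r(1) re(1) B by auto
  have ev2: "\<forall>\<^sub>F j in sequentially. hs j < h0"
    using hs_lim h0(1) by (rule order_tendstoD)
  obtain j where close: "\<And>x t. dist x0 x \<le> r \<Longrightarrow> \<bar>t - t0\<bar> \<le> r \<Longrightarrow> \<bar>v j (x, t) - w (x, t)\<bar> < \<epsilon>"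
    and hj: "hs j < h0"
  proof -
    obtain j where j: "\<And>x t. dist x0 x \<le> r \<Longrightarrow> t0 - r \<le> t \<Longrightarrow> t \<le> t0 + r \<Longrightarrow> \<bar>v j (x, t) - w (x, t)\<bar> < \<epsilon>" "hs j < h0"
      using eventually_happens'[OF sequentially_bot eventually_conj[OF ev1 ev2]] by blast
    show ?thesis by (rule that[OF j(1) j(2)]) linarith+
  qed
  define h where "h = hs j"
  have h: "0 < h" "h < r / 2" "h < re" "h * B < r / 4"
  proof -
    show "0 < h" "h < r / 2" "h < re" using hj hs_pos[of j] h0 unfolding h_def by linarith+
    have "h < r / (4 * B)" using hj h0 unfolding h_def by linarith
    then show "h * B < r / 4" using B by (simp add: field_simps)
  qed
  define S' where "S' = {(x, k). dist x0 x \<le> r \<and> \<bar>real k * h - t0\<bar> \<le> r}"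
  define f where "f = (\<lambda>(x, k). v j (x, real k * h) - \<psi> (x, real k * h))"
  define m0 where "m0 = w (x0, t0) - \<phi> (x0, t0)"
  have low: "m0 - \<epsilon> + norm (x - x0) ^ 4 + (real k * h - t0) ^ 4 \<le> f (x, k)" if "(x, k) \<in> S'" for x k
  proof -
    have a: "dist x0 x \<le> r" "\<bar>real k * h - t0\<bar> \<le> r" using that by (auto simp: S'_def)
    have "w (x0, t0) - \<phi> (x0, t0) \<le> w (x, real k * h) - \<phi> (x, real k * h)"
      using a r bt[OF a(2)] by (intro min) auto
    then show ?thesis using close[OF a] by (simp add: f_def \<psi>_def m0_def quart_norm)
  qed
  have low0: "m0 - \<epsilon> \<le> f z" if "z \<in> S'" for z
  proof -
    obtain x k where z: "z = (x, k)" by (cases z)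
    have "0 \<le> norm (x - x0) ^ 4" "0 \<le> (real k * h - t0) ^ 4" by auto
    then show ?thesis using low[of x k] that unfolding z by linarith
  qed
  \<comment> \<open>\<open>v j\<close> is constant between grid times, so its value at
    \<open>t0\<close> is that at the grid time just before; \<open>h < re\<close> controls the
    change of \<open>\<psi>\<close>.\<close>
  define k0 where "k0 = nat \<lfloor>t0 / h\<rfloor>"
  have k0: "real k0 * h \<le> t0" "t0 - h < real k0 * h"
    using floor_step[of t0 h] t0 h by (auto simp: k0_def)
  have k0S: "(x0, k0) \<in> S'" using k0 h r by (simp add: S'_def)
  have f0: "f (x0, k0) < m0 + 2 * \<epsilon>"
  proof -
    have "v j (x0, t0) = v j (x0, real k0 * h)"
      using time_steps[of t0 j x0] t0 by (simp add: k0_def h_def)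
    moreover have "\<bar>v j (x0, t0) - w (x0, t0)\<bar> < \<epsilon>" using close[of x0 t0] r by simp
    moreover have "dist (\<psi> (x0, real k0 * h)) (\<psi> (x0, t0)) < \<epsilon>" using re(2)[of "real k0 * h"] k0 h by simp
    ultimately show ?thesis by (simp add: f_def m0_def at0 dist_real_def)
  qed
  define m where "m = Inf (f ` S')"
  have bdd: "bdd_below (f ` S')" using low0 by (auto intro: bdd_belowI[of _ "m0 - \<epsilon>"])
  have m_le: "m \<le> f z" if "z \<in> S'" for z unfolding m_def using bdd that by (simp add: cINF_lower)
  \<comment> \<open>The infimum need not be attained, and \<open>\<sigma>\<close> is the defect. The
    bound by \<open>\<rho> ^ 4\<close> localises the cut, the one by \<open>(v1 - v2) * h\<close>
    keeps the defect below the displacement of one step, and the one by \<open>l * r\<close>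
    excludes \<open>D k = UNIV\<close>.\<close>
  obtain \<sigma> where "0 < \<sigma>" "\<sigma> \<le> \<epsilon>" "\<sigma> \<le> \<rho> ^ 4 / 4" "\<sigma> \<le> (v1 - v2) * h / 4" "\<sigma> \<le> l * r / 16"
    using positive_lower_bound[of "[\<epsilon>, \<rho> ^ 4 / 4, (v1 - v2) * h / 4, l * r / 16]"] \<epsilon>(1) \<rho>(1) v2(2) h(1) l r(1)
    by auto
  then have \<sigma>: "0 < \<sigma>" "\<sigma> \<le> \<epsilon>" "4 * \<sigma> \<le> \<rho> ^ 4" "4 * \<sigma> \<le> (v1 - v2) * h" "16 * \<sigma> \<le> l * r" by linarith+
  obtain xh k where xkS: "(xh, k) \<in> S'" and fm: "f (xh, k) < m + \<sigma>"
  proof -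
    have "m < m + \<sigma>" using \<sigma> by simp
    then obtain z where "z \<in> S'" "f z < m + \<sigma>"
      unfolding m_def using cINF_less_iff[OF _ bdd] k0S by blast
    then show ?thesis using that by (cases z) auto
  qed
  have near0: "norm (xh - x0) ^ 4 + (real k * h - t0) ^ 4 < (r / 2) ^ 4"
  proof -
    have "f (xh, k) < m0 + 3 * \<epsilon>" using fm m_le[OF k0S] f0 \<sigma> by linarith
    then show ?thesis using low[OF xkS] \<epsilon> by linarith
  qed
  have dxh: "dist x0 xh < r / 2"
  proof -
    have "0 \<le> (real k * h - t0) ^ 4" by simp
    then have "norm (xh - x0) ^ 4 < (r / 2) ^ 4" using near0 by linarith
    then have "norm (xh - x0) < r / 2" by (rule power_less_imp_less_base) (use r(1) in simp)
    then show ?thesis by (simp add: dist_norm norm_minus_commute)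
  qed
  have dkh: "\<bar>real k * h - t0\<bar> < r / 2"
  proof -
    have "(real k * h - t0) ^ 4 = \<bar>real k * h - t0\<bar> ^ 4" by (simp add: power_even_abs)
    moreover have "0 \<le> norm (xh - x0) ^ 4" by simp
    ultimately have "\<bar>real k * h - t0\<bar> ^ 4 < (r / 2) ^ 4" using near0 by linarith
    then show ?thesis by (rule power_less_imp_less_base) (use r(1) in simp)
  qed
  have "0 < real k * h" using dkh r(1) by (intro bt(1)) linarith
  then have "0 < k" using h by (cases k) auto
  then obtain k' where k: "k = Suc k'" by (cases k) auto
  have k'h: "real k' * h = real k * h - h" by (simp add: k algebra_simps)
  have dk'h: "\<bar>real k' * h - t0\<bar> \<le> r" using dkh h(1,2) unfolding k'h by linarith
  have bkr: "\<bar>real k * h - t0\<bar> \<le> r" using dkh r(1) by linarith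
  have bkT: "real k * h < T" "real k' * h < T" using bt(2)[OF bkr] bt(2)[OF dk'h] by auto
  have dxr: "dist x0 xh \<le> r" using dxh r(1) by linarith
  \<comment> \<open>Slightly above the value at the near-minimum, so that \<open>xh\<close> is in
    the strict sublevel set and therefore in \<open>D k\<close>.\<close>
  define s where "s = v j (xh, real k * h) + \<sigma>"
  have "s < w (x0, t0) + \<gamma>"
    using close[OF dxr bkr] bw[OF dxr bkr] \<sigma>(2) \<epsilon>(3) \<gamma> unfolding s_def by linarith
  then have US: "ball x0 r0 \<subseteq> U s" by (rule U)
  obtain D where D: "\<And>i. real i * h < T \<Longrightarrow> {x. v j (x, real i * h) < s} \<subseteq> D i \<and> D i \<subseteq> {x. v j (x, real i * h) \<le> s}"
    and cs: "\<And>i. cut_step h (U s) (D i) (D (Suc i))"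
    using levels[of j s] unfolding h_def by blast
  define c0 where "c0 = \<psi> (xh, real k * h)"
  have level: "\<psi> (x, real i * h) \<le> c0 + 2 * \<sigma>" if "x \<in> D i" "dist x0 x \<le> r" "\<bar>real i * h - t0\<bar> \<le> r" for x i
  proof -
    have "real i * h < T" using bt that(3) by blast
    from D[OF this] that(1) have "v j (x, real i * h) \<le> s" by blast
    moreover have "m \<le> v j (x, real i * h) - \<psi> (x, real i * h)"
      using m_le[of "(x, i)"] that by (simp add: S'_def f_def)
    ultimately show ?thesis using fm by (simp add: f_def s_def c0_def)
  qed
  have xhD: "xh \<in> D k" using D[OF bkT(1)] \<sigma> by (auto simp: s_def)
  let ?f = "\<lambda>x. \<psi> (x, real k * h)"
  let ?f' = "\<lambda>x. \<psi> (x, real k' * h)"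
  \<comment> \<open>Otherwise \<open>level\<close> would cap \<open>\<psi>\<close> near
    \<open>xh\<close> by \<open>c0 + 2 * \<sigma>\<close>, although it rises by at least
    \<open>l * r / 4\<close> along \<open>P\<close>.\<close>
  have "D k \<noteq> UNIV"
  proof
    assume "D k = UNIV"
    define y where "y = xh + ((r / 4) / norm P) *\<^sub>R P"
    have dy: "dist xh y = r / 4" using P0 r by (simp add: y_def dist_norm)
    have "?f xh + (r / 4) * (norm P - \<kappa>) \<le> ?f y"
      unfolding y_def
    proof (rule directional_growth[where R = "r / 4" and Gf = "\<lambda>x. G1 (x, real k * h)"])
      show "norm (G1 (x, real k * h) - P) \<le> \<kappa>" if "dist xh x \<le> r / 4" for x
      proof -
        have "dist x0 x \<le> r" using dist_triangle[of x0 x xh] dxh that r(1) by linarith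
        then show ?thesis using bG[OF _ bkr, of x] \<beta>'(1,2) by linarith
      qed
    qed (use P0 r S(1) in auto)
    moreover have "?f y \<le> c0 + 2 * \<sigma>"
    proof (rule level[OF _ _ bkr])
      show "dist x0 y \<le> r" using dist_triangle[of x0 y xh] dy dxh r(1) by linarith
    qed (simp add: \<open>D k = UNIV\<close>)
    ultimately have "(r / 4) * l \<le> 2 * \<sigma>" by (simp add: c0_def l_def)
    then have "2 * (l * r) \<le> l * r" using \<sigma>(5) by (simp add: algebra_simps)
    then show False using l r by (simp add: mult_le_0_iff)
  qed
  with cs[of k'] xhD have cm: "cut_minimal h (U s) (D k') (D k)" by (auto simp: cut_step_def k)
  then have D'ne: "D k' \<noteq> {}" by (simp add: cut_minimal_def)
  let ?G = "\<lambda>x. G1 (x, real k * h) - quart_grad (x - xh)"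
  let ?H = "\<lambda>x. H1 (x, real k * h) - quart_hess (x - xh)"
  \<comment> \<open>The quartic confines the cut: on \<open>D k\<close>, \<open>level\<close> and
    \<open>?g x > 0\<close> give |x - xh|^4 < 3 \<sigma> < \<rho>^4. The shift by
    \<open>\<sigma>\<close> makes \<open>?g\<close> positive at \<open>xh\<close>.\<close>
  let ?g = "\<lambda>x. ?f x - quart (x - xh) - (c0 - \<sigma>)"
  have inr: "dist x0 x \<le> r" if "dist xh x < 2 * \<rho>" for x
    using dist_triangle[of x0 x xh] dxh that \<rho> by linarith
  have small: "norm (?G x - P) < 2 * \<beta>'" "norm (?H x - X) < 2 * \<beta>'" if "dist xh x < 2 * \<rho>" for x
  proof -
    have q: "norm (quart_grad (x - xh)) < \<beta>'" "norm (quart_hess (x - xh)) < \<beta>'"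
      using \<rho>0(2)[of "x - xh"] that \<rho> by (auto simp: dist_norm norm_minus_commute)
    have "norm (?G x - P) \<le> norm (G1 (x, real k * h) - P) + norm (quart_grad (x - xh))"
      by (rule norm_diff_diff_le)
    then show "norm (?G x - P) < 2 * \<beta>'" using bG[OF inr[OF that] bkr] q by linarith
    have "norm (?H x - X) \<le> norm (H1 (x, real k * h) - X) + norm (quart_hess (x - xh))"
      by (rule norm_diff_diff_le)
    then show "norm (?H x - X) < 2 * \<beta>'" using bH[OF inr[OF that] bkr] q by linarith
  qed
  have normG: "l \<le> norm (?G x)" "norm (?G x) \<le> norm P + \<kappa>" if "dist xh x < 2 * \<rho>" for x
    using small(1)[OF that] \<beta>' norm_triangle_ineq2[of P "?G x"] norm_triangle_ineq2[of "?G x" P]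
    by (auto simp: l_def norm_minus_commute)
  have q0: "0 < l\<^sup>2" using l by simp
  have Gq: "l\<^sup>2 \<le> ?G x \<bullet> ?G x" if "dist xh x < 2 * \<rho>" for x
    using normG(1)[OF that] l by (simp add: power2_norm_eq_inner[symmetric] power_mono)
  have dG: "(?G has_derivative (\<lambda>v. ?H x *v v)) (at x)" for x
    by (auto intro!: derivative_eq_intros S(3) quart_grad_deriv simp: matrix_vector_mult_diff_rdistrib)
  obtain x where x: "x \<in> D k" "dist xh x < 2 * \<rho>" "0 < ?g x"
    and EL: "sd (D k') x / h + divergence (\<lambda>x. unit_field (l\<^sup>2) (?G x)) x \<le> 0"
  proof (rule cut_minimal_variation[OF cm h(1) \<rho>(1) q0 zero_less_one, where g = ?g and G = ?G and G' = "\<lambda>x v. ?H x *v v" and ?x0.0 = xh and y = xh])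
    show "(?g has_derivative (\<lambda>v. ?G x \<bullet> v)) (at x)" for x
      by (auto intro!: derivative_eq_intros S(1) quart_deriv simp: inner_diff_left)
    show "(?G has_derivative (\<lambda>v. ?H x *v v)) (at x)" for x by (rule dG)
    show "continuous_on UNIV (\<lambda>x. ?H x *v b)" for b
    proof -
      have "continuous_on UNIV (\<lambda>x. ?H x)"
        by (intro continuous_intros continuous_on_compose2[OF S(6)]) auto
      then show ?thesis by (rule continuous_on_matrix_vector)
    qed
    show "dist xh x \<le> \<rho>" if "x \<in> D k" "dist xh x < 2 * \<rho>" "0 < ?g x" for x
    proof -
      have "norm (x - xh) ^ 4 < \<rho> ^ 4"
        using level[OF that(1) inr[OF that(2)] bkr] that(3) \<sigma> by (simp add: quart_norm)
      then have "norm (x - xh) < \<rho>" by (rule power_less_imp_less_base) (use \<rho>(1) in simp)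
      then show ?thesis by (simp add: dist_norm norm_minus_commute)
    qed
    show "l\<^sup>2 \<le> ?G x \<bullet> ?G x" if "dist xh x < 2 * \<rho>" for x by (rule Gq[OF that])
    show "x \<in> U s" if "dist xh x < 2 * \<rho>" for x
      using US dist_triangle[of x0 x xh] dxh that \<rho> r by (intro subsetD[OF US]) simp
    show "xh \<in> D k" "dist xh xh < 2 * \<rho>" "0 < ?g xh" using xhD \<rho> \<sigma> by (auto simp: c0_def)
  qed (use that in blast)
  have Gx0: "?G x \<noteq> 0" using normG(1)[OF x(2)] l by auto
  have "mcf_F (?G x) (?H x) < c"
    using small[OF x(2)] \<beta>' Gx0 by (intro near) (auto simp: transpose_diff transpose_quart_hess S(8))
  then have "mcf_F (?G x) (?H x) / norm (?G x) < c / norm (?G x)"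
    using Gx0 by (intro divide_strict_right_mono) auto
  with EL divergence_unit_field[OF q0 Gq[OF x(2)] dG]
  have sdh: "sd (D k') x / h < c / norm (?G x)" by simp
  have growth: "?f x + v1 * h \<le> ?f' x"
  proof -
    have "real k' * h < real k * h" using h by (simp add: k'h)
    then obtain \<tau> where \<tau>: "real k' * h < \<tau>" "\<tau> < real k * h"
      "\<psi> (x, real k * h) - \<psi> (x, real k' * h) = (real k * h - real k' * h) * p1 (x, \<tau>)"
      using MVT2[of "real k' * h" "real k * h" "\<lambda>t. \<psi> (x, t)" "\<lambda>t. p1 (x, t)"] S(2) by blast
    have "\<bar>\<tau> - t0\<bar> \<le> r" using \<tau> dk'h bkr by linarith
    from bp[OF inr[OF x(2)] this] have "h * p1 (x, \<tau>) \<le> h * - v1" using h by (intro mult_left_mono) auto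
    moreover have "real k * h - real k' * h = h" by (simp add: k'h)
    ultimately show ?thesis using \<tau>(3) by (simp add: algebra_simps)
  qed
  \<comment> \<open>The gap of \<open>3 * \<sigma>\<close> between the cut level
    \<open>c0 - \<sigma>\<close> and the bound \<open>c0 + 2 * \<sigma>\<close> valid on
    \<open>D k'\<close> is paid for by \<open>(v1 - v2) * h\<close>.\<close>
  have fx: "c0 + 2 * \<sigma> + v2 * h \<le> ?f' x"
  proof -
    have "0 \<le> quart (x - xh)" by (simp add: quart_def)
    then have "c0 - \<sigma> < ?f x" using x(3) by linarith
    then show ?thesis using growth \<sigma> by (simp add: algebra_simps)
  qed
  obtain b where b: "norm P - \<kappa> \<le> b" "b \<le> norm P + \<kappa>" "v2 * h / b \<le> sd (D k') x"
  proof (rule sd_lower_bound[where f = ?f' and Gf = "\<lambda>x. G1 (x, real k' * h)" and R = "r / 4" and P = P and \<kappa> = \<kappa> and c = "c0 + 2 * \<sigma>" and a = "v2 * h" and x = x and D = "D k'"])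
    have inr': "dist x0 y \<le> r" if "dist x y \<le> r / 4" for y
    proof -
      have "dist xh x \<le> r / 4"
      proof -
        have "norm (x - xh) ^ 4 < \<rho> ^ 4"
          using level[OF x(1) inr[OF x(2)] bkr] x(3) \<sigma> by (simp add: quart_norm)
        then have "norm (x - xh) < \<rho>" by (rule power_less_imp_less_base) (use \<rho>(1) in simp)
        then show ?thesis using \<rho> by (simp add: dist_norm norm_minus_commute)
      qed
      then show ?thesis using dist_triangle[of x0 y xh] dist_triangle[of xh y x] dxh that by linarith
    qed
    show "norm (G1 (y, real k' * h) - P) \<le> \<kappa>" if "dist x y \<le> r / 4" for y
      using bG[OF inr'[OF that] dk'h] \<beta>' by simp
    show "?f' y \<le> c0 + 2 * \<sigma>" if "y \<in> D k'" "dist x y \<le> r / 4" for y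
      by (rule level[OF that(1) inr'[OF that(2)] dk'h])
    show "\<bar>v2 * h\<bar> / (norm P - \<kappa>) < r / 4"
    proof -
      have "\<bar>v2 * h\<bar> / (norm P - \<kappa>) \<le> h * B"
        using h l unfolding B_def l_def[symmetric] by (simp add: abs_mult field_simps)
      then show ?thesis using h by linarith
    qed
  qed (use S(1) \<kappa> D'ne fx that in auto)
  have "c / norm (?G x) < v2 / b"
    by (rule gap) (use normG[OF x(2)] b in \<open>auto simp: l_def\<close>)
  also have "\<dots> = (v2 * h / b) / h" using h by simp
  also have "\<dots> \<le> sd (D k') x / h" using b(3) h by (intro divide_right_mono) auto
  finally show False using sdh by simp
qed

end

section \<open>Shrinking balls and contact with vanishing gradient\<close>

text \<open>Each step costs a radius of order h / R while the radius stays above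
  \<open>R / 2\<close>, so the ball survives for a time of order R^2, the scaling of mean curvature
  flow.\<close>

lemma cut_steps_ball:
  fixes D :: "nat \<Rightarrow> (real^'n) set"
  assumes cs: "\<And>k. cut_step h U (D k) (D (Suc k))" and h: "0 < h" and R: "0 < R"
    and D0: "D k0 \<inter> ball y R = {}" and U: "ball y R \<subseteq> U"
    and n: "real n * h * (6 * real CARD('n) + 1) \<le> R\<^sup>2 / 2"
  shows "y \<notin> D (k0 + n)"
proof -
  \<comment> \<open>For radii at least \<open>R / 2\<close> the one-step condition is 3 n h < a R /
    2; the extra 1 in 6 n + 1 makes it strict.\<close>
  define a where "a = (6 * real CARD('n) + 1) * h / R"
  have a: "0 < a" using h R by (simp add: a_def)
  have na: "real n * a \<le> R / 2"
    using n R by (simp add: a_def field_simps power2_eq_square)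
  have Ra: "R / 2 \<le> R - real i * a" if "i \<le> n" for i
  proof -
    have "real i * a \<le> real n * a" using that a by (intro mult_right_mono) auto
    then show ?thesis using na by linarith
  qed
  have "D (k0 + i) \<inter> ball y (R - real i * a) = {}" if "i \<le> n" for i
    using that
  proof (induction i)
    case 0 then show ?case using D0 by simp
  next
    case (Suc i)
    let ?\<rho> = "R - real (Suc i) * a"
    have \<rho>: "R / 2 \<le> ?\<rho>" by (rule Ra[OF Suc.prems])
    have "3 * real CARD('n) * h < a * (R / 2)"
      using h R by (simp add: a_def)
    also have "\<dots> \<le> a * ?\<rho>" using a \<rho> by (intro mult_left_mono) auto
    also have "\<dots> = ((R - real i * a) - ?\<rho>) * ?\<rho>" by (simp add: algebra_simps)
    finally have r: "3 * real CARD('n) * h < ((R - real i * a) - ?\<rho>) * ?\<rho>" .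
    have "ball y ?\<rho> \<subseteq> U" using U a by (intro order_trans[OF subset_ball U]) simp
    then have "D (Suc (k0 + i)) \<inter> ball y ?\<rho> = {}"
      using Suc \<rho> R by (intro cut_step_ball[OF cs h _ r]) auto
    then show ?case by simp
  qed
  from this[of n] Ra[of n] R show ?thesis by (auto simp: disjoint_iff)
qed

lemma DERIV2_nonpos_at_max:
  fixes f :: "real \<Rightarrow> real"
  assumes f: "\<And>t. (f has_real_derivative f' t) (at t)" and f': "(f' has_real_derivative d) (at 0)"
    and r: "0 < r" and max: "\<And>t. \<bar>t\<bar> < r \<Longrightarrow> f t \<le> f 0"
  shows "d \<le> 0"
proof (rule ccontr)
  assume "\<not> d \<le> 0"
  then obtain e where e: "0 < e" "\<And>t. 0 < t \<Longrightarrow> t < e \<Longrightarrow> f' 0 < f' (0 + t)"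
    using DERIV_pos_inc_right[OF f'] by auto
  have f0: "f' 0 = 0" by (rule DERIV_local_max[OF f r]) (use max in auto)
  define t where "t = min e r / 2"
  have t: "0 < t" "t < e" "t < r" using e r by (auto simp: t_def)
  obtain \<xi> where "0 < \<xi>" "\<xi> < t" "f t - f 0 = (t - 0) * f' \<xi>"
    using MVT2[OF t(1), of f f'] f by blast
  moreover have "0 < f' \<xi>" using e(2)[of \<xi>] calculation t f0 by simp
  ultimately have "0 < f t - f 0" using t by simp
  then show False using max[of t] t by simp
qed

lemma axis_norm [simp]: "norm (axis i (1::real)) = 1"
  by (metis axis_Basis norm_Basis)

context scheme_limit
begin

text \<open>At time \<open>t1 - \<tau>\<close> a sublevel set slightly above the value
  \<open>w (x1, t1)\<close> misses a ball around \<open>x1\<close> too large to shrink away by time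
  \<open>t1\<close>, so \<open>x1\<close> would still lie outside that set.\<close>

lemma ball_barrier:
  assumes t: "0 < t1 - \<tau>" "t1 < T" and e: "0 < e" and \<tau>: "0 < \<tau>" and R: "0 < R"
    and R\<tau>: "2 * \<tau> * (6 * real CARD('n) + 1) \<le> R\<^sup>2 / 2"
    and high: "\<And>x. dist x1 x \<le> R \<Longrightarrow> w (x1, t1) + 6 * e \<le> w (x, t1 - \<tau>)"
    and U: "ball x1 R \<subseteq> U (w (x1, t1) + 2 * e)"
  shows False
proof -
  have ev1: "\<forall>\<^sub>F j in sequentially. \<forall>x t. dist x1 x \<le> R \<longrightarrow> t1 - \<tau> \<le> t \<longrightarrow> t \<le> t1 \<longrightarrow> \<bar>v j (x, t) - w (x, t)\<bar> < e"
    using t by (intro eventually_close e) auto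
  have ev2: "\<forall>\<^sub>F j in sequentially. hs j < \<tau>"
    using hs_lim \<tau> by (rule order_tendstoD)
  obtain j where close: "\<And>x t. dist x1 x \<le> R \<Longrightarrow> t1 - \<tau> \<le> t \<Longrightarrow> t \<le> t1 \<Longrightarrow> \<bar>v j (x, t) - w (x, t)\<bar> < e"
    and hj: "hs j < \<tau>"
    using eventually_happens'[OF sequentially_bot eventually_conj[OF ev1 ev2]] by blast
  define h where "h = hs j"
  have h: "0 < h" "h < \<tau>" using hj hs_pos[of j] by (auto simp: h_def)
  define s where "s = w (x1, t1) + 2 * e"
  obtain D where D: "\<And>i. real i * h < T \<Longrightarrow> {x. v j (x, real i * h) < s} \<subseteq> D i \<and> D i \<subseteq> {x. v j (x, real i * h) \<le> s}"
    and cs: "\<And>i. cut_step h (U s) (D i) (D (Suc i))"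
    using levels[of j s] unfolding h_def by blast
  define k0 where "k0 = nat \<lfloor>(t1 - \<tau>) / h\<rfloor>"
  define k1 where "k1 = nat \<lfloor>t1 / h\<rfloor>"
  have k0: "real k0 * h \<le> t1 - \<tau>" "t1 - \<tau> - h < real k0 * h"
    using floor_step[of "t1 - \<tau>" h] t h by (auto simp: k0_def)
  have k1: "real k1 * h \<le> t1" "t1 - h < real k1 * h"
    using floor_step[of t1 h] t \<tau> h by (auto simp: k1_def)
  have k01: "k0 \<le> k1"
    unfolding k0_def k1_def using \<tau> h by (intro nat_mono floor_mono divide_right_mono) auto
  have kT: "real k0 * h < T" "real k1 * h < T" using k0 k1 t \<tau> by linarith+
  have D0: "D k0 \<inter> ball x1 R = {}"
  proof -
    have "x \<notin> D k0" if x: "dist x1 x < R" for x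
    proof
      assume "x \<in> D k0"
      then have "v j (x, real k0 * h) \<le> s" using D[OF kT(1)] by blast
      moreover have "v j (x, t1 - \<tau>) = v j (x, real k0 * h)"
        using time_steps[of "t1 - \<tau>" j x] t \<tau> by (simp add: k0_def h_def)
      moreover have "\<bar>v j (x, t1 - \<tau>) - w (x, t1 - \<tau>)\<bar> < e"
        using x \<tau> by (intro close) auto
      ultimately show False using e high[of x] x unfolding s_def by linarith
    qed
    then show ?thesis by force
  qed
  \<comment> \<open>Rounding both times down to the grid adds at most one \<open>h < \<tau>\<close>,
    hence the factor 2.\<close>
  have n: "real (k1 - k0) * h * (6 * real CARD('n) + 1) \<le> R\<^sup>2 / 2"
  proof -
    have "real (k1 - k0) * h = real k1 * h - real k0 * h" using k01 by (simp add: of_nat_diff algebra_simps)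
    then have "real (k1 - k0) * h \<le> 2 * \<tau>" using k0 k1 h by linarith
    then have "real (k1 - k0) * h * (6 * real CARD('n) + 1) \<le> 2 * \<tau> * (6 * real CARD('n) + 1)"
      by (intro mult_right_mono) auto
    then show ?thesis using R\<tau> by linarith
  qed
  have "x1 \<notin> D (k0 + (k1 - k0))" by (rule cut_steps_ball[OF cs h(1) R D0 U[folded s_def] n])
  then have "x1 \<notin> D k1" using k01 by simp
  then have "s \<le> v j (x1, real k1 * h)" using D[OF kT(2)] by force
  moreover have "v j (x1, t1) = v j (x1, real k1 * h)"
    using time_steps[of t1 j x1] t \<tau> by (simp add: k1_def h_def)
  moreover have "\<bar>v j (x1, t1) - w (x1, t1)\<bar> < e"
    using R \<tau> by (intro close) auto
  ultimately show False using e unfolding s_def by linarith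
qed

text \<open>A test function with vanishing gradient is treated by doubling the space variable: a minimum of
  \<open>w (x, t) - \<psi> (y, t) + N \<bar>x - y\<bar>^4\<close> with \<open>x \<noteq> y\<close> gives a translated test function with nonzero
  gradient, and one with \<open>x = y\<close> makes \<open>w\<close> exceed the minimum in a ball whose discrete evolution
  does not vanish in time.\<close>

lemma no_strict_test:
  assumes st: "smooth_test \<phi> G H p" and t0: "0 < t0" "t0 < T" and r0: "0 < r0" and \<gamma>: "0 < \<gamma>"
    and U: "\<And>s. s < w (x0, t0) + \<gamma> \<Longrightarrow> ball x0 r0 \<subseteq> U s"
    and min: "\<And>x t. \<lbrakk>dist x0 x \<le> r0; \<bar>t - t0\<bar> \<le> r0; 0 \<le> t; t < T\<rbrakk> \<Longrightarrow>
      w (x0, t0) - \<phi> (x0, t0) \<le> w (x, t) - \<phi> (x, t)"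
    and strict: "strict_test G H p (x0, t0) \<beta> c"
  shows False
proof (cases "G (x0, t0) = 0")
  case False
  then show False using no_strict_test_nonzero[OF st t0 r0 \<gamma> U min] strict by blast
next
  case G0: True
  define X where "X = H (x0, t0)"
  have \<beta>: "0 < \<beta>" and pc: "p (x0, t0) < - c"
    and near: "\<And>q Y. \<lbrakk>q \<noteq> 0; norm q < \<beta>; norm (Y - X) < \<beta>; transpose Y = Y\<rbrakk> \<Longrightarrow> mcf_F q Y < c"
    using strict by (auto simp: strict_test_def G0 X_def)
  define \<eta> where "\<eta> = (- c - p (x0, t0)) / 2"
  have \<eta>: "0 < \<eta>" using pc by (simp add: \<eta>_def)
  define \<psi> where "\<psi> z = \<phi> z - quart (fst z - x0) - (snd z - t0) ^ 4" for z
  define G1 where "G1 z = G z - quart_grad (fst z - x0)" for z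
  define H1 where "H1 z = H z - quart_hess (fst z - x0)" for z
  define p1 where "p1 z = p z - 4 * (snd z - t0) ^ 3" for z
  have st1: "smooth_test \<psi> G1 H1 p1"
    unfolding \<psi>_def G1_def H1_def p1_def by (rule smooth_test_quartic[OF st])
  note S = smooth_testD[OF st1]
  have at0: "\<psi> (x0, t0) = \<phi> (x0, t0)" "G1 (x0, t0) = 0" "H1 (x0, t0) = X" "p1 (x0, t0) = p (x0, t0)"
    by (auto simp: \<psi>_def G1_def H1_def p1_def X_def G0)
  have \<beta>2: "0 < \<beta> / 2" using \<beta> by simp
  then obtain r where r: "0 < r" "r \<le> r0" and bt': "\<forall>t. \<bar>t - t0\<bar> \<le> r \<longrightarrow> 0 < t \<and> t < T"
    and loc: "\<forall>x t. dist x0 x \<le> r \<longrightarrow> \<bar>t - t0\<bar> \<le> r \<longrightarrow> norm (G1 (x, t)) < \<beta> / 2 \<and>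
      norm (H1 (x, t) - X) < \<beta> / 2 \<and> \<bar>p1 (x, t) - p (x0, t0)\<bar> < \<eta> \<and> w (x, t) < w (x0, t0) + \<gamma> / 2"
    using localize[OF st1 t0 r0 _ \<eta>, of "\<beta> / 2" "\<gamma> / 2" x0, unfolded at0 diff_0_right] half_gt_zero[OF \<gamma>] by blast
  have bt: "0 < t" "t < T" if "\<bar>t - t0\<bar> \<le> r" for t using bt' that by blast+
  have \<eta>2: "2 * \<eta> = - c - p (x0, t0)" by (simp add: \<eta>_def)
  have bG: "norm (G1 (x, t)) < \<beta> / 2" and bH: "norm (H1 (x, t) - X) < \<beta> / 2"
    and bw: "w (x, t) < w (x0, t0) + \<gamma> / 2" and bp: "p1 (x, t) < - c - \<eta>"
    if "dist x0 x \<le> r" "\<bar>t - t0\<bar> \<le> r" for x t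
    using loc[rule_format, OF that] \<eta>2 by linarith+
  have lipschitz: "\<bar>\<psi> (x, t) - \<psi> (y, t)\<bar> \<le> \<beta> / 2 * dist x y"
    if "dist x0 x \<le> r" "dist x0 y \<le> r" "\<bar>t - t0\<bar> \<le> r" for x y t
  proof -
    have "norm (\<psi> (x, t) - \<psi> (y, t)) \<le> \<beta> / 2 * norm (x - y)"
    proof (rule differentiable_bound[of "cball x0 r" "\<lambda>x. \<psi> (x, t)" "\<lambda>x v. G1 (x, t) \<bullet> v"])
      fix x assume x: "x \<in> cball x0 r"
      show "((\<lambda>x. \<psi> (x, t)) has_derivative (\<lambda>v. G1 (x, t) \<bullet> v)) (at x within cball x0 r)"
        using S(1) by (rule has_derivative_at_withinI)
      have "norm (G1 (x, t)) \<le> \<beta> / 2" using bG[of x t] x that by simp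
      then show "onorm (\<lambda>v. G1 (x, t) \<bullet> v) \<le> \<beta> / 2"
        by (intro onorm_le) (metis Cauchy_Schwarz_ineq2 mult_right_mono norm_ge_zero order_trans real_norm_def)
    qed (use that in auto)
    then show ?thesis by (simp add: dist_norm)
  qed
  define m0 where "m0 = w (x0, t0) - \<psi> (x0, t0)"
  have low: "m0 + norm (x - x0) ^ 4 + (t - t0) ^ 4 \<le> w (x, t) - \<psi> (x, t)"
    if "dist x0 x \<le> r" "\<bar>t - t0\<bar> \<le> r" for x t
  proof -
    have "w (x0, t0) - \<phi> (x0, t0) \<le> w (x, t) - \<phi> (x, t)"
      using that r bt[OF that(2)] by (intro min) auto
    then show ?thesis by (simp add: \<psi>_def m0_def at0 quart_norm)
  qed
  \<comment> \<open>The penalty \<open>N\<close> defined from \<open>\<delta>\<close> forces |x1 -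
    y1| \<le> \<delta>; the last bound then keeps the minimum within \<open>r / 4\<close> of
    \<open>(x0, t0)\<close> in space and in time.\<close>
  obtain \<delta> where \<delta>: "0 < \<delta>" "\<delta> \<le> r / 8" "\<delta> \<le> (r / 4) ^ 4 / \<beta>"
    using positive_lower_bound[of "[r / 8, (r / 4) ^ 4 / \<beta>]"] r(1) \<beta> by auto
  define N where "N = \<beta> / \<delta> ^ 3"
  have N: "0 < N" using \<beta> \<delta> by (simp add: N_def)
  define K where "K = cball x0 r \<times> cball x0 r \<times> {t0 - r..t0 + r}"
  define \<Phi> where "\<Phi> = (\<lambda>(x, y, t). w (x, t) - \<psi> (y, t) + N * quart (x - y))"
  have "compact K" unfolding K_def by (intro compact_Times) auto
  moreover have "(x0, x0, t0) \<in> K" using r by (simp add: K_def)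
  moreover have "continuous_on K \<Phi>"
  proof -
    have "continuous_on K (\<lambda>(x, y, t). w (x, t))"
      unfolding split_def
    proof (intro continuous_on_compose2[OF cont] continuous_intros)
      show "(\<lambda>x. (fst x, snd (snd x))) ` K \<subseteq> UNIV \<times> {0..<T}"
      proof
        fix y assume "y \<in> (\<lambda>x. (fst x, snd (snd x))) ` K"
        then obtain x t where y: "y = (x, t)" "\<bar>t - t0\<bar> \<le> r" by (auto simp: K_def abs_le_iff)
        then show "y \<in> UNIV \<times> {0..<T}" using bt[OF y(2)] by simp
      qed
    qed
    moreover have "continuous_on K (\<lambda>(x, y, t). \<psi> (y, t))"
      unfolding split_def by (intro continuous_on_compose2[OF S(4)] continuous_intros) auto
    ultimately show ?thesis unfolding \<Phi>_def split_def by (intro continuous_intros)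
  qed
  ultimately obtain z1 where z1: "z1 \<in> K" "\<And>z. z \<in> K \<Longrightarrow> \<Phi> z1 \<le> \<Phi> z"
    using continuous_attains_inf[of K \<Phi>] by blast
  obtain x1 y1 t1 where z1e: "z1 = (x1, y1, t1)" by (cases z1)
  have in1: "dist x0 x1 \<le> r" "dist x0 y1 \<le> r" "\<bar>t1 - t0\<bar> \<le> r"
    using z1(1) by (auto simp: K_def z1e)
  have min1: "w (x1, t1) - \<psi> (y1, t1) + N * quart (x1 - y1) \<le> w (x, t) - \<psi> (y, t) + N * quart (x - y)"
    if "dist x0 x \<le> r" "dist x0 y \<le> r" "\<bar>t - t0\<bar> \<le> r" for x y t
    using z1(2)[of "(x, y, t)"] that by (auto simp: K_def z1e \<Phi>_def abs_le_iff)
  define d where "d = dist x1 y1"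
  have d0: "0 \<le> d" by (simp add: d_def)
  \<comment> \<open>Comparison with the value at \<open>(x0, x0, t0)\<close>; evaluating
    \<open>\<psi>\<close> at \<open>y1\<close> instead of \<open>x1\<close> costs at most
    \<open>\<beta> / 2 * d\<close>.\<close>
  have ineq: "norm (x1 - x0) ^ 4 + (t1 - t0) ^ 4 + N * d ^ 4 \<le> \<beta> / 2 * d"
  proof -
    have q: "quart (x1 - y1) = d ^ 4" by (simp add: quart_norm d_def dist_norm)
    have "w (x1, t1) - \<psi> (y1, t1) + N * d ^ 4 \<le> m0"
      using min1[of x0 x0 t0] r unfolding q by (simp add: m0_def)
    then show ?thesis using low[OF in1(1,3)] lipschitz[OF in1, folded d_def] by linarith
  qed
  have nn: "0 \<le> norm (x1 - x0) ^ 4" "0 \<le> (t1 - t0) ^ 4" by auto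
  have d\<delta>: "d \<le> \<delta>"
  proof (rule ccontr)
    assume "\<not> d \<le> \<delta>"
    then have "\<delta> ^ 3 < d ^ 3" "0 < d" using \<delta> by (auto intro!: power_strict_mono)
    then have "\<beta> < N * d ^ 3" using \<beta> \<delta> by (simp add: N_def field_simps)
    then have "\<beta> * d < N * d ^ 3 * d" using \<open>0 < d\<close> by (intro mult_strict_right_mono)
    also have "\<dots> = N * d ^ 4" by (simp add: power_numeral_reduce)
    finally have "\<beta> * d < \<beta> / 2 * d" using ineq nn by linarith
    then show False using \<beta> \<open>0 < d\<close> by simp
  qed
  have small: "norm (x1 - x0) ^ 4 + (t1 - t0) ^ 4 < (r / 4) ^ 4"
  proof -
    have "\<beta> / 2 * d \<le> \<beta> / 2 * ((r / 4) ^ 4 / \<beta>)"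
      using d\<delta> \<delta>(3) \<beta> by (intro mult_left_mono) auto
    also have "\<dots> = (r / 4) ^ 4 / 2" using \<beta> by simp
    finally have "norm (x1 - x0) ^ 4 + (t1 - t0) ^ 4 + N * d ^ 4 \<le> (r / 4) ^ 4 / 2" using ineq by linarith
    moreover have "0 \<le> N * d ^ 4" using N d0 by simp
    moreover have "0 < (r / 4) ^ 4" using r(1) by simp
    ultimately show ?thesis by linarith
  qed
  have dx1: "dist x0 x1 < r / 4"
  proof -
    have "norm (x1 - x0) ^ 4 < (r / 4) ^ 4" using small nn by linarith
    then have "norm (x1 - x0) < r / 4" by (rule power_less_imp_less_base) (use r(1) in simp)
    then show ?thesis by (simp add: dist_norm norm_minus_commute)
  qed
  have dt1: "\<bar>t1 - t0\<bar> < r / 4"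
  proof -
    have "(t1 - t0) ^ 4 = \<bar>t1 - t0\<bar> ^ 4" by (simp add: power_even_abs)
    then have "\<bar>t1 - t0\<bar> ^ 4 < (r / 4) ^ 4" using small nn by linarith
    then show ?thesis by (rule power_less_imp_less_base) (use r(1) in simp)
  qed
  have dy1: "dist x0 y1 < r / 2"
    using dist_triangle[of x0 y1 x1] dx1 d\<delta> \<delta>(2) r(1) unfolding d_def by linarith
  have t1: "0 < t1" "t1 < T" using bt[OF in1(3)] by auto
  have U1: "ball x1 (r / 4) \<subseteq> U s" if "s < w (x1, t1) + \<gamma> / 2" for s
  proof -
    have "s < w (x0, t0) + \<gamma>" using that bw[OF in1(1,3)] by linarith
    then have "ball x0 r0 \<subseteq> U s" by (rule U)
    moreover have "ball x1 (r / 4) \<subseteq> ball x0 r0"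
    proof
      fix x assume "x \<in> ball x1 (r / 4)"
      then have "dist x1 x < r / 4" by simp
      then have "dist x0 x < r0" using dist_triangle[of x0 x x1] dx1 r(1,2) by linarith
      then show "x \<in> ball x0 r0" by simp
    qed
    ultimately show ?thesis by blast
  qed
  show False
  proof (cases "x1 = y1")
    case False
    \<comment> \<open>Freezing the difference of the two variables makes the penalty constant, so
      \<open>w\<close> minus the translate of \<open>\<psi>\<close> has a local minimum at
      \<open>(x1, t1)\<close>.\<close>
    define a where "a = y1 - x1"
    note st2 = smooth_test_translate[OF st1, of a]
    have a: "a \<noteq> 0" "x1 + a = y1" using False by (auto simp: a_def)
    \<comment> \<open>Stationarity in the second variable; the gradient of the penalty does not
      vanish since \<open>x1 \<noteq> y1\<close>.\<close>
    have gy: "G1 (y1, t1) = N *\<^sub>R quart_grad (y1 - x1)"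
    proof -
      let ?k = "\<lambda>y. N * quart (y - x1) - \<psi> (y, t1)"
      have dk: "(?k has_derivative (\<lambda>v. N * (quart_grad (y1 - x1) \<bullet> v) - G1 (y1, t1) \<bullet> v)) (at y1)"
        by (intro has_derivative_diff has_derivative_mult_right quart_deriv S(1))
      have "\<forall>y\<in>ball y1 (r / 2). ?k y1 \<le> ?k y"
      proof
        fix y assume "y \<in> ball y1 (r / 2)"
        then have "dist y1 y < r / 2" by simp
        then have "dist x0 y \<le> r" using dist_triangle[of x0 y y1] dy1 by linarith
        from min1[OF in1(1) this in1(3)] show "?k y1 \<le> ?k y"
          by (simp add: quart_norm norm_minus_commute)
      qed
      then have z: "(\<lambda>v. N * (quart_grad (y1 - x1) \<bullet> v) - G1 (y1, t1) \<bullet> v) = (\<lambda>v. 0)"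
        by (intro differential_zero_maxmin[OF _ open_ball dk]) (use r(1) in auto)
      let ?g = "N *\<^sub>R quart_grad (y1 - x1) - G1 (y1, t1)"
      have "?g \<bullet> ?g = 0" using fun_cong[OF z, of ?g] by (simp add: inner_diff_left)
      then show ?thesis by simp
    qed
    show False
    proof (rule no_strict_test_nonzero[OF st2 t1 _ _ U1, where \<gamma> = "\<gamma> / 2" and \<beta> = "\<beta> / 2" and c = c])
      show "0 < r / 4" "0 < \<gamma> / 2" using r \<gamma> by auto
      show "w (x1, t1) - \<psi> (fst (x1, t1) + a, snd (x1, t1)) \<le> w (x, t) - \<psi> (fst (x, t) + a, snd (x, t))"
        if "dist x1 x \<le> r / 4" "\<bar>t - t1\<bar> \<le> r / 4" for x t
      proof -
        have e: "dist y1 (x + a) = dist x1 x" by (simp add: dist_norm a_def)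
        have "dist x0 x \<le> r" using dist_triangle[of x0 x x1] dx1 that r(1) by linarith
        moreover have "dist x0 (x + a) \<le> r" using dist_triangle[of x0 "x + a" y1] dy1 that r(1) e by linarith
        moreover have "\<bar>t - t0\<bar> \<le> r" using that dt1 r(1) by linarith
        ultimately have "w (x1, t1) - \<psi> (y1, t1) + N * quart (x1 - y1) \<le> w (x, t) - \<psi> (x + a, t) + N * quart (x - (x + a))"
          by (rule min1)
        moreover have "x - (x + a) = x1 - y1" by (simp add: a_def)
        ultimately show ?thesis using a by simp
      qed
      show "G1 (fst (x1, t1) + a, snd (x1, t1)) \<noteq> 0"
        using a N gy False by (simp add: quart_grad_def)
      show "strict_test (\<lambda>z. G1 (fst z + a, snd z)) (\<lambda>z. H1 (fst z + a, snd z)) (\<lambda>z. p1 (fst z + a, snd z)) (x1, t1) (\<beta> / 2) c"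
        unfolding strict_test_def fst_conv snd_conv a(2)
      proof (intro conjI allI impI)
        show "0 < \<beta> / 2" by (rule \<beta>2)
        show "p1 (y1, t1) < - c" using bp[OF in1(2,3)] \<eta> by linarith
        fix q Y assume q: "q \<noteq> 0" "norm (q - G1 (y1, t1)) < \<beta> / 2" "norm (Y - H1 (y1, t1)) < \<beta> / 2" "transpose Y = Y"
        show "mcf_F q Y < c"
        proof (rule near[OF q(1) _ _ q(4)])
          show "norm q < \<beta>" using q(2) bG[OF in1(2,3)] norm_triangle_sub[of q "G1 (y1, t1)"] by linarith
          show "norm (Y - X) < \<beta>"
            using q(3) bH[OF in1(2,3)] norm_triangle_ineq[of "Y - H1 (y1, t1)" "H1 (y1, t1) - X"] by simp
        qed
      qed
    qed
  next
    case True
    define w1 where "w1 = w (x1, t1)"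
    \<comment> \<open>In the second variable, \<psi>(y, t1) - N |y - x1|^4 is maximal at
      \<open>x1\<close>, and the quartic has no second derivative there.\<close>
    have Hle: "H1 (x1, t1) $ i $ i \<le> 0" for i
    proof (rule DERIV2_nonpos_at_max)
      let ?e = "axis i (1::real) :: real^'n"
      show "((\<lambda>s. \<psi> (x1 + s *\<^sub>R ?e, t1) - N * s ^ 4) has_real_derivative
          G1 (x1 + s *\<^sub>R ?e, t1) \<bullet> ?e - N * (4 * s ^ 3)) (at s)" for s
      proof -
        have "((\<lambda>s. \<psi> (x1 + s *\<^sub>R ?e, t1)) has_derivative (\<lambda>u. G1 (x1 + s *\<^sub>R ?e, t1) \<bullet> (u *\<^sub>R ?e))) (at s)"
          by (rule has_derivative_compose[of "\<lambda>s. x1 + s *\<^sub>R ?e" "\<lambda>u. u *\<^sub>R ?e" s UNIV "\<lambda>x. \<psi> (x, t1)", OF _ S(1)])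
            (auto intro!: derivative_eq_intros)
        moreover have "(\<lambda>u. G1 (x1 + s *\<^sub>R ?e, t1) \<bullet> (u *\<^sub>R ?e)) = (*) (G1 (x1 + s *\<^sub>R ?e, t1) \<bullet> ?e)"
          by (rule ext) simp
        ultimately have "((\<lambda>s. \<psi> (x1 + s *\<^sub>R ?e, t1)) has_real_derivative G1 (x1 + s *\<^sub>R ?e, t1) \<bullet> ?e) (at s)"
          unfolding has_field_derivative_def by (simp only:)
        then show ?thesis by (auto intro!: derivative_eq_intros)
      qed
      show "((\<lambda>s. G1 (x1 + s *\<^sub>R ?e, t1) \<bullet> ?e - N * (4 * s ^ 3)) has_real_derivative H1 (x1, t1) $ i $ i) (at 0)"
      proof -
        have S3: "((\<lambda>x. G1 (x, t1)) has_derivative (\<lambda>v. H1 (x1, t1) *v v)) (at (x1 + 0 *\<^sub>R ?e))"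
          using S(3)[of t1 x1] by simp
        have "((\<lambda>s. G1 (x1 + s *\<^sub>R ?e, t1)) has_derivative (\<lambda>u. H1 (x1, t1) *v (u *\<^sub>R ?e))) (at 0)"
          by (rule has_derivative_compose[of "\<lambda>s. x1 + s *\<^sub>R ?e" "\<lambda>u. u *\<^sub>R ?e" 0 UNIV "\<lambda>x. G1 (x, t1)", OF _ S3])
            (auto intro!: derivative_eq_intros)
        from has_derivative_inner_left[OF this, of ?e]
        have "((\<lambda>s. G1 (x1 + s *\<^sub>R ?e, t1) \<bullet> ?e) has_derivative (\<lambda>u. (H1 (x1, t1) *v (u *\<^sub>R ?e)) \<bullet> ?e)) (at 0)" .
        moreover have "(\<lambda>u. (H1 (x1, t1) *v (u *\<^sub>R ?e)) \<bullet> ?e) = (*) (H1 (x1, t1) $ i $ i)"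
          by (rule ext) (simp add: matrix_vector_mult_scaleR inner_axis matrix_vector_mult_basis column_def)
        ultimately have "((\<lambda>s. G1 (x1 + s *\<^sub>R ?e, t1) \<bullet> ?e) has_real_derivative H1 (x1, t1) $ i $ i) (at 0)"
          unfolding has_field_derivative_def by (simp only:)
        then show ?thesis by (auto intro!: derivative_eq_intros)
      qed
      show "0 < r / 2" using r by simp
      show "\<psi> (x1 + s *\<^sub>R ?e, t1) - N * s ^ 4 \<le> \<psi> (x1 + 0 *\<^sub>R ?e, t1) - N * 0 ^ 4" if "\<bar>s\<bar> < r / 2" for s
      proof -
        have "dist x1 (x1 + s *\<^sub>R ?e) = \<bar>s\<bar>" by (simp add: dist_norm)
        then have "dist x0 (x1 + s *\<^sub>R ?e) \<le> r"
          using dist_triangle[of x0 "x1 + s *\<^sub>R ?e" x1] dx1 that r(1) by linarith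
        from min1[OF in1(1) this in1(3)] show ?thesis
          using True by (simp add: quart_norm power_even_abs)
      qed
    qed
    \<comment> \<open>For \<open>q\<close> along a coordinate axis, \<open>mcf_F q\<close> is minus
      the sum of the other diagonal entries, hence nonnegative, yet it is below \<open>c\<close>.
      Consequently \<open>\<psi>\<close> decreases in time at rate at least
      \<open>\<eta>\<close>.\<close>
    have c0: "0 < c"
    proof -
      obtain i :: 'n where True by blast
      define q where "q = (\<beta> / 2) *\<^sub>R (axis i 1 :: real^'n)"
      have nq: "norm q = \<beta> / 2" using \<beta> by (simp add: q_def)
      have "mcf_F q (H1 (x1, t1)) < c"
        by (rule near) (use \<beta> nq bH[OF in1(1,3)] S(8) in auto)
      moreover have "0 \<le> mcf_F q (H1 (x1, t1))"
      proof -
        have "q \<bullet> (H1 (x1, t1) *v q) / (norm q)\<^sup>2 = H1 (x1, t1) $ i $ i"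
          unfolding nq using \<beta>
          by (simp add: q_def matrix_vector_mult_scaleR inner_axis' matrix_vector_mult_basis column_def power2_eq_square)
        moreover have "trace (H1 (x1, t1)) \<le> H1 (x1, t1) $ i $ i"
        proof -
          have "trace (H1 (x1, t1)) = H1 (x1, t1) $ i $ i + (\<Sum>j\<in>UNIV - {i}. H1 (x1, t1) $ j $ j)"
            unfolding trace_def by (rule sum.remove) auto
          moreover have "(\<Sum>j\<in>UNIV - {i}. H1 (x1, t1) $ j $ j) \<le> 0" by (rule sum_nonpos) (rule Hle)
          ultimately show ?thesis by linarith
        qed
        ultimately show ?thesis unfolding mcf_F_eq by linarith
      qed
      ultimately show ?thesis by linarith
    qed
    define M where "M = 6 * real CARD('n) + 1"
    have M: "0 < M" by (simp add: M_def)
    \<comment> \<open>\<open>R2\<close> is the squared radius. With \<tau> = 4 N R^4 / \<eta> the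
      penalty on the ball is a quarter of the decrease \<open>\<eta> * \<tau>\<close>, and the
      barrier requirement \<tau> = O(R^2) holds for small R. The other bounds keep the ball and the
      time near the contact and the level below the obstacle.\<close>
    obtain R2 where R2: "0 < R2" "R2 \<le> (r / 4)\<^sup>2" "R2 \<le> \<eta> / (16 * N * M)" "R2 \<le> 1" "R2 \<le> \<gamma> / (2 * N)" "R2 \<le> r * \<eta> / (16 * N)"
      using positive_lower_bound[of "[(r / 4)\<^sup>2, \<eta> / (16 * N * M), 1, \<gamma> / (2 * N), r * \<eta> / (16 * N)]"] r(1) \<eta> N M \<gamma> by auto
    define R where "R = sqrt R2"
    have R: "0 < R" "R\<^sup>2 = R2" using R2 by (auto simp: R_def)
    have Rr: "R \<le> r / 4"
      using R2(2) r(1) unfolding R_def by (intro real_le_lsqrt) auto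
    have R22: "R2 * R2 \<le> R2" using R2(1,4) by (simp add: mult_left_le)
    define \<tau> where "\<tau> = 4 * N * (R2 * R2) / \<eta>"
    have \<tau>0: "0 < \<tau>" using N R2 \<eta> by (simp add: \<tau>_def)
    have \<eta>\<tau>: "\<eta> * \<tau> / 4 = N * R ^ 4"
      using \<eta> R(2) by (simp add: \<tau>_def power2_eq_square power_numeral_reduce algebra_simps)
    have \<tau>r: "\<tau> \<le> r / 4"
    proof -
      have "\<eta> * \<tau> = 4 * N * (R2 * R2)" using \<eta> by (simp add: \<tau>_def)
      also have "\<dots> \<le> 4 * N * R2" using R22 N by (intro mult_left_mono) auto
      also have "\<dots> \<le> 4 * N * (r * \<eta> / (16 * N))" using R2(6) N by (intro mult_left_mono) auto
      also have "\<dots> = \<eta> * (r / 4)" using N by simp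
      finally show ?thesis using \<eta> by simp
    qed
    have \<tau>\<gamma>: "\<eta> * \<tau> / 4 \<le> \<gamma> / 2"
    proof -
      have "\<eta> * \<tau> / 4 = N * (R2 * R2)" using \<eta> by (simp add: \<tau>_def)
      also have "\<dots> \<le> N * (\<gamma> / (2 * N))" using R22 R2(5) N by (intro mult_left_mono) auto
      also have "\<dots> = \<gamma> / 2" using N by simp
      finally show ?thesis .
    qed
    have \<tau>M: "2 * \<tau> * M \<le> R\<^sup>2 / 2"
    proof -
      have "2 * \<tau> * M = 8 * N * M / \<eta> * R2 * R2" by (simp add: \<tau>_def)
      also have "\<dots> \<le> 8 * N * M / \<eta> * R2 * (\<eta> / (16 * N * M))"
        using R2(1,3) N M \<eta> by (intro mult_left_mono) auto
      also have "\<dots> = R\<^sup>2 / 2" using N M \<eta> R(2) by (simp add: field_simps)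
      finally show ?thesis .
    qed
    have tb: "\<bar>t1 - \<tau> - t0\<bar> \<le> r" using dt1 \<tau>r \<tau>0 r(1) by linarith
    have t1\<tau>: "0 < t1 - \<tau>" "t1 - \<tau> < T" using bt[OF tb] by auto
    have high: "w1 + 3 * (\<eta> * \<tau> / 4) \<le> w (x, t1 - \<tau>)" if x: "dist x1 x \<le> R" for x
    proof -
      have x0x: "dist x0 x \<le> r" using dist_triangle[of x0 x x1] dx1 x Rr r(1) by linarith
      have "w1 - \<psi> (x1, t1) \<le> w (x, t1 - \<tau>) - \<psi> (x1, t1 - \<tau>) + N * quart (x - x1)"
        using min1[OF x0x in1(1) tb] True by (simp add: w1_def)
      moreover have "\<psi> (x1, t1) + \<eta> * \<tau> \<le> \<psi> (x1, t1 - \<tau>)"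
      proof -
        have "t1 - \<tau> < t1" using \<tau>0 by simp
        then obtain s where s: "t1 - \<tau> < s" "s < t1" "\<psi> (x1, t1) - \<psi> (x1, t1 - \<tau>) = (t1 - (t1 - \<tau>)) * p1 (x1, s)"
          using MVT2[of "t1 - \<tau>" t1 "\<lambda>t. \<psi> (x1, t)" "\<lambda>t. p1 (x1, t)"] S(2) by blast
        have "\<bar>s - t0\<bar> \<le> r" using s in1(3) tb by linarith
        then have "p1 (x1, s) \<le> - \<eta>" using bp[OF in1(1)] c0 by fastforce
        then have "\<tau> * p1 (x1, s) \<le> \<tau> * - \<eta>" using \<tau>0 by (intro mult_left_mono) auto
        then show ?thesis using s(3) by (simp add: algebra_simps)
      qed
      moreover have "N * quart (x - x1) \<le> \<eta> * \<tau> / 4"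
      proof -
        have "norm (x - x1) ^ 4 \<le> R ^ 4" using x by (intro power_mono) (auto simp: dist_norm norm_minus_commute)
        then show ?thesis unfolding \<eta>\<tau> quart_norm using N by (intro mult_left_mono) auto
      qed
      ultimately show ?thesis by linarith
    qed
    show False
    proof (rule ball_barrier[OF t1\<tau>(1) t1(2) _ \<tau>0 R(1)])
      \<comment> \<open>With this \<open>e\<close>, the gap 3 \<eta> \<tau> / 4 of
        \<open>high\<close> is 6 e.\<close>
      show "0 < \<eta> * \<tau> / 8" using \<eta> \<tau>0 by simp
      show "2 * \<tau> * (6 * real CARD('n) + 1) \<le> R\<^sup>2 / 2" using \<tau>M by (simp add: M_def)
      show "w (x1, t1) + 6 * (\<eta> * \<tau> / 8) \<le> w (x, t1 - \<tau>)" if "dist x1 x \<le> R" for x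
        using high[OF that] by (simp add: w1_def)
      have "w (x1, t1) + 2 * (\<eta> * \<tau> / 8) < w (x0, t0) + \<gamma>"
        using \<tau>\<gamma> bw[OF in1(1,3)] by linarith
      then have "ball x0 r0 \<subseteq> U (w (x1, t1) + 2 * (\<eta> * \<tau> / 8))" by (rule U)
      moreover have "ball x1 R \<subseteq> ball x0 r0"
      proof
        fix x assume "x \<in> ball x1 R"
        then have "dist x1 x < R" by simp
        then have "dist x0 x < r0" using dist_triangle[of x0 x x1] dx1 Rr r(1,2) by linarith
        then show "x \<in> ball x0 r0" by simp
      qed
      ultimately show "ball x1 R \<subseteq> U (w (x1, t1) + 2 * (\<eta> * \<tau> / 8))" by blast
    qed
  qed
qed

end

section \<open>From the discrete evolution to the abstract scheme\<close>

lemma mcf_filter_eventually: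
  fixes p :: "real^'n"
  assumes "\<forall>\<^sub>F z in mcf_filter p X. Q z"
  obtains \<beta> where "0 < \<beta>"
    "\<And>q Y. \<lbrakk>q \<noteq> 0; norm (q - p) < \<beta>; norm (Y - X) < \<beta>; transpose Y = Y\<rbrakk> \<Longrightarrow> Q (q, Y)"
proof -
  from assms obtain d where d: "0 < d"
    "\<And>z. dist z (p, X) < d \<Longrightarrow> z \<in> {(q, Y). q \<noteq> 0 \<and> transpose Y = Y} \<Longrightarrow> Q z"
    unfolding mcf_filter_def eventually_inf_principal eventually_nhds_metric by blast
  have "Q (q, Y)" if "q \<noteq> 0" "norm (q - p) < d / 2" "norm (Y - X) < d / 2" "transpose Y = Y" for q Y
  proof (rule d(2))
    have "dist (q, Y) (p, X) \<le> dist q p + dist Y X"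
      unfolding dist_Pair_Pair by (rule sqrt_sum_squares_le_sum) auto
    also have "\<dots> < d" using that by (simp add: dist_norm)
    finally show "dist (q, Y) (p, X) < d" .
  qed (use that in simp)
  then show ?thesis using that[of "d / 2"] d(1) by simp
qed

lemma discrete_evolution_sublevels:
  assumes de: "discrete_evolution T u0 up h v" and s: "s \<in> {-1..1}"
  shows "\<exists>G. G 0 = {x. u0 x \<le> s} \<and> (\<forall>k. flow_step {x. up x \<le> s} h (G k) (G (Suc k))) \<and>
      (\<forall>t\<in>{0..<T}. {x. v (x, t) \<le> s} = G (nat \<lfloor>t / h\<rfloor>))"
  by (rule bspec[OF conjunct2[OF de[unfolded discrete_evolution_def]] s])

lemma discrete_evolution_levels:
  assumes de: "discrete_evolution T u0 up h v" and h: "0 < h" and s: "s \<in> {-1..1}"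
  shows "\<exists>G. G 0 = {x. u0 x \<le> s} \<and> (\<forall>k. flow_step {x. up x \<le> s} h (G k) (G (Suc k))) \<and>
      (\<forall>k. real k * h < T \<longrightarrow> {x. v (x, real k * h) \<le> s} = G k)"
proof -
  obtain G where G: "G 0 = {x. u0 x \<le> s} \<and> (\<forall>k. flow_step {x. up x \<le> s} h (G k) (G (Suc k))) \<and>
      (\<forall>t\<in>{0..<T}. {x. v (x, t) \<le> s} = G (nat \<lfloor>t / h\<rfloor>))"
    using discrete_evolution_sublevels[OF de s] by (elim exE)
  have "{x. v (x, real k * h) \<le> s} = G k" if "real k * h < T" for k
    using bspec[OF conjunct2[OF conjunct2[OF G]], of "real k * h"] that h by simp
  then show ?thesis using G by (intro exI[of _ G]) simp
qed

lemma discrete_evolution_range: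
  assumes "discrete_evolution T u0 up h v" "0 \<le> t" "t < T"
  shows "v (x, t) \<in> {-1..1}"
  using assms unfolding discrete_evolution_def by simp

lemma eq_from_sublevels:
  fixes a b :: real
  assumes "a \<in> {-1..1}" "b \<in> {-1..1}" "\<And>s. s \<in> {-1..1} \<Longrightarrow> a \<le> s \<longleftrightarrow> b \<le> s"
  shows "a = b"
  using assms(3)[of a] assms(3)[of b] assms(1,2) by (intro antisym) auto

text \<open>Values in [-1, 1] are determined by the sublevel sets at levels in that interval, and
  these depend on \<open>t\<close> only through the number of completed steps.\<close>

lemma discrete_evolution_time_steps:
  assumes de: "discrete_evolution T u0 up h v" and h: "0 < h" and t: "0 \<le> t" "t < T"
  shows "v (x, t) = v (x, real (nat \<lfloor>t / h\<rfloor>) * h)"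
proof -
  let ?k = "nat \<lfloor>t / h\<rfloor>"
  have "real ?k * h \<le> t"
  proof -
    have "real ?k \<le> t / h" using t h by simp
    then show ?thesis using h by (simp add: pos_le_divide_eq)
  qed
  then have kT: "real ?k * h < T" using t by simp
  show ?thesis
  proof (rule eq_from_sublevels)
    show "v (x, t) \<in> {-1..1}" "v (x, real ?k * h) \<in> {-1..1}"
      using discrete_evolution_range[OF de] t kT h by auto
    fix s :: real assume s: "s \<in> {-1..1}"
    obtain G where "G 0 = {x. u0 x \<le> s} \<and> (\<forall>k. flow_step {x. up x \<le> s} h (G k) (G (Suc k))) \<and>
      (\<forall>t\<in>{0..<T}. {x. v (x, t) \<le> s} = G (nat \<lfloor>t / h\<rfloor>))"
      using discrete_evolution_sublevels[OF de s] by (elim exE)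
    note G = bspec[OF conjunct2[OF conjunct2[OF this]]]
    have "{x. v (x, t) \<le> s} = {x. v (x, real ?k * h) \<le> s}"
      using G[of t] G[of "real ?k * h"] t kT h by simp
    then show "v (x, t) \<le> s \<longleftrightarrow> v (x, real ?k * h) \<le> s" by blast
  qed
qed

text \<open>Levels outside [-1, 1] arise as a value plus a small defect; constant families
  \<open>{}\<close> or \<open>UNIV\<close> serve there.\<close>

lemma cut_steps_trivial_level:
  fixes f :: "nat \<Rightarrow> real^'n \<Rightarrow> real"
  assumes range: "\<And>k x. P k \<Longrightarrow> f k x \<in> {-1..1}" and s: "s \<notin> {-1..1}"
  shows "\<exists>D. (\<forall>k. P k \<longrightarrow> {x. f k x < s} \<subseteq> D k \<and> D k \<subseteq> {x. f k x \<le> s}) \<and>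
    (\<forall>k. cut_step h U (D k) (D (Suc k)))"
proof (cases "s < -1")
  case True
  have "{x. f k x < s} = {}" if "P k" for k
    using range[OF that] True by (auto simp: not_less) (meson less_imp_le order_trans)
  then show ?thesis by (intro exI[of _ "\<lambda>_. {}"]) (simp add: cut_step_def)
next
  case False
  then have "1 < s" using s by auto
  have "{x. f k x \<le> s} = UNIV" if "P k" for k
    using range[OF that] \<open>1 < s\<close> by (auto intro: order_trans less_imp_le)
  then show ?thesis by (intro exI[of _ "\<lambda>_. UNIV"]) (simp add: cut_step_def)
qed

theorem proposition11:
  fixes u0 up :: "real^'n \<Rightarrow> real"
    and T :: real
    and uh :: "real \<Rightarrow> (real^'n) \<times> real \<Rightarrow> real"
    and hs :: "nat \<Rightarrow> real"
    and u :: "(real^'n) \<times> real \<Rightarrow> real"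
  assumes T_pos: "0 < T"
    and u0_range: "\<And>x. u0 x \<in> {-1..1}"
    and u0_unif_cont: "uniformly_continuous_on UNIV u0"
    and u0_hull: "\<And>s. s \<in> {-1..1} \<Longrightarrow> minimizing_hull {x. u0 x \<le> s}"
    and up_range: "\<And>x. up x \<in> {-1..1}"
    and up_unif_cont: "uniformly_continuous_on UNIV up"
    and u0_le_up: "\<And>x. u0 x \<le> up x"
    and uh_evolution: "\<And>h. 0 < h \<Longrightarrow> discrete_evolution T u0 up h (uh h)"
    and hs_pos: "\<And>k. 0 < hs k"
    and hs_lim: "hs \<longlonglongrightarrow> 0"
    and u_limit: "\<And>K. compact K \<Longrightarrow> K \<subseteq> UNIV \<times> {0..<T} \<Longrightarrow>
                   uniform_limit K (\<lambda>k. uh (hs k)) u sequentially"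
    and u_unif_cont: "uniformly_continuous_on (UNIV \<times> {0..<T}) u"
  shows "mcf_viscosity_solution T (\<lambda>z. -1) (\<lambda>(x, t). up x) u0 u"
proof -
  have cont: "continuous_on (UNIV \<times> {0..<T}) u"
    using u_unif_cont by (rule uniformly_continuous_imp_continuous)
  have pointwise: "(\<lambda>k. uh (hs k) (x, t)) \<longlonglongrightarrow> u (x, t)" if "0 \<le> t" "t < T" for x t
    by (rule tendsto_uniform_limitI[OF u_limit[of "{(x, t)}"]]) (use that in auto)
  have lower: "-1 \<le> u z" if zT: "z \<in> UNIV \<times> {0..<T}" for z
  proof -
    obtain x t where z: "z = (x, t)" "0 \<le> t" "t < T" using zT by (cases z) auto
    show ?thesis unfolding z(1)
      by (rule LIMSEQ_le_const[OF pointwise[OF z(2,3)]])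
        (use discrete_evolution_range[OF uh_evolution[OF hs_pos] z(2,3)] in auto)
  qed
  \<comment> \<open>At the level \<open>up x\<close> the point \<open>x\<close> belongs to the
    obstacle set and hence to every iterate.\<close>
  have uh_le: "uh h (x, t) \<le> up x" if h: "0 < h" and t: "0 \<le> t" "t < T" for h x t
  proof -
    obtain G where G': "G 0 = {x'. u0 x' \<le> up x} \<and> (\<forall>k. flow_step {x'. up x' \<le> up x} h (G k) (G (Suc k))) \<and>
      (\<forall>t\<in>{0..<T}. {x'. uh h (x', t) \<le> up x} = G (nat \<lfloor>t / h\<rfloor>))"
      using discrete_evolution_sublevels[OF uh_evolution[OF h] up_range[of x]] by (elim exE)
    note G = conjunct1[OF G'] spec[OF conjunct1[OF conjunct2[OF G']]] bspec[OF conjunct2[OF conjunct2[OF G']]]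
    have "x \<in> G k" for k
      using G(1) u0_le_up flow_stepD(4)[OF G(2)] by (cases k) auto
    then show ?thesis using G(3)[of t] t by auto
  qed
  have upper: "u z \<le> (\<lambda>(x, t). up x) z" if zT: "z \<in> UNIV \<times> {0..<T}" for z
  proof -
    obtain x t where z: "z = (x, t)" "0 \<le> t" "t < T" using zT by (cases z) auto
    show ?thesis unfolding z(1) split_conv
      by (rule LIMSEQ_le_const2[OF pointwise[OF z(2,3)]]) (use uh_le[OF hs_pos z(2,3)] in auto)
  qed
  have init: "u (x, 0) = u0 x" for x
  proof -
    have "uh h (x, 0) = u0 x" if h: "0 < h" for h
    proof (rule eq_from_sublevels)
      show "uh h (x, 0) \<in> {-1..1}" "u0 x \<in> {-1..1}"
        using discrete_evolution_range[OF uh_evolution[OF h], of 0] T_pos u0_range by auto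
      fix s :: real assume s: "s \<in> {-1..1}"
      obtain G where G: "G 0 = {x. u0 x \<le> s} \<and> (\<forall>k. flow_step {x. up x \<le> s} h (G k) (G (Suc k))) \<and>
        (\<forall>k. real k * h < T \<longrightarrow> {x. uh h (x, real k * h) \<le> s} = G k)"
        using discrete_evolution_levels[OF uh_evolution[OF h] h s] by (elim exE)
      have "{x. uh h (x, 0) \<le> s} = {x. u0 x \<le> s}"
        using conjunct1[OF G] spec[OF conjunct2[OF conjunct2[OF G]], of 0] T_pos by simp
      then show "uh h (x, 0) \<le> s \<longleftrightarrow> u0 x \<le> s" by blast
    qed
    then have "(\<lambda>k. u0 x) \<longlonglongrightarrow> u (x, 0)" using pointwise[of 0 x] T_pos hs_pos by simp
    then show ?thesis by (simp add: LIMSEQ_const_iff)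
  qed
  have steps: "\<exists>\<Omega> F. flow_step \<Omega> h {x. u0 x \<le> s} F" if "s \<in> {-1..1}" "0 < h" for s h
    using discrete_evolution_levels[OF uh_evolution[OF that(2)] that(2,1)] by metis
  have cut_steps: "cut_step h {x. s < up x} (G k) (G (Suc k))" "cut_step h UNIV (- G k) (- G (Suc k))"
    if "s \<in> {-1..1}" "0 < h" "G 0 = {x. u0 x \<le> s}" "\<And>k. flow_step {x. up x \<le> s} h (G k) (G (Suc k))" for s h G k
    using discrete_evolution_cut_steps[OF u0_unif_cont u0_range u0_hull u0_le_up steps _ _ that(3,4)] that(1,2)
    by simp_all

  interpret super: scheme_limit T "\<lambda>s. {x. s < up x}" hs "\<lambda>k. uh (hs k)" u
  proof
    fix j and s :: real
    let ?v = "\<lambda>k x. uh (hs j) (x, real k * hs j)"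
    have range: "?v k x \<in> {-1..1}" if "real k * hs j < T" for k x
      using discrete_evolution_range[OF uh_evolution[OF hs_pos[of j]], of "real k * hs j"] that hs_pos[of j]
      by simp
    show "\<exists>D. (\<forall>k. real k * hs j < T \<longrightarrow> {x. ?v k x < s} \<subseteq> D k \<and> D k \<subseteq> {x. ?v k x \<le> s}) \<and>
        (\<forall>k. cut_step (hs j) {x. s < up x} (D k) (D (Suc k)))"
    proof (cases "s \<in> {-1..1}")
      case True
      obtain G where G': "G 0 = {x. u0 x \<le> s} \<and> (\<forall>k. flow_step {x. up x \<le> s} (hs j) (G k) (G (Suc k))) \<and>
        (\<forall>k. real k * hs j < T \<longrightarrow> {x. ?v k x \<le> s} = G k)"
        using discrete_evolution_levels[OF uh_evolution[OF hs_pos] hs_pos[of j] True] by (elim exE)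
      note G = conjunct1[OF G'] spec[OF conjunct1[OF conjunct2[OF G']]] spec[OF conjunct2[OF conjunct2[OF G']], THEN mp]
      show ?thesis
      proof (intro exI[of _ G] conjI allI impI)
        show "cut_step (hs j) {x. s < up x} (G k) (G (Suc k))" for k
          by (rule cut_steps(1)[OF True hs_pos G(1,2)])
        show "{x. ?v k x < s} \<subseteq> G k" "G k \<subseteq> {x. ?v k x \<le> s}" if "real k * hs j < T" for k
          unfolding G(3)[OF that, symmetric] by auto
      qed
    next
      case False
      show ?thesis by (rule cut_steps_trivial_level[OF range False])
    qed
  next
    show "uh (hs j) (x, t) = uh (hs j) (x, real (nat \<lfloor>t / hs j\<rfloor>) * hs j)" if "0 \<le> t" "t < T" for j x t
      by (rule discrete_evolution_time_steps[OF uh_evolution[OF hs_pos] hs_pos that])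
  qed (use hs_pos hs_lim u_limit cont in auto)

  \<comment> \<open>The family at level \<open>s\<close> consists of the complements of the iterates
    at level \<open>- s\<close>.\<close>
  interpret sub: scheme_limit T "\<lambda>s. UNIV" hs "\<lambda>k z. - uh (hs k) z" "\<lambda>z. - u z"
  proof
    fix j and s :: real
    let ?v = "\<lambda>k x. - uh (hs j) (x, real k * hs j)"
    have range: "?v k x \<in> {-1..1}" if "real k * hs j < T" for k x
      using discrete_evolution_range[OF uh_evolution[OF hs_pos[of j]], of "real k * hs j" x] that hs_pos[of j]
      by simp
    show "\<exists>D. (\<forall>k. real k * hs j < T \<longrightarrow> {x. ?v k x < s} \<subseteq> D k \<and> D k \<subseteq> {x. ?v k x \<le> s}) \<and>
        (\<forall>k. cut_step (hs j) UNIV (D k) (D (Suc k)))"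
    proof (cases "s \<in> {-1..1}")
      case True
      then have s: "- s \<in> {-1..1}" by auto
      obtain G where G': "G 0 = {x. u0 x \<le> - s} \<and> (\<forall>k. flow_step {x. up x \<le> - s} (hs j) (G k) (G (Suc k))) \<and>
        (\<forall>k. real k * hs j < T \<longrightarrow> {x. uh (hs j) (x, real k * hs j) \<le> - s} = G k)"
        using discrete_evolution_levels[OF uh_evolution[OF hs_pos] hs_pos[of j] s] by (elim exE)
      note G = conjunct1[OF G'] spec[OF conjunct1[OF conjunct2[OF G']]] spec[OF conjunct2[OF conjunct2[OF G']], THEN mp]
      show ?thesis
      proof (intro exI[of _ "\<lambda>k. - G k"] conjI allI impI)
        show "cut_step (hs j) UNIV (- G k) (- G (Suc k))" for k
          by (rule cut_steps(2)[OF s hs_pos G(1,2)])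
        show "{x. ?v k x < s} \<subseteq> - G k" "- G k \<subseteq> {x. ?v k x \<le> s}" if "real k * hs j < T" for k
          unfolding G(3)[OF that, symmetric] by auto
      qed
    next
      case False
      show ?thesis by (rule cut_steps_trivial_level[OF range False])
    qed
  next
    show "- uh (hs j) (x, t) = - uh (hs j) (x, real (nat \<lfloor>t / hs j\<rfloor>) * hs j)" if "0 \<le> t" "t < T" for j x t
      using discrete_evolution_time_steps[OF uh_evolution[OF hs_pos] hs_pos that] by simp
  next
    show "uniform_limit K (\<lambda>k z. - uh (hs k) z) (\<lambda>z. - u z) sequentially"
      if "compact K" "K \<subseteq> UNIV \<times> {0..<T}" for K
      using u_limit[OF that] by (rule uniform_limit_uminus)
  qed (use hs_pos hs_lim cont in \<open>auto intro: continuous_on_minus\<close>)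

  have usc: "upper_semicont_on (UNIV \<times> {0..<T}) u" and lsc: "lower_semicont_on (UNIV \<times> {0..<T}) u"
    using cont unfolding upper_semicont_on_def lower_semicont_on_def continuous_on_def
    by (blast intro: order_tendstoD)+

  have super_ineq: "0 \<le> ereal (time_deriv \<phi> z) + mcf_F_upper (space_grad \<phi> z) (space_hess \<phi> z)"
    if z: "z \<in> UNIV \<times> {0<..<T}" and \<phi>: "C2 \<phi>"
      and min: "\<forall>y\<in>UNIV \<times> {0..<T}. u z - \<phi> z \<le> u y - \<phi> y"
      and obst: "u z < (\<lambda>(x, t). up x) z" for \<phi> z
  proof (rule ccontr)
    obtain x0 t0 where z0: "z = (x0, t0)" "0 < t0" "t0 < T" using z by (cases z) auto
    assume "\<not> ?thesis"
    then have "mcf_F_upper (space_grad \<phi> z) (space_hess \<phi> z) < ereal (- time_deriv \<phi> z)"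
      by (cases "mcf_F_upper (space_grad \<phi> z) (space_hess \<phi> z)") auto
    \<comment> \<open>A real number strictly in between turns the failed inequality into one that
      holds on a whole neighbourhood, as \<open>strict_test\<close> demands.\<close>
    then obtain c where c: "mcf_F_upper (space_grad \<phi> z) (space_hess \<phi> z) < ereal c" "c < - time_deriv \<phi> z"
      using ereal_dense2 by force
    have "\<forall>\<^sub>F (q, Y) in mcf_filter (space_grad \<phi> z) (space_hess \<phi> z). ereal (mcf_F q Y) < ereal c"
      using Limsup_lessD[OF c(1)[unfolded mcf_F_upper_def]] by (simp add: split_def)
    then obtain \<beta> where "strict_test (space_grad \<phi>) (space_hess \<phi>) (time_deriv \<phi>) z \<beta> c"
      unfolding strict_test_def using c(2) by (elim mcf_filter_eventually) auto
    \<comment> \<open>Contact takes place strictly below the obstacle: near \<open>x0\<close>, all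
      levels up to the midpoint of \<open>u z\<close> and \<open>up x0\<close> remain below
      \<open>up\<close>.\<close>
    moreover obtain r where r: "0 < r" "\<And>x. dist x0 x < r \<Longrightarrow> (u z + up x0) / 2 < up x"
    proof -
      have "isCont up x0"
        using uniformly_continuous_imp_continuous[OF up_unif_cont] by (simp add: continuous_on_eq_continuous_at)
      then have "\<forall>\<^sub>F x in at x0. (u z + up x0) / 2 < up x"
        using obst z0(1) by (intro order_tendstoD(1)[of up "up x0"]) (auto simp: isCont_def)
      then obtain r where "0 < r" "\<And>x. x \<noteq> x0 \<Longrightarrow> dist x x0 < r \<Longrightarrow> (u z + up x0) / 2 < up x"
        by (auto simp: eventually_at)
      moreover have "(u z + up x0) / 2 < up x0" using obst z0(1) by simp
      ultimately show ?thesis using that[of r] by (metis dist_commute)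
    qed
    moreover have "0 < (up x0 - u z) / 2" using obst z0(1) by simp
    ultimately show False
    proof (intro super.no_strict_test[OF smooth_test_C2[OF \<phi>] z0(2,3) r(1), where \<gamma> = "(up x0 - u z) / 2" and ?x0.0 = x0 and \<beta> = \<beta> and c = c])
      show "ball x0 r \<subseteq> {x. s < up x}" if "s < u (x0, t0) + (up x0 - u z) / 2" for s
      proof
        fix x assume "x \<in> ball x0 r"
        then have "(u z + up x0) / 2 < up x" using r(2)[of x] by simp
        moreover have "u z + (up x0 - u z) / 2 = (u z + up x0) / 2" by (simp add: field_simps)
        ultimately have "s < up x" using that unfolding z0(1)[symmetric] by linarith
        then show "x \<in> {x. s < up x}" by simp
      qed
    qed (use min z0 in auto)
  qed

  have sub_ineq: "ereal (time_deriv \<phi> z) + mcf_F_lower (space_grad \<phi> z) (space_hess \<phi> z) \<le> 0"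
    if z: "z \<in> UNIV \<times> {0<..<T}" and \<phi>: "C2 \<phi>"
      and max: "\<forall>y\<in>UNIV \<times> {0..<T}. u y - \<phi> y \<le> u z - \<phi> z" for \<phi> z
  proof (rule ccontr)
    obtain x0 t0 where z0: "z = (x0, t0)" "0 < t0" "t0 < T" using z by (cases z) auto
    assume "\<not> ?thesis"
    then have "ereal (- time_deriv \<phi> z) < mcf_F_lower (space_grad \<phi> z) (space_hess \<phi> z)"
      by (cases "mcf_F_lower (space_grad \<phi> z) (space_hess \<phi> z)") auto
    then obtain c where c: "ereal c < mcf_F_lower (space_grad \<phi> z) (space_hess \<phi> z)" "- time_deriv \<phi> z < c"
      using ereal_dense2 by force
    have "\<forall>\<^sub>F (q, Y) in mcf_filter (space_grad \<phi> z) (space_hess \<phi> z). ereal c < ereal (mcf_F q Y)"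
      using less_LiminfD[OF c(1)[unfolded mcf_F_lower_def]] by (simp add: split_def)
    then obtain \<beta> where \<beta>: "0 < \<beta>" "\<And>q Y. \<lbrakk>q \<noteq> 0; norm (q - space_grad \<phi> z) < \<beta>; norm (Y - space_hess \<phi> z) < \<beta>;
        transpose Y = Y\<rbrakk> \<Longrightarrow> c < mcf_F q Y"
      by (elim mcf_filter_eventually) auto
    have "mcf_F q Y < - c" if "q \<noteq> 0" "norm (q - - space_grad \<phi> z) < \<beta>" "norm (Y - - space_hess \<phi> z) < \<beta>"
      "transpose Y = Y" for q Y
    proof -
      have "c < mcf_F (- q) (- Y)"
      proof (rule \<beta>(2))
        show "norm (- q - space_grad \<phi> z) < \<beta>" "norm (- Y - space_hess \<phi> z) < \<beta>"
          using that(2,3) norm_minus_cancel[of "- q - space_grad \<phi> z"] norm_minus_cancel[of "- Y - space_hess \<phi> z"]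
          by (simp_all add: algebra_simps)
      qed (use that in \<open>auto simp: transpose_minus\<close>)
      then show ?thesis by (simp add: mcf_F_uminus)
    qed
    then have "strict_test (\<lambda>z. - space_grad \<phi> z) (\<lambda>z. - space_hess \<phi> z) (\<lambda>z. - time_deriv \<phi> z) (x0, t0) \<beta> (- c)"
      using \<beta>(1) c(2) z0(1) by (auto simp: strict_test_def)
    then show False
    \<comment> \<open>Radius and margin are set to 1, the free region being the whole space at every
      level.\<close>
    proof (rule sub.no_strict_test[OF smooth_test_uminus[OF smooth_test_C2[OF \<phi>]] z0(2,3) zero_less_one zero_less_one, rotated 2])
      show "- u (x0, t0) - - \<phi> (x0, t0) \<le> - u (x, t) - - \<phi> (x, t)" if "0 \<le> t" "t < T" for x t
        using bspec[OF max, of "(x, t)"] that z0(1) by simp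
    qed simp
  qed

  show ?thesis
    unfolding mcf_viscosity_solution_def mcf_subsolution_def mcf_supersolution_def
    using usc lsc lower upper init super_ineq sub_ineq by auto
qed

end
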